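(* Let $C\subset\mathbb{R}^d$ be a closed convex cone with $\emptyset\subsetneq C\subsetneq\mathbb{R}^d$. Let $\delta=E[V_C]$ and $\tau^2=\mathrm{Var}(V_C)$ with $\tau>0$, let $F$ be the distribution function of $(V_C-\delta)/\tau$, let $\Phi(u)=P[N\le u]$ with $N\sim\mathcal{N}(0,1)$, and set $$\eta=\sup_{u\in\mathbb{R}}|F(u)-\Phi(u)|.$$ Then $$\eta\le\frac{1}{108}\left(\frac{\tau}{\delta^3}\vee\frac{1}{\delta^{8/3}}\right)^{\frac{3}{16}}\left(\log^+\left(\frac{\tau^3}{\delta}\right)\right)^{\frac32}\log^+\left(\frac{\tau^2}{144\,\delta}\log^+\left(\frac{\tau^3}{\delta}\right)\right)+48\sqrt{\frac{\delta}{\tau^2\log^+\left(\frac{\tau^3}{\delta}\right)}}.$$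
   Context: $a\vee b=\max\{a,b\}$, and $\log^+x=\max(\log x,0)$ (with $\log^+0=0$); a quotient with positive numerator and zero denominator is read as $+\infty$. For a non-empty closed convex cone $C\subset\mathbb{R}^d$, $\Pi_C(\mathbf{x})$ denotes the metric projection of $\mathbf{x}$ onto $C$ and $C^0=\{\mathbf{y}:\langle\mathbf{y},\mathbf{x}\rangle\le0\ \forall\mathbf{x}\in C\}$ is the polar cone. The conic intrinsic volumes $v_0,\dots,v_d$ of $C$ are the uniquely determined nonnegative numbers summing to one such that, for $\mathbf{g}\sim\mathcal{N}(0,I_d)$ and every bounded measurable $f:\mathbb{R}_+^2\to\mathbb{R}$, $$E f(\|\Pi_C(\mathbf{g})\|^2,\|\Pi_{C^0}(\mathbf{g})\|^2)=\sum_{j=0}^d v_j\,E f(Y_j,Y'_{d-j}),$$ where the $Y_j,Y_j'$ are independent with chi-squared distributions with $j$ degrees of freedom ($\chi^2_0$ is the point mass at $0$). $V_C$ denotes a random variable with $P(V_C=j)=v_j$, $j=0,\dots,d$. *)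

theory Defs
  imports "HOL-Probability.Probability"
begin

definition std_gaussian :: "(real ^ 'n) measure" where
  "std_gaussian = density lborel (\<lambda>x. ennreal (\<Prod>i\<in>UNIV. std_normal_density (x $ i)))"

(* For k = 0 the product measure sits on a single point and the sum is empty, so this is the
   point mass at 0. *)
definition chi_squared :: "nat \<Rightarrow> real measure" where
  "chi_squared k =
     distr (Pi\<^sub>M {..<k} (\<lambda>_. std_normal_distribution)) borel (\<lambda>x. \<Sum>i<k. (x i)\<^sup>2)"

definition polar_cone :: "'a::real_inner set \<Rightarrow> 'a set" where
  "polar_cone C = {y. \<forall>x\<in>C. y \<bullet> x \<le> 0}"

(* The defining property of the conic intrinsic volumes v 0, ..., v d of C; values of v beyond
   d = CARD('n) are irrelevant.  The test functions live on the whole plane: both sides only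
   evaluate f at points of the closed quadrant, and every bounded Borel function on the quadrant
   extends by zero.  The pair (Y, Y') of independent variables has the product measure as law. *)
definition conic_intrinsic_volumes :: "(real ^ 'n) set \<Rightarrow> (nat \<Rightarrow> real) \<Rightarrow> bool" where
  "conic_intrinsic_volumes C v \<longleftrightarrow>
     (\<forall>j\<le>CARD('n). 0 \<le> v j) \<and> (\<Sum>j\<le>CARD('n). v j) = 1 \<and>
     (\<forall>f :: real \<times> real \<Rightarrow> real. f \<in> borel_measurable borel \<and> bounded (range f) \<longrightarrow>
        (\<integral>g. f ((norm (closest_point C g))\<^sup>2, (norm (closest_point (polar_cone C) g))\<^sup>2)
            \<partial>std_gaussian) =
        (\<Sum>j\<le>CARD('n). v j *
           (\<integral>y. f y \<partial>(chi_squared j \<Otimes>\<^sub>M chi_squared (CARD('n) - j)))))"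

definition log_plus :: "real \<Rightarrow> real" where
  "log_plus x = (if x > 0 then max (ln x) 0 else 0)"

(* Square root on [0, \<infinity>]. *)
definition ereal_sqrt :: "ereal \<Rightarrow> ereal" where
  "ereal_sqrt x = (if x = \<infinity> then \<infinity> else ereal (sqrt (real_of_ereal x)))"

end

theory Submission
  imports Defs
begin

text \<open>
  Write \<open>P\<close> for the projection onto the cone \<open>C\<close>, \<open>G = |P|\<^sup>2\<close>, and let \<open>g\<close> be standard Gaussian.  The
  defining property of the intrinsic volumes says that \<open>G(g)\<close> is a chi-squared variable whose
  number of degrees of freedom is the random number \<open>V\<close>.  Comparing derivatives of characteristic
  functions at \<open>0\<close> gives \<open>E G = \<delta>\<close> and \<open>Var G = \<tau>\<^sup>2 + 2\<delta>\<close>.  The proof shows that \<open>G(g)\<close> is close to normal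
  and transfers this to \<open>V\<close>.

  The centred square of a standard normal variable has characteristic function \<open>exp(-t\<^sup>2)\<close> up to
  \<open>O(t\<^sup>3)\<close>, and \<open>V\<close> deviates from \<open>\<delta>\<close> by at most \<open>\<tau>\<close> on average.  Hence \<open>E exp(it(G - \<delta>))\<close> equals
  \<open>exp(-t\<^sup>2\<delta>) E exp(it(V - \<delta>))\<close> up to \<open>6\<delta>t\<^sup>3 + t\<^sup>2\<tau>\<close>.  Dividing by \<open>exp(-t\<^sup>2\<delta>)\<close> turns the Gaussian
  approximation of \<open>G\<close> into one of \<open>V\<close> (lemma \<open>intrinsic_volumes_char_normal\<close>).  The factor
  \<open>exp(t\<^sup>2\<delta>)\<close> lost here restricts the usable frequencies \<open>s = t\<tau>\<close> to \<open>s\<^sup>2\<delta>/\<tau>\<^sup>2\<close> at most a fraction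
  of the logarithm of \<open>\<tau>\<^sup>3/\<delta>\<close>; up to a constant, the rate in the theorem is the
  reciprocal of this largest frequency.

  The approximation of \<open>G\<close> is Stein's method: \<open>E \<kappa>(G)(G - \<delta>)\<close> equals \<open>Var G \<cdot> E \<kappa>'(G)\<close> up to
  \<open>4\<pi>\<^sup>2\<delta> sup|\<kappa>''|\<close> (lemma \<open>stein_bound\<close>).  For \<open>\<kappa> = cos, sin\<close> this is a linear differential
  equation, with small error, for the characteristic function of \<open>G - \<delta>\<close> (lemma \<open>\<phi>_gauss\<close>).
  Covariances of functions of \<open>g\<close> are estimated by rotating \<open>(g, g')\<close>, with \<open>g'\<close> an independent
  copy, from \<open>g\<close> to \<open>g'\<close> (lemma \<open>gauss_cov_bound\<close>).  Only one of the two functions is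
  differentiated; for the other one a local Lipschitz bound suffices, by integration by parts
  against the Gaussian weight (lemma \<open>gauss_ibp_approx\<close>).  This matters because \<open>P\<close>, the gradient
  of \<open>G/2\<close>, is merely Lipschitz.  The same estimate gives a Poincare inequality, \<open>\<tau>\<^sup>2 \<le> 5\<delta>\<close>.

  Esseen's smoothing argument with the Fejer kernel (lemma \<open>esseen_smoothing\<close>) finally converts
  closeness of characteristic functions on \<open>[-T, T]\<close> into closeness of distribution functions.
  The bound is at least \<open>1\<close> unless \<open>2304 \<delta> < \<tau>\<^sup>2 log(\<tau>\<^sup>3/\<delta>)\<close>.  As \<open>\<tau>\<^sup>2 \<le> 5\<delta>\<close>, in that case the logarithm
  exceeds \<open>460\<close>, so that everything except the smoothing error \<open>8/T\<close> is a negative power of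
  \<open>\<tau>\<^sup>3/\<delta>\<close> times a power of its logarithm, and is absorbed by the square-root term.
\<close>

section \<open>The standard Gaussian measure\<close>

abbreviation \<gamma> :: "(real ^ 'n) measure" where
  "\<gamma> \<equiv> std_gaussian"

abbreviation gauss_pair :: "((real ^ 'n) \<times> (real ^ 'n)) measure" (\<open>\<gamma>\<^sub>2\<close>) where
  "\<gamma>\<^sub>2 \<equiv> std_gaussian \<Otimes>\<^sub>M std_gaussian"

lemma prod_Basis_vec:
  fixes f :: "real \<Rightarrow> 'c::comm_monoid_mult" and x :: "real ^ 'n"
  shows "(\<Prod>b\<in>Basis. f (x \<bullet> b)) = (\<Prod>i\<in>UNIV. f (x $ i))"
proof -
  have B: "(Basis :: (real^'n) set) = (\<lambda>i. axis i 1) ` UNIV"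
    by (auto simp: Basis_vec_def)
  have inj: "inj (\<lambda>i::'n. axis i (1::real))"
    by (auto simp: inj_on_def axis_eq_axis)
  show ?thesis
    unfolding B by (subst prod.reindex[OF inj]) (simp add: inner_axis)
qed

lemma norm_square_vec: "(norm x)\<^sup>2 = (\<Sum>i\<in>UNIV. (x $ i)\<^sup>2)" for x :: "real ^ 'n"
  by (simp only: power2_norm_eq_inner inner_vec_def) (simp add: power2_eq_square)

lemma prod_std_normal_density:
  fixes x :: "real ^ 'n"
  shows "(\<Prod>i\<in>UNIV. std_normal_density (x $ i)) =
    (1 / sqrt (2 * pi)) ^ CARD('n) * exp (- (norm x)\<^sup>2 / 2)"
  by (simp add: norm_square_vec std_normal_density_def prod.distrib exp_sum sum_divide_distrib
    prod_dividef power_one_over flip: sum_negf)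

lemma sets_std_gaussian [simp, measurable_cong]: "sets \<gamma> = sets borel"
  by (simp add: std_gaussian_def)

lemma space_std_gaussian [simp]: "space \<gamma> = UNIV"
  by (simp add: std_gaussian_def)

lemma prob_space_std_gaussian: "prob_space (\<gamma> :: (real ^ 'n) measure)"
proof
  have "emeasure (\<gamma> :: (real ^ 'n) measure) UNIV =
      (\<integral>\<^sup>+x. ennreal (\<Prod>i\<in>UNIV. std_normal_density ((x :: real ^ 'n) $ i)) \<partial>lborel)"
    by (simp add: std_gaussian_def emeasure_density)
  also have "\<dots> = (\<integral>\<^sup>+x. (\<Prod>b\<in>Basis. ennreal (std_normal_density ((x :: real ^ 'n) \<bullet> b))) \<partial>lborel)"
    by (intro nn_integral_cong) (simp add: prod_Basis_vec prod_ennreal)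
  also have "\<dots> = (\<Prod>b\<in>(Basis :: (real ^ 'n) set). \<integral>\<^sup>+x. ennreal (std_normal_density x) \<partial>lborel)"
    by (rule nn_integral_lborel_prod) auto
  also have "\<dots> = 1"
    by (simp add: nn_integral_eq_integral)
  finally show "emeasure (\<gamma> :: (real ^ 'n) measure) (space \<gamma>) = 1"
    by simp
qed

interpretation gauss: prob_space "\<gamma> :: (real ^ 'n) measure"
  by (rule prob_space_std_gaussian)

interpretation gauss2: pair_prob_space
  "\<gamma> :: (real ^ 'n) measure" "\<gamma> :: (real ^ 'n) measure" ..

lemma integrable_gauss_exp_square:
  "integrable (\<gamma> :: (real ^ 'n) measure) (\<lambda>x. exp ((norm x)\<^sup>2 / 4))"
proof (rule integrableI_nonneg)
  have 1: "ennreal (std_normal_density x) * ennreal (exp (x\<^sup>2 / 4)) =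
      ennreal (sqrt 2 * normal_density 0 (sqrt 2) x)" for x
    by (simp add: normal_density_def exp_add[symmetric] real_sqrt_mult field_simps flip: ennreal_mult')
  have 2: "exp ((norm x)\<^sup>2 / 4) = (\<Prod>i\<in>UNIV. exp ((x $ i)\<^sup>2 / 4))" for x :: "real ^ 'n"
    by (simp add: norm_square_vec sum_divide_distrib flip: exp_sum)
  have "(\<integral>\<^sup>+x. ennreal (exp ((norm x)\<^sup>2 / 4)) \<partial>(\<gamma> :: (real ^ 'n) measure)) =
      (\<integral>\<^sup>+x. ennreal (\<Prod>i\<in>UNIV. std_normal_density ((x :: real ^ 'n) $ i)) * ennreal (exp ((norm x)\<^sup>2 / 4)) \<partial>lborel)"
    by (simp add: std_gaussian_def nn_integral_density)
  also have "\<dots> = (\<integral>\<^sup>+x. (\<Prod>b\<in>Basis. ennreal (std_normal_density ((x :: real ^ 'n) \<bullet> b)) *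
      ennreal (exp ((x \<bullet> b)\<^sup>2 / 4))) \<partial>lborel)"
    by (intro nn_integral_cong, subst prod_Basis_vec[of "\<lambda>z. ennreal (std_normal_density z) * ennreal (exp (z\<^sup>2 / 4))"])
      (simp add: 2 prod.distrib prod_ennreal prod_nonneg ennreal_mult'[symmetric])
  also have "\<dots> = (\<Prod>b\<in>(Basis :: (real ^ 'n) set). \<integral>\<^sup>+x. ennreal (std_normal_density x) *
      ennreal (exp (x\<^sup>2 / 4)) \<partial>lborel)"
    by (rule nn_integral_lborel_prod) auto
  also have "\<dots> < \<infinity>"
    unfolding 1 by (subst nn_integral_eq_integral) (auto simp: ennreal_prod_eq_top less_top[symmetric] power_eq_top_ennreal)
  finally show "(\<integral>\<^sup>+x. ennreal (exp ((norm x)\<^sup>2 / 4)) \<partial>(\<gamma> :: (real ^ 'n) measure)) < \<infinity>" .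
qed auto

lemma integrable_gauss_exp_norm:
  "integrable (\<gamma> :: (real ^ 'n) measure) (\<lambda>x. exp (a * norm x))"
proof (rule Bochner_Integration.integrable_bound)
  show "integrable (\<gamma> :: (real ^ 'n) measure) (\<lambda>x. exp (a\<^sup>2) * exp ((norm x)\<^sup>2 / 4))"
    by (intro integrable_mult_right integrable_gauss_exp_square)
  have "a * norm x \<le> a\<^sup>2 + (norm x)\<^sup>2 / 4" for x :: "real ^ 'n"
    using zero_le_power2[of "a - norm x / 2"] by (simp add: power2_diff field_simps)
  then show "AE x in (\<gamma> :: (real ^ 'n) measure).
      norm (exp (a * norm x)) \<le> norm (exp (a\<^sup>2) * exp ((norm x)\<^sup>2 / 4))"
    by (simp flip: exp_add)
qed auto

subsection \<open>Functions of exponential type\<close>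

text \<open>
  Growth at most exponential in the norm is stable under sums, products, maps of linear growth and
  partial Gaussian integration, and it implies Gaussian integrability.  Unlike polynomial growth it
  also covers the factors \<open>exp(\<langle>v, y\<rangle>)\<close> produced by translating the Gaussian density.
\<close>

definition exp_type :: "('a::euclidean_space \<Rightarrow> real) \<Rightarrow> bool" where
  "exp_type f \<longleftrightarrow> f \<in> borel_measurable borel \<and>
    (\<exists>a c. 0 \<le> a \<and> 0 \<le> c \<and> (\<forall>x. \<bar>f x\<bar> \<le> c * exp (a * norm x)))"

definition linear_growth :: "('a::euclidean_space \<Rightarrow> 'b::euclidean_space) \<Rightarrow> bool" where
  "linear_growth h \<longleftrightarrow> h \<in> borel_measurable borel \<and> (\<exists>K\<ge>0. \<forall>x. norm (h x) \<le> K * (1 + norm x))"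

lemma exp_typeI:
  assumes "f \<in> borel_measurable borel" "0 \<le> a" "0 \<le> c" "\<And>x. \<bar>f x\<bar> \<le> c * exp (a * norm x)"
  shows "exp_type f"
  using assms unfolding exp_type_def by blast

lemma exp_typeE:
  assumes "exp_type f"
  obtains a c where "f \<in> borel_measurable borel" "0 \<le> a" "0 \<le> c" "\<And>x. \<bar>f x\<bar> \<le> c * exp (a * norm x)"
  using assms unfolding exp_type_def by blast

lemma exp_type_measurable: "exp_type f \<Longrightarrow> f \<in> borel_measurable borel"
  by (simp add: exp_type_def)

lemma linear_growthE:
  assumes "linear_growth h"
  obtains K where "h \<in> borel_measurable borel" "0 \<le> K" "\<And>x. norm (h x) \<le> K * (1 + norm x)"
  using assms unfolding linear_growth_def by blast

lemma linear_growth_measurable: "linear_growth f \<Longrightarrow> f \<in> borel_measurable borel"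
  by (simp add: linear_growth_def)

lemma linear_growthI:
  assumes "h \<in> borel_measurable borel" "0 \<le> K" "\<And>x. norm (h x) \<le> K * (1 + norm x)"
  shows "linear_growth h"
  using assms unfolding linear_growth_def by blast

named_theorems growth

lemma linear_growth_fst [growth]: "linear_growth fst"
  by (rule linear_growthI[of _ 1]) (auto simp: add_increasing norm_fst_le simp flip: borel_prod)

lemma linear_growth_snd [growth]: "linear_growth snd"
  by (rule linear_growthI[of _ 1]) (auto simp: add_increasing norm_snd_le simp flip: borel_prod)

lemma linear_growth_ident [growth]: "linear_growth (\<lambda>x. x)"
  by (rule linear_growthI[of _ 1]) auto

lemma linear_growth_const [growth]: "linear_growth (\<lambda>x. w)"
proof (rule linear_growthI[of _ "norm w"])
  show "norm w \<le> norm w * (1 + norm x)" for x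
    by (simp add: distrib_left)
qed auto

lemma linear_growth_scaleR [growth]: "linear_growth h \<Longrightarrow> linear_growth (\<lambda>x. c *\<^sub>R h x)"
proof (erule linear_growthE)
  fix K assume h: "h \<in> borel_measurable borel" "0 \<le> K" "\<And>x. norm (h x) \<le> K * (1 + norm x)"
  show "linear_growth (\<lambda>x. c *\<^sub>R h x)"
  proof (rule linear_growthI[of _ "\<bar>c\<bar> * K"])
    show "norm (c *\<^sub>R h x) \<le> \<bar>c\<bar> * K * (1 + norm x)" for x
      using mult_left_mono[OF h(3)[of x], of "\<bar>c\<bar>"] by (simp add: mult.assoc)
  qed (use h in auto)
qed

lemma linear_growth_add [growth]:
  assumes "linear_growth h1" "linear_growth h2" shows "linear_growth (\<lambda>x. h1 x + h2 x)"
proof -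
  from assms(1) obtain K1 where h1: "h1 \<in> borel_measurable borel" "0 \<le> K1" "\<And>x. norm (h1 x) \<le> K1 * (1 + norm x)"
    by (elim linear_growthE) blast
  from assms(2) obtain K2 where h2: "h2 \<in> borel_measurable borel" "0 \<le> K2" "\<And>x. norm (h2 x) \<le> K2 * (1 + norm x)"
    by (elim linear_growthE) blast
  show ?thesis
  proof (rule linear_growthI[of _ "K1 + K2"])
    show "norm (h1 x + h2 x) \<le> (K1 + K2) * (1 + norm x)" for x
      using norm_triangle_ineq[of "h1 x" "h2 x"] h1(3)[of x] h2(3)[of x] by (simp add: distrib_right)
  qed (use h1 h2 in auto)
qed

lemma linear_growth_Pair [growth]:
  assumes "linear_growth h1" "linear_growth h2" shows "linear_growth (\<lambda>x. (h1 x, h2 x))"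
proof -
  from assms(1) obtain K1 where h1: "h1 \<in> borel_measurable borel" "0 \<le> K1" "\<And>x. norm (h1 x) \<le> K1 * (1 + norm x)"
    by (elim linear_growthE) blast
  from assms(2) obtain K2 where h2: "h2 \<in> borel_measurable borel" "0 \<le> K2" "\<And>x. norm (h2 x) \<le> K2 * (1 + norm x)"
    by (elim linear_growthE) blast
  show ?thesis
  proof (rule linear_growthI[of _ "K1 + K2"])
    show "norm (h1 x, h2 x) \<le> (K1 + K2) * (1 + norm x)" for x
      using norm_Pair_le[of "h1 x" "h2 x"] h1(3)[of x] h2(3)[of x] by (simp add: distrib_right)
    show "(\<lambda>x. (h1 x, h2 x)) \<in> borel_measurable borel"
      using h1(1) h2(1) by (simp flip: borel_prod)
  qed (use h1 h2 in auto)
qed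

lemma exp_type_compose:
  assumes "exp_type f" "linear_growth h" shows "exp_type (\<lambda>x. f (h x))"
proof -
  from assms(1) obtain a c where f: "f \<in> borel_measurable borel" "0 \<le> a" "0 \<le> c" "\<And>x. \<bar>f x\<bar> \<le> c * exp (a * norm x)"
    by (elim exp_typeE) blast
  from assms(2) obtain K where h: "h \<in> borel_measurable borel" "0 \<le> K" "\<And>x. norm (h x) \<le> K * (1 + norm x)"
    by (elim linear_growthE) blast
  show ?thesis
  proof (rule exp_typeI[of _ "a * K" "c * exp (a * K)"])
    fix x :: 'b
    have "\<bar>f (h x)\<bar> \<le> c * exp (a * norm (h x))" by (rule f)
    also have "\<dots> \<le> c * exp (a * (K * (1 + norm x)))"
      using f h by (intro mult_left_mono) (auto intro: mult_left_mono)
    also have "\<dots> = c * exp (a * K) * exp (a * K * norm x)"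
      by (simp add: algebra_simps flip: exp_add)
    finally show "\<bar>f (h x)\<bar> \<le> c * exp (a * K) * exp (a * K * norm x)" .
  qed (use f h in auto)
qed

lemma exp_type_const [growth]: "exp_type (\<lambda>x. c)"
  by (rule exp_typeI[of _ 0 "\<bar>c\<bar>"]) auto

lemma exp_type_add [growth]:
  assumes "exp_type f" "exp_type g" shows "exp_type (\<lambda>x. f x + g x)"
proof -
  from assms(1) obtain a c where f: "f \<in> borel_measurable borel" "0 \<le> a" "0 \<le> c" "\<And>x. \<bar>f x\<bar> \<le> c * exp (a * norm x)"
    by (elim exp_typeE) blast
  from assms(2) obtain b d where g: "g \<in> borel_measurable borel" "0 \<le> b" "0 \<le> d" "\<And>x. \<bar>g x\<bar> \<le> d * exp (b * norm x)"
    by (elim exp_typeE) blast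
  show ?thesis
  proof (rule exp_typeI[of _ "a + b" "c + d"])
    fix x :: 'a
    have "c * exp (a * norm x) \<le> c * exp ((a + b) * norm x)" "d * exp (b * norm x) \<le> d * exp ((a + b) * norm x)"
      using f g by (auto intro!: mult_left_mono mult_right_mono)
    then show "\<bar>f x + g x\<bar> \<le> (c + d) * exp ((a + b) * norm x)"
      using f(4)[of x] g(4)[of x] unfolding distrib_right[of c d] by linarith
  qed (use f g in auto)
qed

lemma exp_type_mult [growth]:
  assumes "exp_type f" "exp_type g" shows "exp_type (\<lambda>x. f x * g x)"
proof -
  from assms(1) obtain a c where f: "f \<in> borel_measurable borel" "0 \<le> a" "0 \<le> c" "\<And>x. \<bar>f x\<bar> \<le> c * exp (a * norm x)"
    by (elim exp_typeE) blast
  from assms(2) obtain b d where g: "g \<in> borel_measurable borel" "0 \<le> b" "0 \<le> d" "\<And>x. \<bar>g x\<bar> \<le> d * exp (b * norm x)"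
    by (elim exp_typeE) blast
  show ?thesis
  proof (rule exp_typeI[of _ "a + b" "c * d"])
    fix x :: 'a
    have "\<bar>f x\<bar> * \<bar>g x\<bar> \<le> (c * exp (a * norm x)) * (d * exp (b * norm x))"
      using f g by (intro mult_mono) auto
    then show "\<bar>f x * g x\<bar> \<le> c * d * exp ((a + b) * norm x)"
      by (simp add: abs_mult ring_distribs exp_add mult_ac)
  qed (use f g in auto)
qed

lemma exp_type_diff [growth]:
  assumes "exp_type f" "exp_type g" shows "exp_type (\<lambda>x. f x - g x)"
  using exp_type_add[OF assms(1) exp_type_mult[OF exp_type_const[of "-1"] assms(2)]] by simp

lemma exp_type_abs [growth]: "exp_type f \<Longrightarrow> exp_type (\<lambda>x. \<bar>f x\<bar>)"
  unfolding exp_type_def by auto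

lemma exp_type_power [growth]: "exp_type f \<Longrightarrow> exp_type (\<lambda>x. f x ^ k)"
  by (induction k) (auto intro: growth)

lemma exp_type_exp_norm: "0 \<le> a \<Longrightarrow> exp_type (\<lambda>x. exp (a * norm x))"
  by (rule exp_typeI[of _ a 1]) auto

lemma exp_type_norm_ident: "exp_type norm"
proof (rule exp_typeI[of _ 1 1])
  show "\<bar>norm x\<bar> \<le> 1 * exp (1 * norm x)" for x :: 'a
    using exp_ge_add_one_self[of "norm x"] by (simp only: abs_norm_cancel mult_1)
qed auto

lemma exp_type_norm [growth]: "linear_growth h \<Longrightarrow> exp_type (\<lambda>x. norm (h x))"
  by (rule exp_type_compose[OF exp_type_norm_ident])

lemma exp_type_bound:
  assumes "exp_type g" "f \<in> borel_measurable borel" "\<And>x. \<bar>f x\<bar> \<le> g x"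
  shows "exp_type f"
proof -
  from assms(1) obtain a c where g: "g \<in> borel_measurable borel" "0 \<le> a" "0 \<le> c" "\<And>x. \<bar>g x\<bar> \<le> c * exp (a * norm x)"
    by (elim exp_typeE) blast
  show ?thesis
    by (rule exp_typeI[OF assms(2) g(2,3)]) (use g(4) assms(3) in \<open>metis abs_ge_self order_trans\<close>)
qed

lemma exp_type_inner [growth]:
  assumes "linear_growth h1" "linear_growth h2" shows "exp_type (\<lambda>x. h1 x \<bullet> h2 x)"
proof (rule exp_type_bound)
  show "exp_type (\<lambda>x. norm (h1 x) * norm (h2 x))" by (intro growth assms)
  show "(\<lambda>x. h1 x \<bullet> h2 x) \<in> borel_measurable borel"
    using assms[THEN linear_growth_measurable] by simp
qed (rule Cauchy_Schwarz_ineq2)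

lemma sets_gauss2:
  "sets (\<gamma>\<^sub>2 :: ((real ^ 'n) \<times> _) measure) = sets borel"
  by (subst borel_prod[symmetric]) (intro sets_pair_measure_cong sets_std_gaussian)

lemma borel_measurable_gauss2:
  "f \<in> measurable borel N \<Longrightarrow> f \<in> measurable (\<gamma>\<^sub>2 :: ((real ^ 'n) \<times> _) measure) N"
  using measurable_cong_sets[OF sets_gauss2 refl] by blast

lemma integrable_gauss_exp_type:
  fixes f :: "real ^ 'n \<Rightarrow> real"
  assumes "exp_type f" shows "integrable \<gamma> f"
proof -
  from assms obtain a c where f: "f \<in> borel_measurable borel" "0 \<le> a" "0 \<le> c" "\<And>x. \<bar>f x\<bar> \<le> c * exp (a * norm x)"
    by (elim exp_typeE) blast
  show ?thesis
    by (rule Bochner_Integration.integrable_bound[OF integrable_mult_right[OF integrable_gauss_exp_norm[of a], of c]])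
      (use f in auto)
qed

lemma integrable_gauss2_exp_type:
  fixes f :: "(real ^ 'n) \<times> (real ^ 'n) \<Rightarrow> real"
  assumes "exp_type f" shows "integrable \<gamma>\<^sub>2 f"
proof -
  from assms obtain a c where f: "f \<in> borel_measurable borel" "0 \<le> a" "0 \<le> c" "\<And>x. \<bar>f x\<bar> \<le> c * exp (a * norm x)"
    by (elim exp_typeE) blast
  have 1: "integrable \<gamma>\<^sub>2
      (\<lambda>(x :: real ^ 'n, y :: real ^ 'n). exp (a * norm x) * exp (a * norm y))"
    by (rule gauss2.Fubini_integrable) (auto simp: integrable_gauss_exp_norm)
  show ?thesis
  proof (rule Bochner_Integration.integrable_bound[OF integrable_mult_right[OF 1, of c]])
    show "f \<in> borel_measurable \<gamma>\<^sub>2"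
      using f(1) by (rule borel_measurable_gauss2)
    show "AE z in \<gamma>\<^sub>2. norm (f z)
        \<le> norm (c * (case z of (x, y) \<Rightarrow> exp (a * norm x) * exp (a * norm y)))"
    proof (rule AE_I2)
      fix z :: "(real ^ 'n) \<times> (real ^ 'n)"
      have "\<bar>f z\<bar> \<le> c * exp (a * norm z)" by (rule f)
      also have "\<dots> \<le> c * exp (a * (norm (fst z) + norm (snd z)))"
        using f norm_Pair_le[of "fst z" "snd z"] by (intro mult_left_mono) (auto intro: mult_left_mono)
      finally show "norm (f z) \<le> norm (c * (case z of (x, y) \<Rightarrow> exp (a * norm x) * exp (a * norm y)))"
        using f by (simp add: case_prod_beta distrib_left exp_add)
    qed
  qed
qed

lemma gauss2_integral:
  fixes f :: "(real ^ 'n) \<times> (real ^ 'n) \<Rightarrow> real"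
  assumes "exp_type f"
  shows "(\<integral>z. f z \<partial>\<gamma>\<^sub>2) = (\<integral>x. (\<integral>y. f (x, y) \<partial>\<gamma>) \<partial>\<gamma>)"
  by (rule gauss2.integral_fst'[symmetric] integrable_gauss2_exp_type assms)+

lemma exp_type_integral [growth]:
  fixes f :: "'a::euclidean_space \<times> (real ^ 'n) \<Rightarrow> real"
  assumes "exp_type f"
  shows "exp_type (\<lambda>x. \<integral>y. f (x, y) \<partial>\<gamma>)"
proof -
  from assms obtain a c where f: "f \<in> borel_measurable borel" "0 \<le> a" "0 \<le> c" "\<And>x. \<bar>f x\<bar> \<le> c * exp (a * norm x)"
    by (elim exp_typeE) blast
  let ?I = "\<integral>y. exp (a * norm (y :: real ^ 'n)) \<partial>\<gamma>"
  show ?thesis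
  proof (rule exp_typeI[of _ a "c * ?I"])
    have "sets (borel \<Otimes>\<^sub>M (\<gamma> :: (real ^ 'n) measure)) = sets (borel :: ('a \<times> (real ^ 'n)) measure)"
      by (subst borel_prod[symmetric]) (intro sets_pair_measure_cong sets_std_gaussian refl)
    with f(1) have "f \<in> borel_measurable (borel \<Otimes>\<^sub>M \<gamma>)"
      by (simp cong: measurable_cong_sets)
    then show "(\<lambda>x. \<integral>y. f (x, y) \<partial>\<gamma>) \<in> borel_measurable borel"
      by (intro gauss.borel_measurable_lebesgue_integral) simp
    fix x :: 'a
    have "\<bar>\<integral>y. f (x, y) \<partial>\<gamma>\<bar> \<le> (\<integral>y. \<bar>f (x, y)\<bar> \<partial>\<gamma>)"
      by (rule integral_abs_bound)
    also have "\<dots> \<le> (\<integral>y. c * exp (a * norm x) * exp (a * norm (y :: real ^ 'n)) \<partial>\<gamma>)"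
    proof (rule integral_mono)
      show "integrable \<gamma> (\<lambda>y. \<bar>f (x, y)\<bar>)"
        by (intro integrable_gauss_exp_type exp_type_abs exp_type_compose[OF assms] growth)
      show "integrable \<gamma> (\<lambda>y :: real ^ 'n. c * exp (a * norm x) * exp (a * norm y))"
        by (intro integrable_mult_right integrable_gauss_exp_norm)
      fix y :: "real ^ 'n"
      have "\<bar>f (x, y)\<bar> \<le> c * exp (a * norm (x, y))" by (rule f)
      also have "\<dots> \<le> c * exp (a * (norm x + norm y))"
        using f norm_Pair_le[of x y] by (intro mult_left_mono) (auto intro: mult_left_mono)
      finally show "\<bar>f (x, y)\<bar> \<le> c * exp (a * norm x) * exp (a * norm y)"
        by (simp add: distrib_left exp_add)
    qed
    also have "\<dots> = c * ?I * exp (a * norm x)"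
      by simp
    finally show "\<bar>\<integral>y. f (x, y) \<partial>\<gamma>\<bar> \<le> c * ?I * exp (a * norm x)" .
  qed (use f in auto)
qed

subsection \<open>Rotations and translations\<close>

lemma nn_integral_lborel_affine:
  fixes f :: "'a::euclidean_space \<Rightarrow> ennreal"
  assumes [measurable]: "f \<in> borel_measurable borel" and "c \<noteq> 0"
  shows "(\<integral>\<^sup>+x. f x \<partial>lborel) = ennreal (\<bar>c\<bar> ^ DIM('a)) * (\<integral>\<^sup>+x. f (t + c *\<^sub>R x) \<partial>lborel)"
  by (subst lborel_affine[OF assms(2), of t]) (simp add: nn_integral_density nn_integral_distr nn_integral_cmult)

definition rot :: "real \<Rightarrow> ('a::real_vector \<times> 'a) \<Rightarrow> 'a \<times> 'a" where
  "rot \<theta> z = (cos \<theta> *\<^sub>R fst z + sin \<theta> *\<^sub>R snd z, - sin \<theta> *\<^sub>R fst z + cos \<theta> *\<^sub>R snd z)"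

lemma norm_rot_squares:
  fixes z :: "'a::real_inner \<times> 'a"
  shows "(norm (fst (rot \<theta> z)))\<^sup>2 + (norm (snd (rot \<theta> z)))\<^sup>2 = (norm (fst z))\<^sup>2 + (norm (snd z))\<^sup>2"
proof -
  have "(norm (fst (rot \<theta> z)))\<^sup>2 + (norm (snd (rot \<theta> z)))\<^sup>2 =
      ((cos \<theta>)\<^sup>2 + (sin \<theta>)\<^sup>2) * ((norm (fst z))\<^sup>2 + (norm (snd z))\<^sup>2)"
    unfolding rot_def power2_norm_eq_inner
    by (simp only: inner_add_left inner_add_right inner_scaleR_left inner_scaleR_right fst_conv snd_conv
      inner_minus_left inner_minus_right scaleR_minus_left inner_commute[of "snd z" "fst z"]) algebra
  then show ?thesis by simp
qed

lemma linear_growth_rot [growth]: "linear_growth (rot \<theta>)"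
  unfolding rot_def[abs_def] by (intro growth)

text \<open>
  If \<open>sin \<theta> \<noteq> 0\<close>, then for fixed \<open>x\<close> the first coordinate of the rotated point is substituted for \<open>y\<close>; then, with that
  coordinate fixed, the second one is substituted for \<open>x\<close>.  Both substitutions are affine with
  factor \<open>1 / sin \<theta>\<close> up to sign, and the two Jacobians cancel.
\<close>

lemma nn_integral_lborel_rot:
  fixes H :: "('a::euclidean_space \<times> 'a) \<Rightarrow> ennreal"
  assumes H [measurable]: "H \<in> borel_measurable borel"
  shows "(\<integral>\<^sup>+x. \<integral>\<^sup>+y. H (rot \<theta> (x, y)) \<partial>lborel \<partial>lborel) = (\<integral>\<^sup>+x. \<integral>\<^sup>+y. H (x, y) \<partial>lborel \<partial>lborel)"
proof (cases "sin \<theta> = 0")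
  case True
  then have c: "cos \<theta> \<noteq> 0"
    using sin_cos_squared_add[of \<theta>] by auto
  have c1: "\<bar>cos \<theta>\<bar> = 1"
    using True sin_cos_squared_add[of \<theta>] by (auto simp: power2_eq_1_iff)
  have m [measurable]: "(\<lambda>y. H (z, y)) \<in> borel_measurable borel" for z
    using H by measurable
  have H' [measurable]: "H \<in> borel_measurable (borel \<Otimes>\<^sub>M borel)"
    using H by (simp add: borel_prod)
  have "(\<integral>\<^sup>+x. \<integral>\<^sup>+y. H (x, y) \<partial>lborel \<partial>lborel) = (\<integral>\<^sup>+x. \<integral>\<^sup>+y. H (x, cos \<theta> *\<^sub>R y) \<partial>lborel \<partial>lborel)"
    using c1 by (subst nn_integral_lborel_affine[OF m c, of _ 0]) simp
  also have "\<dots> = (\<integral>\<^sup>+x. \<integral>\<^sup>+y. H (cos \<theta> *\<^sub>R x, cos \<theta> *\<^sub>R y) \<partial>lborel \<partial>lborel)"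
    using c1 by (subst nn_integral_lborel_affine[OF _ c, of _ 0]) simp_all
  finally show ?thesis
    by (simp add: rot_def True)
next
  case s: False
  have H' [measurable]: "H \<in> borel_measurable (borel \<Otimes>\<^sub>M borel)"
    using H by (simp add: borel_prod)
  let ?s = "sin \<theta>" and ?c = "cos \<theta>" and ?d = "ennreal (\<bar>1 / sin \<theta>\<bar> ^ DIM('a))"
  have sc: "?c * ?c = 1 - ?s * ?s"
    using sin_cos_squared_add[of \<theta>] by (simp add: power2_eq_square algebra_simps)
  have eq: "H (rot \<theta> (x, (- (?c / ?s)) *\<^sub>R x + (1 / ?s) *\<^sub>R u)) = H (u, (?c / ?s) *\<^sub>R u + (- 1 / ?s) *\<^sub>R x)" for x u
  proof -
    have "- ?s + ?c * (- (?c / ?s)) = - 1 / ?s"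
      using s sc by (simp add: diff_divide_distrib)
    moreover have "- ?s *\<^sub>R x + ?c *\<^sub>R ((- (?c / ?s)) *\<^sub>R x + (1 / ?s) *\<^sub>R u) =
        (- ?s + ?c * (- (?c / ?s))) *\<^sub>R x + (?c / ?s) *\<^sub>R u"
      by (simp add: algebra_simps)
    ultimately have "- ?s *\<^sub>R x + ?c *\<^sub>R ((- (?c / ?s)) *\<^sub>R x + (1 / ?s) *\<^sub>R u) =
        (?c / ?s) *\<^sub>R u + (- 1 / ?s) *\<^sub>R x"
      by (simp only: add.commute)
    moreover have "?c *\<^sub>R x + ?s *\<^sub>R ((- (?c / ?s)) *\<^sub>R x + (1 / ?s) *\<^sub>R u) = u"
      using s by (simp add: algebra_simps)
    ultimately show ?thesis
      by (simp only: rot_def fst_conv snd_conv)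
  qed
  have "(\<integral>\<^sup>+x. \<integral>\<^sup>+y. H (rot \<theta> (x, y)) \<partial>lborel \<partial>lborel) =
      (\<integral>\<^sup>+x. ?d * (\<integral>\<^sup>+u. H (u, (?c / ?s) *\<^sub>R u + (- 1 / ?s) *\<^sub>R x) \<partial>lborel) \<partial>lborel)"
    using s unfolding eq[symmetric]
    by (intro nn_integral_cong nn_integral_lborel_affine) (auto simp: rot_def)
  also have "\<dots> = ?d * (\<integral>\<^sup>+x. \<integral>\<^sup>+u. H (u, (?c / ?s) *\<^sub>R u + (- 1 / ?s) *\<^sub>R x) \<partial>lborel \<partial>lborel)"
    by (rule nn_integral_cmult) simp
  also have "\<dots> = ?d * (\<integral>\<^sup>+u. \<integral>\<^sup>+x. H (u, (?c / ?s) *\<^sub>R u + (- 1 / ?s) *\<^sub>R x) \<partial>lborel \<partial>lborel)"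
    by (subst lborel_pair.Fubini') (auto simp: case_prod_beta)
  also have "\<dots> = (\<integral>\<^sup>+u. ?d * (\<integral>\<^sup>+x. H (u, (?c / ?s) *\<^sub>R u + (- 1 / ?s) *\<^sub>R x) \<partial>lborel) \<partial>lborel)"
    by (rule nn_integral_cmult[symmetric]) simp
  also have "\<dots> = (\<integral>\<^sup>+u. \<integral>\<^sup>+x. H (u, x) \<partial>lborel \<partial>lborel)"
  proof (rule nn_integral_cong)
    fix u
    show "?d * (\<integral>\<^sup>+x. H (u, (?c / ?s) *\<^sub>R u + (- 1 / ?s) *\<^sub>R x) \<partial>lborel) = (\<integral>\<^sup>+x. H (u, x) \<partial>lborel)"
      using s by (subst nn_integral_lborel_affine[of _ "- 1 / ?s" "(?c / ?s) *\<^sub>R u"]) simp_all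
  qed
  finally show ?thesis .
qed

lemma nn_integral_gauss2:
  fixes h :: "(real ^ 'n) \<times> (real ^ 'n) \<Rightarrow> ennreal"
  assumes h [measurable]: "h \<in> borel_measurable borel"
  shows "(\<integral>\<^sup>+z. h z \<partial>\<gamma>\<^sub>2) =
    (\<integral>\<^sup>+x. \<integral>\<^sup>+y. ennreal ((1 / (2 * pi)) ^ CARD('n) * exp (- ((norm (fst (x, y)))\<^sup>2 + (norm (snd (x, y)))\<^sup>2) / 2)) * h (x, y) \<partial>lborel \<partial>lborel)"
proof -
  let ?g = "\<lambda>x :: real ^ 'n. ennreal ((1 / sqrt (2 * pi)) ^ CARD('n) * exp (- (norm x)\<^sup>2 / 2))"
  have h' [measurable]: "h \<in> borel_measurable (borel \<Otimes>\<^sub>M borel)"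
    using h by (simp add: borel_prod)
  have g: "\<gamma> = density lborel ?g"
    unfolding std_gaussian_def prod_std_normal_density ..
  have gg: "?g x * ?g y = ennreal ((1 / (2 * pi)) ^ CARD('n) * exp (- ((norm (fst (x, y)))\<^sup>2 + (norm (snd (x, y)))\<^sup>2) / 2))" for x y
  proof -
    have a: "(1 / sqrt (2 * pi)) ^ CARD('n) * (1 / sqrt (2 * pi)) ^ CARD('n) = (1 / (2 * pi)) ^ CARD('n)"
      unfolding power_mult_distrib[symmetric] by simp
    have b: "exp (- (norm x)\<^sup>2 / 2) * exp (- (norm y)\<^sup>2 / 2) = exp (- ((norm x)\<^sup>2 + (norm y)\<^sup>2) / 2)"
      unfolding exp_add[symmetric] by (simp add: add_divide_distrib)
    have "((1 / sqrt (2 * pi)) ^ CARD('n) * exp (- (norm x)\<^sup>2 / 2)) *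
        ((1 / sqrt (2 * pi)) ^ CARD('n) * exp (- (norm y)\<^sup>2 / 2)) =
        (1 / (2 * pi)) ^ CARD('n) * exp (- ((norm x)\<^sup>2 + (norm y)\<^sup>2) / 2)"
      unfolding a[symmetric] b[symmetric] by (simp only: mult_ac)
    then show ?thesis
      by (simp flip: ennreal_mult)
  qed
  have "(\<integral>\<^sup>+z. h z \<partial>\<gamma>\<^sub>2) = (\<integral>\<^sup>+x. \<integral>\<^sup>+y. h (x, y) \<partial>\<gamma> \<partial>\<gamma>)"
    by (rule gauss.nn_integral_fst[symmetric]) (rule borel_measurable_gauss2[OF h])
  also have "\<dots> = (\<integral>\<^sup>+x. ?g x * (\<integral>\<^sup>+y. ?g y * h (x, y) \<partial>lborel) \<partial>lborel)"
    unfolding g by (simp add: nn_integral_density)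
  also have "\<dots> = (\<integral>\<^sup>+x. \<integral>\<^sup>+y. (?g x * ?g y) * h (x, y) \<partial>lborel \<partial>lborel)"
    by (simp add: nn_integral_cmult mult.assoc)
  finally show ?thesis
    unfolding gg .
qed

text \<open>
  The density of a pair of independent standard Gaussians depends only on the sum of the squared
  norms, which a rotation preserves.
\<close>

lemma gauss2_rot:
  fixes h :: "(real ^ 'n) \<times> (real ^ 'n) \<Rightarrow> real"
  assumes h [measurable]: "h \<in> borel_measurable borel"
  shows "(\<integral>z. h (rot \<theta> z) \<partial>\<gamma>\<^sub>2) = (\<integral>z. h z \<partial>\<gamma>\<^sub>2)"
proof -
  let ?M = "\<gamma>\<^sub>2 :: ((real ^ 'n) \<times> _) measure"
  have r [measurable]: "(rot \<theta> :: (real ^ 'n) \<times> (real ^ 'n) \<Rightarrow> _) \<in> borel_measurable borel"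
    by (rule linear_growth_measurable) (rule growth)
  have "distr ?M borel (rot \<theta>) = ?M"
  proof (rule measure_eqI)
    fix A assume "A \<in> sets (distr ?M borel (rot \<theta>))"
    then have A [measurable]: "A \<in> sets borel" by simp
    let ?i = "indicator A :: (real ^ 'n) \<times> (real ^ 'n) \<Rightarrow> ennreal"
    let ?D = "\<lambda>w :: (real ^ 'n) \<times> (real ^ 'n). ennreal ((1 / (2 * pi)) ^ CARD('n) *
      exp (- ((norm (fst w))\<^sup>2 + (norm (snd w))\<^sup>2) / 2))"
    have [measurable]: "?i \<in> borel_measurable borel" by (rule borel_measurable_indicator[OF A])
    have [measurable]: "?D \<in> borel_measurable borel" by (simp add: borel_prod[symmetric])
    have "emeasure (distr ?M borel (rot \<theta>)) A = (\<integral>\<^sup>+z. ?i z \<partial>distr ?M borel (rot \<theta>))"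
      by simp
    also have "\<dots> = (\<integral>\<^sup>+z. ?i (rot \<theta> z) \<partial>?M)"
      by (rule nn_integral_distr) (simp_all add: borel_measurable_gauss2 r)
    also have "\<dots> = (\<integral>\<^sup>+x. \<integral>\<^sup>+y. ?D (rot \<theta> (x, y)) * ?i (rot \<theta> (x, y)) \<partial>lborel \<partial>lborel)"
      unfolding norm_rot_squares by (rule nn_integral_gauss2) measurable
    also have "\<dots> = (\<integral>\<^sup>+x. \<integral>\<^sup>+y. ?D (x, y) * ?i (x, y) \<partial>lborel \<partial>lborel)"
      by (rule nn_integral_lborel_rot[of "\<lambda>w. ?D w * ?i w"]) measurable
    also have "\<dots> = (\<integral>\<^sup>+z. ?i z \<partial>?M)"
      by (rule nn_integral_gauss2[symmetric]) measurable
    also have "\<dots> = emeasure ?M A"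
      using A sets_gauss2 by (intro nn_integral_indicator) blast
    finally show "emeasure (distr ?M borel (rot \<theta>)) A = emeasure ?M A" .
  qed (simp only: sets_distr sets_gauss2)
  then have "(\<integral>z. h z \<partial>?M) = (\<integral>z. h z \<partial>distr ?M borel (rot \<theta>))" by simp
  also have "\<dots> = (\<integral>z. h (rot \<theta> z) \<partial>?M)" by (rule integral_distr) (simp_all add: borel_measurable_gauss2 r h)
  finally show ?thesis by simp
qed

subsection \<open>Integration by parts\<close>

lemma gauss_shift:
  fixes f :: "real ^ 'n \<Rightarrow> real"
  assumes f [measurable]: "f \<in> borel_measurable borel"
  shows "(\<integral>y. f (y + v) \<partial>\<gamma>) = (\<integral>y. f y * exp (y \<bullet> v - (norm v)\<^sup>2 / 2) \<partial>\<gamma>)"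
proof -
  let ?g = "\<lambda>x :: real ^ 'n. (1 / sqrt (2 * pi)) ^ CARD('n) * exp (- (norm x)\<^sup>2 / 2)"
  have g: "\<gamma> = density lborel (\<lambda>x. ennreal (?g x))"
    unfolding std_gaussian_def prod_std_normal_density ..
  have sq: "- (norm (y + - v))\<^sup>2 / 2 = - (norm y)\<^sup>2 / 2 + (y \<bullet> v - (norm v)\<^sup>2 / 2)" for y
    by (simp add: power2_norm_eq_inner inner_diff_left inner_diff_right inner_commute field_simps)
  have 1: "?g (y + - v) = ?g y * exp (y \<bullet> v - (norm v)\<^sup>2 / 2)" for y
    unfolding sq exp_add by simp
  have "(\<integral>y. f (y + v) \<partial>\<gamma>) = (\<integral>y. ?g y * f (y + v) \<partial>lborel)"
    unfolding g by (subst integral_density) auto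
  also have "\<dots> = (\<integral>y. ?g y * f (y + v) \<partial>distr lborel borel ((+) (- v)))"
    by (simp add: lborel_distr_plus)
  also have "\<dots> = (\<integral>y. ?g (y + - v) * f y \<partial>lborel)"
    by (subst integral_distr) (auto simp: add.commute)
  also have "\<dots> = (\<integral>y. ?g y * (f y * exp (y \<bullet> v - (norm v)\<^sup>2 / 2)) \<partial>lborel)"
    unfolding 1 by (simp add: mult_ac)
  also have "\<dots> = (\<integral>y. f y * exp (y \<bullet> v - (norm v)\<^sup>2 / 2) \<partial>\<gamma>)"
    unfolding g by (subst integral_density) auto
  finally show ?thesis .
qed

lemma abs_exp_minus_one_le: "\<bar>exp a - 1\<bar> \<le> \<bar>a\<bar> * exp \<bar>a\<bar>" for a :: real
proof (cases "0 \<le> a")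
  case True
  have "1 + - a \<le> exp (- a)" by (rule exp_ge_add_one_self)
  then have "(1 - a) * exp a \<le> exp (- a) * exp a" by (intro mult_right_mono) auto
  then have "(1 - a) * exp a \<le> 1" by (simp flip: exp_add)
  then show ?thesis using True by (simp add: algebra_simps)
next
  case False
  have "1 + a \<le> exp a" by (rule exp_ge_add_one_self)
  moreover have "\<bar>exp a - 1\<bar> = 1 - exp a" using False by simp
  ultimately have "\<bar>exp a - 1\<bar> \<le> \<bar>a\<bar> * 1" using False by linarith
  also have "\<dots> \<le> \<bar>a\<bar> * exp \<bar>a\<bar>" by (intro mult_left_mono) auto
  finally show ?thesis .
qed

lemma exp_shift_quotient_bound:
  fixes u w h :: real
  assumes "0 < h" "h \<le> 1" "0 \<le> w"
  shows "\<bar>(exp (h * u - h\<^sup>2 * w / 2) - 1) / h\<bar> \<le> exp (2 * (\<bar>u\<bar> + w))"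
proof -
  have h2: "h\<^sup>2 \<le> h * 1"
    using assms unfolding power2_eq_square by (intro mult_left_mono) auto
  have "\<bar>h * u - h\<^sup>2 * w / 2\<bar> \<le> h * \<bar>u\<bar> + h\<^sup>2 * w / 2"
    using abs_triangle_ineq4[of "h * u" "h\<^sup>2 * w / 2"] assms by (simp add: abs_mult)
  also have "\<dots> \<le> h * \<bar>u\<bar> + h * w"
    using mult_right_mono[OF h2 assms(3)] mult_nonneg_nonneg[OF less_imp_le[OF assms(1)] assms(3)] by auto
  finally have a: "\<bar>h * u - h\<^sup>2 * w / 2\<bar> \<le> h * (\<bar>u\<bar> + w)" by (simp add: distrib_left)
  also have "\<dots> \<le> 1 * (\<bar>u\<bar> + w)" using assms by (intro mult_right_mono) auto
  finally have b: "\<bar>h * u - h\<^sup>2 * w / 2\<bar> \<le> \<bar>u\<bar> + w" by simp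
  have "\<bar>exp (h * u - h\<^sup>2 * w / 2) - 1\<bar> \<le> \<bar>h * u - h\<^sup>2 * w / 2\<bar> * exp \<bar>h * u - h\<^sup>2 * w / 2\<bar>"
    by (rule abs_exp_minus_one_le)
  also have "\<dots> \<le> (h * (\<bar>u\<bar> + w)) * exp (\<bar>u\<bar> + w)"
    using a b assms by (intro mult_mono) auto
  also have "\<dots> \<le> (h * exp (\<bar>u\<bar> + w)) * exp (\<bar>u\<bar> + w)"
    using assms exp_ge_add_one_self[of "\<bar>u\<bar> + w"] by (intro mult_right_mono mult_left_mono) linarith+
  also have "\<dots> = h * exp (2 * (\<bar>u\<bar> + w))"
    by (simp add: mult.assoc flip: exp_add)
  finally show ?thesis using assms by (simp add: field_simps)
qed

text \<open>
  The derivative at \<open>h = 0\<close> of \<open>E f(y + hv)\<close>, computed by moving the translation into the density,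
  is \<open>E f(y) \<langle>y, v\<rangle>\<close>.  The hypothesis compares the difference quotients of \<open>f\<close> in direction \<open>v\<close> with
  \<open>D\<close>.  With \<open>B = 0\<close> this is integration by parts; with \<open>D = 0\<close> it bounds \<open>E f(y) \<langle>y, v\<rangle>\<close> by the mean
  of a local Lipschitz constant, for functions that need not be differentiable.
\<close>

lemma gauss_ibp_approx:
  fixes f D B C :: "real ^ 'n \<Rightarrow> real"
  assumes f: "exp_type f" and D: "exp_type D" and B: "exp_type B" and C: "exp_type C"
    and le: "\<And>h z. 0 < h \<Longrightarrow> h \<le> 1 \<Longrightarrow> \<bar>f (z + h *\<^sub>R v) - f z - h * D z\<bar> \<le> h * (B z + h * C z)"
  shows "\<bar>(\<integral>y. f y * (y \<bullet> v) \<partial>\<gamma>) - (\<integral>y. D y \<partial>\<gamma>)\<bar> \<le> (\<integral>y. B y \<partial>\<gamma>)"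
proof -
  define h where "h n = 1 / real (Suc n)" for n
  have h: "0 < h n" "h n \<le> 1" for n by (auto simp: h_def)
  have h0: "h \<longlonglongrightarrow> 0" unfolding h_def[abs_def] by (rule LIMSEQ_inverse_real_of_nat[unfolded inverse_eq_divide])
  let ?e = "\<lambda>n y. exp (h n * (y \<bullet> v) - (h n)\<^sup>2 * (norm v)\<^sup>2 / 2)"
  define a where "a n = (\<integral>y. f y * ((?e n y - 1) / h n) \<partial>\<gamma>)" for n
  have [measurable]: "f \<in> borel_measurable borel"
    by (rule exp_type_measurable[OF f])
  have lim: "a \<longlonglongrightarrow> (\<integral>y. f y * (y \<bullet> v) \<partial>\<gamma>)"
    unfolding a_def
  proof (rule integral_dominated_convergence[where w="\<lambda>y. \<bar>f y\<bar> * (exp (2 * (norm v)\<^sup>2) * exp (2 * norm v * norm y))"])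
    show "integrable \<gamma> (\<lambda>y. \<bar>f y\<bar> * (exp (2 * (norm v)\<^sup>2) * exp (2 * norm v * norm y)))"
      by (intro integrable_gauss_exp_type growth f exp_type_exp_norm) auto
    show "AE y in \<gamma>. (\<lambda>n. f y * ((?e n y - 1) / h n)) \<longlonglongrightarrow> f y * (y \<bullet> v)"
    proof (rule AE_I2, rule tendsto_mult[OF tendsto_const])
      fix y :: "real ^ 'n"
      have "((\<lambda>s. exp (s * (y \<bullet> v) - s\<^sup>2 * (norm v)\<^sup>2 / 2)) has_real_derivative y \<bullet> v) (at 0)"
        by (auto intro!: derivative_eq_intros)
      then have "((\<lambda>s. (exp (s * (y \<bullet> v) - s\<^sup>2 * (norm v)\<^sup>2 / 2) - 1) / s) \<longlongrightarrow> y \<bullet> v) (at 0)"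
        by (simp add: has_field_derivative_iff)
      moreover have "filterlim h (at 0) sequentially"
        using h0 h by (auto simp: filterlim_at less_imp_neq[symmetric])
      ultimately show "(\<lambda>n. (?e n y - 1) / h n) \<longlonglongrightarrow> y \<bullet> v"
        by (rule filterlim_compose)
    qed
    show "AE y in \<gamma>. norm (f y * ((?e n y - 1) / h n)) \<le>
        \<bar>f y\<bar> * (exp (2 * (norm v)\<^sup>2) * exp (2 * norm v * norm y))" for n
    proof (rule AE_I2)
      fix y :: "real ^ 'n"
      have "\<bar>(?e n y - 1) / h n\<bar> \<le> exp (2 * (\<bar>y \<bullet> v\<bar> + (norm v)\<^sup>2))"
        by (rule exp_shift_quotient_bound) (use h in auto)
      also have "\<dots> \<le> exp (2 * (norm v)\<^sup>2) * exp (2 * norm v * norm y)"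
        using Cauchy_Schwarz_ineq2[of y v] by (simp add: mult.commute flip: exp_add)
      finally show "norm (f y * ((?e n y - 1) / h n)) \<le> \<bar>f y\<bar> * (exp (2 * (norm v)\<^sup>2) * exp (2 * norm v * norm y))"
        unfolding real_norm_def abs_mult[of "f y"] by (rule mult_left_mono) simp
    qed
  qed (simp_all add: measurable_cong_sets[OF sets_std_gaussian refl])
  have bnd: "\<bar>a n - (\<integral>y. D y \<partial>\<gamma>)\<bar> \<le> (\<integral>y. B y \<partial>\<gamma>) + h n * (\<integral>y. C y \<partial>\<gamma>)" for n
  proof -
    have fs: "exp_type (\<lambda>y. f (y + h n *\<^sub>R v))"
      by (rule exp_type_compose[OF f]) (intro growth)
    have ie: "integrable \<gamma> (\<lambda>y. f y * ?e n y)"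
    proof (rule Bochner_Integration.integrable_bound)
      show "integrable \<gamma> (\<lambda>y. \<bar>f y\<bar> * exp (h n * norm v * norm y))"
        by (intro integrable_gauss_exp_type growth f exp_type_exp_norm) (use h[of n] in auto)
      show "AE y in \<gamma>. norm (f y * ?e n y) \<le> norm (\<bar>f y\<bar> * exp (h n * norm v * norm y))"
      proof (rule AE_I2)
        fix y :: "real ^ 'n"
        have "h n * (y \<bullet> v) \<le> h n * (norm v * norm y)"
          using h[of n] norm_cauchy_schwarz[of y v] by (intro mult_left_mono) (auto simp: mult.commute)
        then have "?e n y \<le> exp (h n * norm v * norm y)"
          by (simp add: mult.assoc add_increasing2 order_trans[OF diff_left_mono[of 0]])
        then show "norm (f y * ?e n y) \<le> norm (\<bar>f y\<bar> * exp (h n * norm v * norm y))"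
          by (simp add: abs_mult mult_left_mono)
      qed
    qed (simp_all add: measurable_cong_sets[OF sets_std_gaussian refl])
    have "h n * a n = (\<integral>y. h n * (f y * ((?e n y - 1) / h n)) \<partial>\<gamma>)"
      unfolding a_def by simp
    also have "\<dots> = (\<integral>y. f y * ?e n y - f y \<partial>\<gamma>)"
      by (rule Bochner_Integration.integral_cong) (use h(1)[of n] in \<open>auto simp: field_simps\<close>)
    also have "\<dots> = (\<integral>y. f y * ?e n y \<partial>\<gamma>) - (\<integral>y. f y \<partial>\<gamma>)"
      by (rule Bochner_Integration.integral_diff[OF ie integrable_gauss_exp_type[OF f]])
    also have "(\<integral>y. f y * ?e n y \<partial>\<gamma>) = (\<integral>y. f (y + h n *\<^sub>R v) \<partial>\<gamma>)"
      by (subst gauss_shift) (simp_all add: power_mult_distrib)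
    finally have ha: "h n * a n = (\<integral>y. f (y + h n *\<^sub>R v) \<partial>\<gamma>) - (\<integral>y. f y \<partial>\<gamma>)" .
    have "h n * (a n - (\<integral>y. D y \<partial>\<gamma>)) = (\<integral>y. f (y + h n *\<^sub>R v) - f y - h n * D y \<partial>\<gamma>)"
      unfolding right_diff_distrib ha using f D fs by (simp add: integrable_gauss_exp_type)
    also have "\<bar>\<dots>\<bar> \<le> (\<integral>y. \<bar>f (y + h n *\<^sub>R v) - f y - h n * D y\<bar> \<partial>\<gamma>)"
      by (rule integral_abs_bound)
    also have "\<dots> \<le> (\<integral>y. h n * (B y + h n * C y) \<partial>\<gamma>)"
      by (intro integral_mono integrable_gauss_exp_type growth fs f D B C le h)
    also have "\<dots> = h n * ((\<integral>y. B y \<partial>\<gamma>) + h n * (\<integral>y. C y \<partial>\<gamma>))"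
      using B C by (simp add: integrable_gauss_exp_type)
    finally show ?thesis
      using h(1)[of n] by (simp add: abs_mult)
  qed
  have "(\<lambda>n. \<bar>a n - (\<integral>y. D y \<partial>\<gamma>)\<bar>) \<longlonglongrightarrow> \<bar>(\<integral>y. f y * (y \<bullet> v) \<partial>\<gamma>) - (\<integral>y. D y \<partial>\<gamma>)\<bar>"
    by (intro tendsto_intros lim)
  moreover have "(\<lambda>n. (\<integral>y. B y \<partial>\<gamma>) + h n * (\<integral>y. C y \<partial>\<gamma>)) \<longlonglongrightarrow>
      (\<integral>y. B y \<partial>\<gamma>) + 0 * (\<integral>y. C y \<partial>\<gamma>)"
    by (intro tendsto_intros h0)
  ultimately show ?thesis
    using LIMSEQ_le[OF _ _ ] bnd by fastforce
qed

subsection \<open>Covariances by rotation\<close>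

lemma rot_rot: "rot \<alpha> (rot \<beta> z) = rot (\<alpha> + \<beta>) z"
  by (simp add: rot_def cos_add sin_add algebra_simps)

lemma rot_0 [simp]: "rot 0 z = z"
  by (simp add: rot_def)

lemma linear_growth_fst_rot [growth]: "linear_growth (\<lambda>z. fst (rot \<theta> z))"
  unfolding rot_def fst_conv by (intro growth)

lemma linear_growth_compose:
  assumes "linear_growth h1" "linear_growth h2" shows "linear_growth (\<lambda>x. h1 (h2 x))"
proof -
  from assms(1) obtain K1 where h1: "h1 \<in> borel_measurable borel" "0 \<le> K1" "\<And>x. norm (h1 x) \<le> K1 * (1 + norm x)"
    by (elim linear_growthE) blast
  from assms(2) obtain K2 where h2: "h2 \<in> borel_measurable borel" "0 \<le> K2" "\<And>x. norm (h2 x) \<le> K2 * (1 + norm x)"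
    by (elim linear_growthE) blast
  show ?thesis
  proof (rule linear_growthI[of _ "K1 * (1 + K2)"])
    fix x
    have "norm (h1 (h2 x)) \<le> K1 * (1 + norm (h2 x))" by (rule h1)
    also have "\<dots> \<le> K1 * ((1 + K2) * (1 + norm x))"
    proof (rule mult_left_mono[OF _ h1(2)])
      show "1 + norm (h2 x) \<le> (1 + K2) * (1 + norm x)"
        using h2(3)[of x] norm_ge_zero[of x] unfolding distrib_right mult_1_left by linarith
    qed
    finally show "norm (h1 (h2 x)) \<le> K1 * (1 + K2) * (1 + norm x)" by (simp add: mult.assoc)
  qed (use h1 h2 in auto)
qed

lemma gauss2_fst:
  fixes f :: "real ^ 'n \<Rightarrow> real"
  assumes "exp_type f"
  shows "(\<integral>z. f (fst z) \<partial>(\<gamma>\<^sub>2 :: ((real ^ 'n) \<times> _) measure)) = (\<integral>x. f x \<partial>\<gamma>)"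
  by (subst gauss2_integral[of "\<lambda>z. f (fst z)"])
    (auto intro: exp_type_compose growth assms simp: gauss.prob_space[simplified])

lemma gauss2_fst_rot: 
  fixes f :: "real ^ 'n \<Rightarrow> real"
  assumes "exp_type f"
  shows "(\<integral>z. f (fst (rot \<theta> z)) \<partial>(\<gamma>\<^sub>2 :: ((real ^ 'n) \<times> _) measure)) = (\<integral>x. f x \<partial>\<gamma>)"
  by (subst gauss2_rot[of "\<lambda>z. f (fst z)"])
    (auto intro!: exp_type_measurable exp_type_compose[OF assms] growth gauss2_fst assms)

text \<open>
  With \<open>\<Phi>(\<theta>) = E k(cos \<theta> x + sin \<theta> y) \<psi>(x)\<close> the covariance is \<open>\<Phi>(0) - \<Phi>(\<pi>/2)\<close>.  Rotating the pair by
  \<open>\<theta>\<close> shows that \<open>\<Phi>'(\<theta>)\<close> is the integral in the last hypothesis, where only the gradient \<open>K\<close> of \<open>k\<close>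
  occurs and \<open>\<psi>\<close> is evaluated at a linear combination of \<open>x\<close> and \<open>y\<close>.  The mean value theorem
  replaces an integral over \<open>\<theta>\<close>.
\<close>

lemma gauss_cov_bound:
  fixes k \<psi> :: "real ^ 'n \<Rightarrow> real" and K :: "real ^ 'n \<Rightarrow> real ^ 'n"
  assumes k: "exp_type k" and \<psi>: "exp_type \<psi>" and K: "linear_growth K" and R: "exp_type R"
    and taylor: "\<And>\<epsilon> z. \<bar>\<epsilon>\<bar> \<le> 1 \<Longrightarrow>
      \<bar>k (fst (rot \<epsilon> z)) - k (fst z) - \<epsilon> * (K (fst z) \<bullet> snd z)\<bar> \<le> \<epsilon>\<^sup>2 * R z"
    and B: "\<And>\<theta>. 0 \<le> \<theta> \<Longrightarrow> \<theta> \<le> pi / 2 \<Longrightarrow>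
      \<bar>\<integral>z. (K (fst z) \<bullet> snd z) * \<psi> (fst (rot (- \<theta>) z)) \<partial>\<gamma>\<^sub>2\<bar> \<le> B"
  shows "\<bar>(\<integral>x. k x * \<psi> x \<partial>\<gamma>) - (\<integral>x. k x \<partial>\<gamma>) * (\<integral>x. \<psi> x \<partial>\<gamma>)\<bar> \<le> pi / 2 * B"
proof -
  let ?M = "\<gamma>\<^sub>2 :: ((real ^ 'n) \<times> _) measure"
  define \<Phi> where "\<Phi> \<theta> = (\<integral>z. k (fst (rot \<theta> z)) * \<psi> (fst z) \<partial>?M)" for \<theta>
  define D where "D \<theta> = (\<integral>z. (K (fst z) \<bullet> snd z) * \<psi> (fst (rot (- \<theta>) z)) \<partial>?M)" for \<theta>
  have Kf: "linear_growth (\<lambda>z :: (real ^ 'n) \<times> (real ^ 'n). K (fst z))"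
    by (rule linear_growth_compose[OF K linear_growth_fst])
  have shifted: "\<Phi> (\<theta> + \<epsilon>) = (\<integral>z. k (fst (rot \<epsilon> z)) * \<psi> (fst (rot (- \<theta>) z)) \<partial>?M)" for \<theta> \<epsilon>
    unfolding \<Phi>_def
    by (subst gauss2_rot[of _ \<theta>, symmetric])
      (auto simp: rot_rot add.commute intro!: exp_type_measurable growth exp_type_compose[OF k] exp_type_compose[OF \<psi>])
  have deriv: "(\<Phi> has_real_derivative D \<theta>) (at \<theta>)" for \<theta>
  proof -
    define c where "c = (\<integral>z. R z * \<bar>\<psi> (fst (rot (- \<theta>) z))\<bar> \<partial>?M)"
    have le: "\<bar>\<Phi> (\<theta> + \<epsilon>) - \<Phi> \<theta> - \<epsilon> * D \<theta>\<bar> \<le> \<epsilon>\<^sup>2 * c" if "\<bar>\<epsilon>\<bar> \<le> 1" for \<epsilon>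
    proof -
      let ?p = "\<lambda>z. \<psi> (fst (rot (- \<theta>) z))"
      have i1: "integrable ?M (\<lambda>z. k (fst (rot \<epsilon> z)) * ?p z)"
        and i2: "integrable ?M (\<lambda>z. k (fst z) * ?p z)"
        and i3: "integrable ?M (\<lambda>z. (K (fst z) \<bullet> snd z) * ?p z)"
        and i4: "integrable ?M (\<lambda>z. R z * \<bar>?p z\<bar>)"
        by (intro integrable_gauss2_exp_type growth exp_type_compose[OF k] exp_type_compose[OF \<psi>] Kf R)+
      have eq: "\<Phi> (\<theta> + \<epsilon>) - \<Phi> \<theta> - \<epsilon> * D \<theta> =
          (\<integral>z. k (fst (rot \<epsilon> z)) * ?p z - k (fst z) * ?p z - \<epsilon> * ((K (fst z) \<bullet> snd z) * ?p z) \<partial>?M)"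
        using i1 i2 i3 shifted[of \<theta> \<epsilon>] shifted[of \<theta> 0] unfolding D_def by simp
      have "\<bar>\<Phi> (\<theta> + \<epsilon>) - \<Phi> \<theta> - \<epsilon> * D \<theta>\<bar> \<le> (\<integral>z. \<bar>k (fst (rot \<epsilon> z)) * ?p z - k (fst z) * ?p z - \<epsilon> * ((K (fst z) \<bullet> snd z) * ?p z)\<bar> \<partial>?M)"
        unfolding eq by (rule integral_abs_bound)
      also have "\<dots> \<le> (\<integral>z. \<epsilon>\<^sup>2 * (R z * \<bar>?p z\<bar>) \<partial>?M)"
      proof (rule integral_mono)
        show "integrable ?M (\<lambda>z. \<bar>k (fst (rot \<epsilon> z)) * ?p z - k (fst z) * ?p z - \<epsilon> * ((K (fst z) \<bullet> snd z) * ?p z)\<bar>)"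
          by (rule integrable_abs, rule Bochner_Integration.integrable_diff[OF Bochner_Integration.integrable_diff[OF i1 i2]],
            rule integrable_mult_right[OF i3])
        show "integrable ?M (\<lambda>z. \<epsilon>\<^sup>2 * (R z * \<bar>?p z\<bar>))" using i4 by (rule integrable_mult_right)
        fix z
        have "\<bar>k (fst (rot \<epsilon> z)) * ?p z - k (fst z) * ?p z - \<epsilon> * ((K (fst z) \<bullet> snd z) * ?p z)\<bar> =
            \<bar>k (fst (rot \<epsilon> z)) - k (fst z) - \<epsilon> * (K (fst z) \<bullet> snd z)\<bar> * \<bar>?p z\<bar>"
          by (simp only: left_diff_distrib mult.assoc flip: abs_mult)
        also have "\<dots> \<le> (\<epsilon>\<^sup>2 * R z) * \<bar>?p z\<bar>"
          by (intro mult_right_mono taylor that) auto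
        finally show "\<bar>k (fst (rot \<epsilon> z)) * ?p z - k (fst z) * ?p z - \<epsilon> * ((K (fst z) \<bullet> snd z) * ?p z)\<bar>
            \<le> \<epsilon>\<^sup>2 * (R z * \<bar>?p z\<bar>)" by (simp add: mult.assoc)
      qed
      finally show ?thesis by (simp add: c_def)
    qed
    have "((\<lambda>\<epsilon>. (\<Phi> (\<theta> + \<epsilon>) - \<Phi> \<theta>) / \<epsilon> - D \<theta>) \<longlongrightarrow> 0) (at 0)"
    proof (rule Lim_null_comparison)
      show "\<forall>\<^sub>F \<epsilon> in at 0. norm ((\<Phi> (\<theta> + \<epsilon>) - \<Phi> \<theta>) / \<epsilon> - D \<theta>) \<le> \<bar>\<epsilon>\<bar> * c"
        unfolding eventually_at
      proof (intro exI[of _ 1] conjI ballI impI, simp, clarify)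
        fix \<epsilon> :: real assume "\<epsilon> \<noteq> 0" "dist \<epsilon> 0 < 1"
        have "\<epsilon> * ((\<Phi> (\<theta> + \<epsilon>) - \<Phi> \<theta>) / \<epsilon> - D \<theta>) = \<Phi> (\<theta> + \<epsilon>) - \<Phi> \<theta> - \<epsilon> * D \<theta>"
          using \<open>\<epsilon> \<noteq> 0\<close> by (simp add: field_simps)
        then have "\<bar>\<epsilon>\<bar> * \<bar>(\<Phi> (\<theta> + \<epsilon>) - \<Phi> \<theta>) / \<epsilon> - D \<theta>\<bar> \<le> \<bar>\<epsilon>\<bar> * (\<bar>\<epsilon>\<bar> * c)"
          using le[of \<epsilon>] \<open>dist \<epsilon> 0 < 1\<close> by (simp add: power2_eq_square mult.assoc flip: abs_mult)
        then show "norm ((\<Phi> (\<theta> + \<epsilon>) - \<Phi> \<theta>) / \<epsilon> - D \<theta>) \<le> \<bar>\<epsilon>\<bar> * c"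
          using \<open>\<epsilon> \<noteq> 0\<close> by simp
      qed
      show "((\<lambda>\<epsilon>. \<bar>\<epsilon>\<bar> * c) \<longlongrightarrow> 0) (at 0)"
        by (auto intro!: tendsto_eq_intros)
    qed
    then show ?thesis
      by (simp add: DERIV_def LIM_zero_iff)
  qed
  have "\<exists>\<xi>. 0 < \<xi> \<and> \<xi> < pi / 2 \<and> \<Phi> (pi / 2) - \<Phi> 0 = (pi / 2 - 0) * D \<xi>"
    by (rule MVT2) (auto intro: deriv)
  then obtain \<xi> where \<xi>: "0 < \<xi>" "\<xi> < pi / 2" "\<Phi> (pi / 2) - \<Phi> 0 = pi / 2 * D \<xi>" by auto
  have "\<Phi> 0 = (\<integral>x. k x * \<psi> x \<partial>\<gamma>)"
    unfolding \<Phi>_def rot_0 by (rule gauss2_fst) (intro growth k \<psi>)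
  moreover have "\<Phi> (pi / 2) = (\<integral>x. k x \<partial>\<gamma>) * (\<integral>x. \<psi> x \<partial>\<gamma>)"
  proof -
    have "\<Phi> (pi / 2) = (\<integral>z. k (snd z) * \<psi> (fst z) \<partial>?M)"
      by (simp add: \<Phi>_def rot_def)
    also have "\<dots> = (\<integral>x. \<integral>y. k y * \<psi> x \<partial>\<gamma> \<partial>\<gamma>)"
      by (subst gauss2_integral) (auto intro!: growth exp_type_compose[OF k] exp_type_compose[OF \<psi>])
    finally show ?thesis by simp
  qed
  moreover have "\<bar>pi / 2 * D \<xi>\<bar> \<le> pi / 2 * B"
    unfolding abs_mult using B[of \<xi>] \<xi> by (auto simp: D_def intro!: mult_mono)
  ultimately show ?thesis
    using \<xi>(3) by linarith
qed

section \<open>The squared norm of a cone projection\<close>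

lemma linear_growth_lipschitz:
  fixes f :: "'a::euclidean_space \<Rightarrow> 'b::euclidean_space"
  assumes "\<And>x y. norm (f x - f y) \<le> norm (x - y)" "f 0 = 0"
  shows "linear_growth f"
proof (rule linear_growthI[of _ 1])
  have "continuous_on UNIV f"
    by (rule continuous_on_iff[THEN iffD2]) (use assms in \<open>auto simp: dist_norm intro: le_less_trans\<close>)
  then show "f \<in> borel_measurable borel"
    by (rule borel_measurable_continuous_onI)
  show "norm (f x) \<le> 1 * (1 + norm x)" for x
    using assms(1)[of x 0] assms(2) by simp
qed simp

text \<open>
  The three properties of the metric projection onto a closed convex cone on which the argument
  rests.  The last one makes \<open>|P|\<^sup>2\<close> a convex function with subgradient \<open>2 P\<close>; as \<open>P\<close> is
  \<open>1\<close>-Lipschitz, \<open>2 P\<close> is then its gradient.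
\<close>

locale cone_projection =
  fixes P :: "real ^ 'n \<Rightarrow> real ^ 'n"
  assumes lipschitz: "norm (P x - P y) \<le> norm (x - y)"
    and zero: "P 0 = 0"
    and subgradient: "2 * (P x \<bullet> (y - x)) \<le> (norm (P y))\<^sup>2 - (norm (P x))\<^sup>2"
begin

definition G :: "real ^ 'n \<Rightarrow> real" where "G x = (norm (P x))\<^sup>2"

definition \<delta> :: real where "\<delta> = (\<integral>x. G x \<partial>\<gamma>)"

definition \<sigma>2 :: real where "\<sigma>2 = (\<integral>x. (G x)\<^sup>2 \<partial>\<gamma>) - \<delta>\<^sup>2"

lemma norm_P_le: "norm (P x) \<le> norm x"
  using lipschitz[of x 0] by (simp add: zero)

lemma linear_growth_P [growth]: "linear_growth P"
  by (rule linear_growth_lipschitz) (use lipschitz zero in auto)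

lemma linear_growth_P' [growth]: "linear_growth h \<Longrightarrow> linear_growth (\<lambda>x. P (h x))"
  by (rule linear_growth_compose[OF linear_growth_P])

lemma exp_type_G [growth]: "exp_type G"
  unfolding G_def[abs_def] by (intro growth)

lemma exp_type_G' [growth]: "linear_growth h \<Longrightarrow> exp_type (\<lambda>x. G (h x))"
  by (rule exp_type_compose[OF exp_type_G])

lemma G_nonneg: "0 \<le> G x"
  by (simp add: G_def)

text \<open>
  The subgradient inequality at \<open>x\<close> and at \<open>y\<close> encloses \<open>G y - G x\<close> between two linear terms that
  differ by \<open>2 \<langle>P y - P x, y - x\<rangle>\<close>, and \<open>P\<close> is a contraction.  So \<open>G\<close> is differentiable with gradient
  \<open>2 P\<close>, although \<open>P\<close> itself need not be.
\<close>

lemma G_expansion: "\<bar>G y - G x - 2 * (P x \<bullet> (y - x))\<bar> \<le> 2 * (norm (y - x))\<^sup>2"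
proof -
  have "2 * ((P y - P x) \<bullet> (y - x)) \<le> 2 * (norm (P y - P x) * norm (y - x))"
    using norm_cauchy_schwarz[of "P y - P x" "y - x"] by simp
  also have "\<dots> \<le> 2 * (norm (y - x))\<^sup>2"
    using lipschitz[of y x] by (auto simp: power2_eq_square intro: mult_right_mono)
  finally have 1: "2 * (P y \<bullet> (y - x)) - 2 * (P x \<bullet> (y - x)) \<le> 2 * (norm (y - x))\<^sup>2"
    by (simp add: inner_diff_left)
  have "2 * (P y \<bullet> (x - y)) = - 2 * (P y \<bullet> (y - x))"
    by (simp add: inner_diff_right)
  with 1 subgradient[of x y] subgradient[of y x] show ?thesis
    unfolding G_def by linarith
qed

end

definition C11 :: "(real \<Rightarrow> real) \<Rightarrow> (real \<Rightarrow> real) \<Rightarrow> real \<Rightarrow> real \<Rightarrow> bool" where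
  "C11 \<kappa> \<kappa>' M1 M2 \<longleftrightarrow> 0 \<le> M1 \<and> 0 \<le> M2 \<and> (\<forall>u. (\<kappa> has_real_derivative \<kappa>' u) (at u)) \<and>
    (\<forall>u. \<bar>\<kappa>' u\<bar> \<le> M1) \<and> (\<forall>u v. \<bar>\<kappa>' u - \<kappa>' v\<bar> \<le> M2 * \<bar>u - v\<bar>)"

lemma C11_expansion:
  assumes "C11 \<kappa> \<kappa>' M1 M2"
  shows "\<bar>\<kappa> b - \<kappa> a - \<kappa>' a * (b - a)\<bar> \<le> M2 * (b - a)\<^sup>2"
proof -
  have "\<exists>z. \<bar>z - a\<bar> \<le> \<bar>b - a\<bar> \<and> \<kappa> b - \<kappa> a = (b - a) * \<kappa>' z"
  proof (cases a b rule: linorder_cases)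
    case less
    then have "\<exists>z>a. z < b \<and> \<kappa> b - \<kappa> a = (b - a) * \<kappa>' z"
      by (intro MVT2) (use assms in \<open>auto simp: C11_def\<close>)
    then show ?thesis by force
  next
    case greater
    then have "\<exists>z>b. z < a \<and> \<kappa> a - \<kappa> b = (a - b) * \<kappa>' z"
      by (intro MVT2) (use assms in \<open>auto simp: C11_def\<close>)
    then obtain z where "b < z" "z < a" "\<kappa> a - \<kappa> b = (a - b) * \<kappa>' z" by auto
    then show ?thesis by (intro exI[of _ z]) (auto simp: algebra_simps)
  qed auto
  then obtain z where z: "\<bar>z - a\<bar> \<le> \<bar>b - a\<bar>" "\<kappa> b - \<kappa> a = (b - a) * \<kappa>' z" by blast
  have "\<bar>\<kappa> b - \<kappa> a - \<kappa>' a * (b - a)\<bar> = \<bar>b - a\<bar> * \<bar>\<kappa>' z - \<kappa>' a\<bar>"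
    unfolding z(2) by (simp add: algebra_simps flip: abs_mult)
  also have "\<bar>b - a\<bar> * \<bar>\<kappa>' z - \<kappa>' a\<bar> \<le> \<bar>b - a\<bar> * (M2 * \<bar>b - a\<bar>)"
  proof (rule mult_left_mono)
    show "\<bar>\<kappa>' z - \<kappa>' a\<bar> \<le> M2 * \<bar>b - a\<bar>"
    proof -
      have "\<bar>\<kappa>' z - \<kappa>' a\<bar> \<le> M2 * \<bar>z - a\<bar>" using assms by (simp add: C11_def)
      also have "\<dots> \<le> M2 * \<bar>b - a\<bar>" using assms z(1) by (intro mult_left_mono) (simp_all add: C11_def)
      finally show ?thesis .
    qed
  qed simp
  also have "\<dots> = M2 * (b - a)\<^sup>2"
    by (simp add: power2_eq_square flip: abs_mult)
  finally show ?thesis .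
qed

lemma C11_continuous: "C11 \<kappa> \<kappa>' M1 M2 \<Longrightarrow> continuous_on UNIV \<kappa>"
  unfolding C11_def by (meson DERIV_isCont continuous_at_imp_continuous_on)

lemma C11_deriv_continuous:
  assumes "C11 \<kappa> \<kappa>' M1 M2" shows "continuous_on UNIV \<kappa>'"
proof (rule continuous_on_iff[THEN iffD2], safe)
  fix u e :: real assume e: "0 < e"
  have M: "0 \<le> M2" "\<And>u v. \<bar>\<kappa>' u - \<kappa>' v\<bar> \<le> M2 * \<bar>u - v\<bar>" using assms by (auto simp: C11_def)
  show "\<exists>d>0. \<forall>x'\<in>UNIV. dist x' u < d \<longrightarrow> dist (\<kappa>' x') (\<kappa>' u) < e"
  proof (intro exI[of _ "e / (M2 + 1)"] conjI ballI impI)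
    fix v assume "dist v u < e / (M2 + 1)"
    then have "(M2 + 1) * \<bar>v - u\<bar> < e" using M(1) by (simp add: dist_real_def field_simps)
    with M(2)[of v u] show "dist (\<kappa>' v) (\<kappa>' u) < e"
      by (simp add: dist_real_def distrib_right)
  qed (use M(1) e in simp)
qed

lemma C11_diff_linear:
  assumes "C11 \<kappa> \<kappa>' M1 M2"
  shows "C11 (\<lambda>u. \<kappa> u - m * u) (\<lambda>u. \<kappa>' u - m) (M1 + \<bar>m\<bar>) M2"
  using assms unfolding C11_def
  by (auto intro!: derivative_eq_intros order_trans[OF abs_triangle_ineq4])

lemma C11_bound:
  assumes "C11 \<kappa> \<kappa>' M1 M2"
  shows "\<bar>\<kappa> u\<bar> \<le> \<bar>\<kappa> 0\<bar> + M1 * \<bar>u\<bar> + M2 * u\<^sup>2"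
proof -
  have "\<bar>\<kappa> u - \<kappa> 0 - \<kappa>' 0 * u\<bar> \<le> M2 * u\<^sup>2" using C11_expansion[OF assms, of u 0] by simp
  moreover have "\<bar>\<kappa>' 0 * u\<bar> \<le> M1 * \<bar>u\<bar>" using assms by (auto simp: C11_def abs_mult intro: mult_right_mono)
  ultimately show ?thesis by linarith
qed

context cone_projection
begin

lemma exp_type_C11:
  assumes "C11 \<kappa> \<kappa>' M1 M2" shows "exp_type (\<lambda>x. \<kappa> (G x))"
proof (rule exp_type_bound)
  show "exp_type (\<lambda>x. \<bar>\<kappa> 0\<bar> + M1 * \<bar>G x\<bar> + M2 * (G x)\<^sup>2)"
    by (intro growth)
  show "(\<lambda>x. \<kappa> (G x)) \<in> borel_measurable borel"
    by (rule measurable_compose[OF exp_type_measurable[OF exp_type_G]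
      borel_measurable_continuous_onI[OF C11_continuous[OF assms]]])
  show "\<bar>\<kappa> (G x)\<bar> \<le> \<bar>\<kappa> 0\<bar> + M1 * \<bar>G x\<bar> + M2 * (G x)\<^sup>2" for x
    by (rule C11_bound[OF assms])
qed

lemma exp_type_C11_deriv:
  assumes "C11 \<kappa> \<kappa>' M1 M2" shows "exp_type (\<lambda>x. \<kappa>' (G x))"
proof (rule exp_type_bound[OF exp_type_const[of M1]])
  show "(\<lambda>x. \<kappa>' (G x)) \<in> borel_measurable borel"
    by (rule measurable_compose[OF exp_type_measurable[OF exp_type_G]
      borel_measurable_continuous_onI[OF C11_deriv_continuous[OF assms]]])
qed (use assms in \<open>auto simp: C11_def\<close>)

text \<open>
  The case \<open>k = \<kappa>(G)\<close> of \<open>gauss_cov_bound\<close>, with gradient \<open>2 \<kappa>'(G) P\<close>.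
\<close>

lemma cov_C11_bound:
  assumes \<kappa>: "C11 \<kappa> \<kappa>' M1 M2" and \<psi>: "exp_type \<psi>"
    and B: "\<And>\<theta>. 0 \<le> \<theta> \<Longrightarrow> \<theta> \<le> pi / 2 \<Longrightarrow>
      \<bar>\<integral>z. (\<kappa>' (G (fst z)) * (2 * (P (fst z) \<bullet> snd z))) * \<psi> (fst (rot (- \<theta>) z)) \<partial>\<gamma>\<^sub>2\<bar> \<le> B"
  shows "\<bar>(\<integral>x. \<kappa> (G x) * \<psi> x \<partial>\<gamma>) - (\<integral>x. \<kappa> (G x) \<partial>\<gamma>) * (\<integral>x. \<psi> x \<partial>\<gamma>)\<bar> \<le> pi / 2 * B"
proof -
  define K where "K x = (\<kappa>' (G x) * 2) *\<^sub>R P x" for x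
  let ?r = "\<lambda>z :: (real ^ 'n) \<times> (real ^ 'n). norm (fst z) + norm (snd z)"
  \<comment> \<open>The rotated point differs from \<open>x\<close> by at most \<open>|\<epsilon>| r\<close>, hence \<open>G\<close> changes by at most \<open>4 |\<epsilon>| r\<^sup>2\<close>.\<close>
  let ?R = "\<lambda>z. 16 * M2 * ?r z ^ 4 + 4 * M1 * ?r z ^ 2"
  have M: "0 \<le> M1" "0 \<le> M2" "\<And>u. \<bar>\<kappa>' u\<bar> \<le> M1" using \<kappa> by (auto simp: C11_def)
  have nK: "norm (K x) \<le> 2 * M1 * norm x" for x
    unfolding K_def using mult_mono[OF M(3)[of "G x"] norm_P_le[of x]] M by simp
  have K: "linear_growth K"
  proof (rule linear_growthI[of _ "2 * M1"])
    have [measurable]: "(\<lambda>x. \<kappa>' (G x)) \<in> borel_measurable borel" "P \<in> borel_measurable borel"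
      by (rule exp_type_measurable[OF exp_type_C11_deriv[OF \<kappa>]])
        (rule linear_growth_measurable[OF linear_growth_P])
    show "K \<in> borel_measurable borel" unfolding K_def[abs_def] by measurable
    show "norm (K x) \<le> 2 * M1 * (1 + norm x)" for x
      using nK[of x] M(1) by (simp add: distrib_left)
  qed (use M in simp)
  show ?thesis
  proof (rule gauss_cov_bound[OF exp_type_C11[OF \<kappa>] \<psi> K, of ?R])
    show "exp_type ?R" by (intro growth)
    show "\<bar>\<integral>z. (K (fst z) \<bullet> snd z) * \<psi> (fst (rot (- \<theta>) z)) \<partial>\<gamma>\<^sub>2\<bar> \<le> B"
      if "0 \<le> \<theta>" "\<theta> \<le> pi / 2" for \<theta>
      using B[OF that] by (simp add: K_def mult.assoc)
    fix \<epsilon> :: real and z :: "(real ^ 'n) \<times> (real ^ 'n)" assume \<epsilon>: "\<bar>\<epsilon>\<bar> \<le> 1"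
    define x y where "x = fst z" and "y = snd z"
    define w where "w = fst (rot \<epsilon> z) - x"
    define r where "r = norm x + norm y"
    have r: "0 \<le> r" "norm x \<le> r" "norm y \<le> r" by (auto simp: r_def)
    have w: "w = (cos \<epsilon> - 1) *\<^sub>R x + sin \<epsilon> *\<^sub>R y"
      by (simp add: w_def x_def y_def rot_def algebra_simps)
    have "cmod (iexp \<epsilon> - (1 + \<i> * \<epsilon>)) \<le> \<epsilon>\<^sup>2 / 2"
      using iexp_approx1[of \<epsilon> 1] by (simp add: numeral_eq_Suc)
    then have "cmod (iexp \<epsilon> - (1 + \<i> * \<epsilon>)) \<le> \<epsilon>\<^sup>2"
      using zero_le_power2[of \<epsilon>] by linarith
    then have c: "\<bar>cos \<epsilon> - 1\<bar> \<le> \<epsilon>\<^sup>2" and s: "\<bar>sin \<epsilon> - \<epsilon>\<bar> \<le> \<epsilon>\<^sup>2"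
      using abs_Re_le_cmod[of "iexp \<epsilon> - (1 + \<i> * \<epsilon>)"] abs_Im_le_cmod[of "iexp \<epsilon> - (1 + \<i> * \<epsilon>)"]
      by (simp_all add: Re_exp Im_exp)
    have e2: "\<epsilon>\<^sup>2 \<le> \<bar>\<epsilon>\<bar>" using \<epsilon> power_decreasing[of 1 2 "\<bar>\<epsilon>\<bar>"] by simp
    have nw: "norm w \<le> \<bar>\<epsilon>\<bar> * r"
    proof -
      have "norm w \<le> \<bar>cos \<epsilon> - 1\<bar> * norm x + \<bar>sin \<epsilon>\<bar> * norm y"
        unfolding w by (metis norm_scaleR norm_triangle_ineq)
      also have "\<dots> \<le> \<bar>\<epsilon>\<bar> * norm x + \<bar>\<epsilon>\<bar> * norm y"
        using c e2 abs_sin_x_le_abs_x[of \<epsilon>] by (intro add_mono mult_right_mono) auto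
      finally show ?thesis by (simp add: r_def distrib_left)
    qed
    have nwe: "norm (w - \<epsilon> *\<^sub>R y) \<le> \<epsilon>\<^sup>2 * r"
    proof -
      have "w - \<epsilon> *\<^sub>R y = (cos \<epsilon> - 1) *\<^sub>R x + (sin \<epsilon> - \<epsilon>) *\<^sub>R y" by (simp add: w algebra_simps)
      then have "norm (w - \<epsilon> *\<^sub>R y) \<le> \<bar>cos \<epsilon> - 1\<bar> * norm x + \<bar>sin \<epsilon> - \<epsilon>\<bar> * norm y"
        by (metis norm_scaleR norm_triangle_ineq)
      also have "\<dots> \<le> \<epsilon>\<^sup>2 * norm x + \<epsilon>\<^sup>2 * norm y"
        using c s by (intro add_mono mult_right_mono) auto
      finally show ?thesis by (simp add: r_def distrib_left)
    qed
    have nw2: "(norm w)\<^sup>2 \<le> \<epsilon>\<^sup>2 * r\<^sup>2"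
      using power_mono[OF nw, of 2] by (simp add: power_mult_distrib)
    define a b where "a = G x" and "b = G (x + w)"
    have ba: "\<bar>b - a - 2 * (P x \<bullet> w)\<bar> \<le> 2 * (\<epsilon>\<^sup>2 * r\<^sup>2)"
      using G_expansion[of "x + w" x] nw2 by (simp add: a_def b_def)
    have "\<bar>P x \<bullet> w\<bar> \<le> r * (\<bar>\<epsilon>\<bar> * r)"
      by (rule order_trans[OF Cauchy_Schwarz_ineq2]) (use norm_P_le[of x] r nw in \<open>intro mult_mono; simp\<close>)
    moreover have "\<epsilon>\<^sup>2 * r\<^sup>2 \<le> \<bar>\<epsilon>\<bar> * r\<^sup>2" using e2 by (intro mult_right_mono) auto
    ultimately have "\<bar>b - a\<bar> \<le> \<bar>\<epsilon>\<bar> * (4 * r\<^sup>2)"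
      using ba by (simp add: power2_eq_square mult_ac)
    then have ba2: "(b - a)\<^sup>2 \<le> \<epsilon>\<^sup>2 * (16 * r ^ 4)"
      using power_mono[of "\<bar>b - a\<bar>" "\<bar>\<epsilon>\<bar> * (4 * r\<^sup>2)" 2] by (simp add: power_mult_distrib)
    have 1: "\<bar>\<kappa> b - \<kappa> a - \<kappa>' a * (b - a)\<bar> \<le> \<epsilon>\<^sup>2 * (16 * M2 * r ^ 4)"
      using order_trans[OF C11_expansion[OF \<kappa>, of b a] mult_left_mono[OF ba2 M(2)]] by (simp add: mult_ac)
    have 2: "\<bar>\<kappa>' a * (b - a) - \<kappa>' a * (2 * (P x \<bullet> w))\<bar> \<le> \<epsilon>\<^sup>2 * (2 * M1 * r\<^sup>2)"
    proof -
      have "\<bar>\<kappa>' a * (b - a - 2 * (P x \<bullet> w))\<bar> \<le> M1 * (2 * (\<epsilon>\<^sup>2 * r\<^sup>2))"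
        unfolding abs_mult by (rule mult_mono[OF M(3) ba M(1)]) simp
      then show ?thesis by (simp only: right_diff_distrib mult_ac)
    qed
    have Kw: "\<bar>K x \<bullet> (w - \<epsilon> *\<^sub>R y)\<bar> \<le> (2 * M1 * r) * (\<epsilon>\<^sup>2 * r)"
    proof (rule order_trans[OF Cauchy_Schwarz_ineq2], rule mult_mono[OF _ nwe])
      show "norm (K x) \<le> 2 * M1 * r"
        using order_trans[OF nK[of x] mult_left_mono[OF r(2), of "2 * M1"]] M(1) by simp
    qed (use M r in auto)
    have 3: "\<bar>\<kappa>' a * (2 * (P x \<bullet> w)) - \<epsilon> * (K x \<bullet> y)\<bar> \<le> \<epsilon>\<^sup>2 * (2 * M1 * r\<^sup>2)"
    proof -
      have "K x \<bullet> (w - \<epsilon> *\<^sub>R y) = \<kappa>' a * (2 * (P x \<bullet> w)) - \<epsilon> * (K x \<bullet> y)"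
        by (simp add: K_def a_def inner_diff_right)
      with Kw show ?thesis by (simp add: power2_eq_square mult_ac)
    qed
    have "\<bar>\<kappa> b - \<kappa> a - \<epsilon> * (K x \<bullet> y)\<bar> \<le> \<epsilon>\<^sup>2 * (16 * M2 * r ^ 4) + \<epsilon>\<^sup>2 * (2 * M1 * r\<^sup>2) + \<epsilon>\<^sup>2 * (2 * M1 * r\<^sup>2)"
      using 1 2 3 by linarith
    also have "\<dots> = \<epsilon>\<^sup>2 * (16 * M2 * r ^ 4 + 4 * M1 * r\<^sup>2)" by (simp add: algebra_simps)
    finally show "\<bar>\<kappa> (G (fst (rot \<epsilon> z))) - \<kappa> (G (fst z)) - \<epsilon> * (K (fst z) \<bullet> snd z)\<bar> \<le> \<epsilon>\<^sup>2 * ?R z"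
      by (simp add: a_def b_def w_def x_def y_def r_def)
  qed
qed

end

section \<open>Stein's method for the squared projection\<close>

lemma linear_growth_fst_rot' [growth]: "linear_growth h \<Longrightarrow> linear_growth (\<lambda>w. fst (rot \<theta> (h w)))"
  by (rule linear_growth_compose[OF linear_growth_fst_rot])

context cone_projection
begin

lemma gauss_ibp_G:
  "(\<integral>y. G (fst (rot (- \<theta>) (x, y))) * (y \<bullet> v) \<partial>\<gamma>) =
    - 2 * sin \<theta> * (\<integral>y. P (fst (rot (- \<theta>) (x, y))) \<bullet> v \<partial>\<gamma>)"
proof -
  let ?u = "\<lambda>y. fst (rot (- \<theta>) (x, y))"
  have "\<bar>(\<integral>y. G (?u y) * (y \<bullet> v) \<partial>\<gamma>) -
      (\<integral>y. (- 2 * sin \<theta>) * (P (?u y) \<bullet> v) \<partial>\<gamma>)\<bar> \<le> (\<integral>y. 0 \<partial>(\<gamma> :: (real ^ 'n) measure))"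
  proof (rule gauss_ibp_approx[where C="\<lambda>_. 2 * (sin \<theta>)\<^sup>2 * (norm v)\<^sup>2"])
    fix h :: real and z :: "real ^ 'n" assume h: "0 < h" "h \<le> 1"
    have u: "?u (z + h *\<^sub>R v) - ?u z = - (h * sin \<theta>) *\<^sub>R v"
      by (simp add: rot_def algebra_simps)
    show "\<bar>G (?u (z + h *\<^sub>R v)) - G (?u z) - h * ((- 2 * sin \<theta>) * (P (?u z) \<bullet> v))\<bar>
        \<le> h * (0 + h * (2 * (sin \<theta>)\<^sup>2 * (norm v)\<^sup>2))"
      using G_expansion[of "?u (z + h *\<^sub>R v)" "?u z"] unfolding u
      by (simp add: power_mult_distrib power2_eq_square mult_ac)
  qed (intro growth)+
  then show ?thesis by simp
qed

text \<open>
  \<open>Q \<theta> x\<close> is, up to the factor \<open>- 4 sin \<theta>\<close>, the mean over \<open>y\<close> of \<open>2 \<langle>P x, y\<rangle> G(cos \<theta> x - sin \<theta> y)\<close>,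
  the integrand that \<open>cov_C11_bound\<close> produces for \<open>\<psi> = G\<close>.  \<open>I \<theta>\<close> is part of its local
  Lipschitz constant.
\<close>

definition Q :: "real \<Rightarrow> real ^ 'n \<Rightarrow> real" where
  "Q \<theta> x = (\<integral>y. P x \<bullet> P (fst (rot (- \<theta>) (x, y))) \<partial>\<gamma>)"

definition I :: "real \<Rightarrow> real ^ 'n \<Rightarrow> real" where
  "I \<theta> x = (\<integral>y. norm (P (fst (rot (- \<theta>) (x, y)))) \<partial>\<gamma>)"

lemma exp_type_Q [growth]: "exp_type (Q \<theta>)"
proof -
  have "exp_type (\<lambda>z :: (real ^ 'n) \<times> (real ^ 'n). P (fst z) \<bullet> P (fst (rot (- \<theta>) z)))"
    by (intro growth)
  from exp_type_integral[OF this] show ?thesis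
    unfolding Q_def[abs_def] fst_conv .
qed

lemma exp_type_I [growth]: "exp_type (I \<theta>)"
proof -
  have "exp_type (\<lambda>z :: (real ^ 'n) \<times> (real ^ 'n). norm (P (fst (rot (- \<theta>) z))))"
    by (intro growth)
  from exp_type_integral[OF this] show ?thesis
    unfolding I_def[abs_def] fst_conv .
qed

lemmas exp_type_Q' [growth] = exp_type_compose[OF exp_type_Q]
lemmas exp_type_I' [growth] = exp_type_compose[OF exp_type_I]

lemma I_nonneg: "0 \<le> I \<theta> x"
  unfolding I_def by (rule integral_nonneg_AE) simp

lemma gauss_stein_G:
  "(\<integral>y. (2 * (P x \<bullet> y)) * G (fst (rot (- \<theta>) (x, y))) \<partial>\<gamma>) = - 4 * sin \<theta> * Q \<theta> x"
  using gauss_ibp_G[of \<theta> x "P x"] unfolding Q_def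
  by (simp add: inner_commute mult_ac)

lemma Q_lipschitz: "\<bar>Q \<theta> x' - Q \<theta> x\<bar> \<le> norm (x' - x) * (I \<theta> x + norm (P x) + norm (x' - x))"
proof -
  let ?u = "\<lambda>x y. fst (rot (- \<theta>) (x, y))"
  let ?d = "norm (x' - x)"
  have i: "integrable \<gamma> (\<lambda>y. P w \<bullet> P (?u w y))" for w
    by (intro integrable_gauss_exp_type growth)
  have i': "integrable \<gamma> (\<lambda>y. norm (P (?u x y)))"
    by (intro integrable_gauss_exp_type growth)
  have le: "\<bar>P x' \<bullet> P (?u x' y) - P x \<bullet> P (?u x y)\<bar> \<le> ?d * (norm (P (?u x y)) + ?d) + norm (P x) * ?d" for y
  proof -
    have "?u x' y - ?u x y = cos \<theta> *\<^sub>R (x' - x)" by (simp add: rot_def algebra_simps)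
    then have "norm (?u x' y - ?u x y) \<le> 1 * ?d"
      by (simp only: norm_scaleR) (intro mult_right_mono, auto)
    then have u: "norm (P (?u x' y) - P (?u x y)) \<le> ?d"
      using lipschitz[of "?u x' y" "?u x y"] by simp
    then have u': "norm (P (?u x' y)) \<le> norm (P (?u x y)) + ?d"
      using norm_triangle_sub[of "P (?u x' y)" "P (?u x y)"] by simp
    have "P x' \<bullet> P (?u x' y) - P x \<bullet> P (?u x y) = (P x' - P x) \<bullet> P (?u x' y) + P x \<bullet> (P (?u x' y) - P (?u x y))"
      by (simp add: inner_diff_left inner_diff_right)
    also have "\<bar>\<dots>\<bar> \<le> norm (P x' - P x) * norm (P (?u x' y)) + norm (P x) * norm (P (?u x' y) - P (?u x y))"
      by (rule order_trans[OF abs_triangle_ineq]) (intro add_mono Cauchy_Schwarz_ineq2)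
    also have "\<dots> \<le> ?d * (norm (P (?u x y)) + ?d) + norm (P x) * ?d"
      by (intro add_mono mult_mono lipschitz u u' mult_left_mono) auto
    finally show ?thesis .
  qed
  have "\<bar>Q \<theta> x' - Q \<theta> x\<bar> = \<bar>\<integral>y. P x' \<bullet> P (?u x' y) - P x \<bullet> P (?u x y) \<partial>\<gamma>\<bar>"
    unfolding Q_def using i by simp
  also have "\<dots> \<le> (\<integral>y. \<bar>P x' \<bullet> P (?u x' y) - P x \<bullet> P (?u x y)\<bar> \<partial>\<gamma>)"
    by (rule integral_abs_bound)
  also have "\<dots> \<le> (\<integral>y. ?d * (norm (P (?u x y)) + ?d) + norm (P x) * ?d \<partial>\<gamma>)"
    by (intro integral_mono le) (use i i' in auto)
  also have "\<dots> = ?d * (I \<theta> x + ?d) + norm (P x) * ?d"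
    unfolding I_def using i' by (simp add: gauss.prob_space[simplified])
  finally show ?thesis by (simp add: algebra_simps)
qed

text \<open>
  Here \<open>gauss_ibp_approx\<close> is applied with \<open>D = 0\<close>: \<open>Q\<close> inherits from \<open>P\<close> only local Lipschitz
  continuity.
\<close>

lemma Q_weighted_bound:
  "\<bar>\<integral>y. Q \<theta> (fst (rot (- \<phi>) (x, y))) * (y \<bullet> v) \<partial>\<gamma>\<bar> \<le>
    norm v * (\<integral>y. I \<theta> (fst (rot (- \<phi>) (x, y))) + norm (P (fst (rot (- \<phi>) (x, y)))) \<partial>\<gamma>)"
proof -
  let ?u = "\<lambda>y. fst (rot (- \<phi>) (x, y))"
  have "\<bar>(\<integral>y. Q \<theta> (?u y) * (y \<bullet> v) \<partial>\<gamma>) - (\<integral>y. 0 \<partial>(\<gamma> :: (real ^ 'n) measure))\<bar> \<le>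
      (\<integral>y. norm v * (I \<theta> (?u y) + norm (P (?u y))) \<partial>\<gamma>)"
  proof (rule gauss_ibp_approx[where C="\<lambda>_. (norm v)\<^sup>2"])
    fix h :: real and z :: "real ^ 'n" assume h: "0 < h" "h \<le> 1"
    have "?u (z + h *\<^sub>R v) - ?u z = - (h * sin \<phi>) *\<^sub>R v"
      by (simp add: rot_def algebra_simps)
    then have "norm (?u (z + h *\<^sub>R v) - ?u z) = (h * norm v) * \<bar>sin \<phi>\<bar>"
      using h by (simp add: abs_mult)
    also have "\<dots> \<le> (h * norm v) * 1" using h by (intro mult_left_mono) auto
    finally have u: "norm (?u (z + h *\<^sub>R v) - ?u z) \<le> h * norm v" by simp
    have "\<bar>Q \<theta> (?u (z + h *\<^sub>R v)) - Q \<theta> (?u z)\<bar> \<le>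
        norm (?u (z + h *\<^sub>R v) - ?u z) * (I \<theta> (?u z) + norm (P (?u z)) + norm (?u (z + h *\<^sub>R v) - ?u z))"
      by (rule Q_lipschitz)
    also have "\<dots> \<le> (h * norm v) * (I \<theta> (?u z) + norm (P (?u z)) + h * norm v)"
      using u I_nonneg[of \<theta> "?u z"] h by (intro mult_mono) auto
    finally show "\<bar>Q \<theta> (?u (z + h *\<^sub>R v)) - Q \<theta> (?u z) - h * 0\<bar> \<le>
        h * (norm v * (I \<theta> (?u z) + norm (P (?u z))) + h * (norm v)\<^sup>2)"
      by (simp add: algebra_simps power2_eq_square)
  qed (intro growth)+
  then show ?thesis by simp
qed

text \<open>
  Both this and the next bound come from \<open>2ab \<le> a\<^sup>2 + b\<^sup>2\<close>, because every rotated point is again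
  standard Gaussian and \<open>E |P|\<^sup>2 = \<delta>\<close>.
\<close>

lemma integral_norm_product_le:
  "(\<integral>z. norm (P (fst z)) * norm (P (fst (rot \<phi> z))) \<partial>(\<gamma>\<^sub>2 :: ((real ^ 'n) \<times> _) measure)) \<le> \<delta>"
proof -
  let ?M = "\<gamma>\<^sub>2 :: ((real ^ 'n) \<times> _) measure"
  have i: "integrable ?M (\<lambda>z. G (fst z))" "integrable ?M (\<lambda>z. G (fst (rot \<phi> z)))"
    by (intro integrable_gauss2_exp_type growth)+
  have "(\<integral>z. norm (P (fst z)) * norm (P (fst (rot \<phi> z))) \<partial>?M) \<le> (\<integral>z. G (fst z) / 2 + G (fst (rot \<phi> z)) / 2 \<partial>?M)"
  proof (rule integral_mono)
    show "integrable ?M (\<lambda>z. norm (P (fst z)) * norm (P (fst (rot \<phi> z))))"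
      by (intro integrable_gauss2_exp_type growth)
    show "norm (P (fst z)) * norm (P (fst (rot \<phi> z))) \<le> G (fst z) / 2 + G (fst (rot \<phi> z)) / 2" for z
      using sum_squares_bound[of "norm (P (fst z))" "norm (P (fst (rot \<phi> z)))"] by (simp add: G_def)
  qed (use i in auto)
  also have "\<dots> = \<delta>"
    using i by (simp add: \<delta>_def gauss2_fst gauss2_fst_rot exp_type_G)
  finally show ?thesis .
qed

lemma integral_norm_I_le:
  "(\<integral>z. norm (P (fst z)) * I \<theta> (fst (rot \<phi> z)) \<partial>(\<gamma>\<^sub>2 :: ((real ^ 'n) \<times> _) measure)) \<le> \<delta>"
proof -
  let ?M = "\<gamma>\<^sub>2 :: ((real ^ 'n) \<times> _) measure"
  define J where "J x = (\<integral>y. G (fst (rot (- \<theta>) (x, y))) \<partial>\<gamma>)" for x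
  have J: "exp_type J"
    unfolding J_def[abs_def] by (rule exp_type_integral[of "\<lambda>z. G (fst (rot (- \<theta>) z))"]) (intro growth)
  have i: "integrable ?M (\<lambda>z. G (fst z))" "integrable ?M (\<lambda>z. J (fst (rot \<phi> z)))"
    by (intro integrable_gauss2_exp_type growth exp_type_compose[OF J])+
  have le: "norm (P (fst z)) * I \<theta> w \<le> G (fst z) / 2 + J w / 2" for z and w :: "real ^ 'n"
  proof -
    let ?u = "\<lambda>y. fst (rot (- \<theta>) (w, y))"
    have j: "integrable \<gamma> (\<lambda>y. G (?u y))"
      by (intro integrable_gauss_exp_type growth)
    have "norm (P (fst z)) * I \<theta> w = (\<integral>y. norm (P (fst z)) * norm (P (?u y)) \<partial>\<gamma>)"
      by (simp add: I_def)
    also have "\<dots> \<le> (\<integral>y. G (fst z) / 2 + G (?u y) / 2 \<partial>\<gamma>)"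
    proof (rule integral_mono)
      show "integrable \<gamma> (\<lambda>y. norm (P (fst z)) * norm (P (?u y)))"
        by (intro integrable_gauss_exp_type growth)
      show "norm (P (fst z)) * norm (P (?u y)) \<le> G (fst z) / 2 + G (?u y) / 2" for y
        using sum_squares_bound[of "norm (P (fst z))" "norm (P (?u y))"] by (simp add: G_def)
    qed (use j in auto)
    also have "\<dots> = G (fst z) / 2 + J w / 2"
      using j by (simp add: J_def gauss.prob_space[simplified])
    finally show ?thesis .
  qed
  have "(\<integral>z. norm (P (fst z)) * I \<theta> (fst (rot \<phi> z)) \<partial>?M) \<le> (\<integral>z. G (fst z) / 2 + J (fst (rot \<phi> z)) / 2 \<partial>?M)"
  proof (rule integral_mono)
    show "integrable ?M (\<lambda>z. norm (P (fst z)) * I \<theta> (fst (rot \<phi> z)))"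
      by (intro integrable_gauss2_exp_type growth)
  qed (use i le in auto)
  also have "\<dots> = \<delta> / 2 + (\<integral>x. J x \<partial>\<gamma>) / 2"
    using i by (simp add: \<delta>_def gauss2_fst gauss2_fst_rot exp_type_G J)
  also have "(\<integral>x. J x \<partial>\<gamma>) = (\<integral>z. G (fst (rot (- \<theta>) z)) \<partial>?M)"
    unfolding J_def by (rule gauss2_integral[symmetric]) (intro growth)
  also have "\<dots> = \<delta>" by (simp add: \<delta>_def gauss2_fst_rot exp_type_G)
  finally show ?thesis by simp
qed

text \<open>
  The dimension-free second-order estimate: the gradient of \<open>\<kappa>(G)\<close> and the local Lipschitz constant
  of \<open>Q\<close> are both controlled by \<open>|P|\<close> at standard Gaussian points, where \<open>|P|\<^sup>2\<close> has mean \<open>\<delta>\<close>.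
\<close>

lemma cov_Q_bound:
  assumes \<kappa>: "C11 \<kappa> \<kappa>' M1 M2"
  shows "\<bar>(\<integral>x. \<kappa> (G x) * Q \<theta> x \<partial>\<gamma>) - (\<integral>x. \<kappa> (G x) \<partial>\<gamma>) * (\<integral>x. Q \<theta> x \<partial>\<gamma>)\<bar>
    \<le> 2 * pi * M1 * \<delta>"
proof -
  let ?M = "\<gamma>\<^sub>2 :: ((real ^ 'n) \<times> _) measure"
  have M1: "0 \<le> M1" "\<And>u. \<bar>\<kappa>' u\<bar> \<le> M1" using \<kappa> by (auto simp: C11_def)
  have k: "exp_type (\<lambda>x. \<kappa>' (G x))" by (rule exp_type_C11_deriv[OF \<kappa>])
  have bound: "\<bar>\<integral>z. (\<kappa>' (G (fst z)) * (2 * (P (fst z) \<bullet> snd z))) * Q \<theta> (fst (rot (- \<phi>) z)) \<partial>?M\<bar> \<le> 4 * M1 * \<delta>" for \<phi>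
  proof -
    let ?u = "\<lambda>x y. fst (rot (- \<phi>) (x, y))"
    have inner: "\<bar>\<integral>y. (\<kappa>' (G x) * (2 * (P x \<bullet> y))) * Q \<theta> (?u x y) \<partial>\<gamma>\<bar> \<le>
        2 * M1 * (\<integral>y. norm (P x) * (I \<theta> (?u x y) + norm (P (?u x y))) \<partial>\<gamma>)" for x
    proof -
      have "(\<integral>y. (\<kappa>' (G x) * (2 * (P x \<bullet> y))) * Q \<theta> (?u x y) \<partial>\<gamma>) =
          (\<integral>y. (\<kappa>' (G x) * 2) * (Q \<theta> (?u x y) * (y \<bullet> P x)) \<partial>\<gamma>)"
        by (rule Bochner_Integration.integral_cong) (auto simp: inner_commute)
      then have "\<bar>\<integral>y. (\<kappa>' (G x) * (2 * (P x \<bullet> y))) * Q \<theta> (?u x y) \<partial>\<gamma>\<bar> =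
          \<bar>\<kappa>' (G x)\<bar> * 2 * \<bar>\<integral>y. Q \<theta> (?u x y) * (y \<bullet> P x) \<partial>\<gamma>\<bar>"
        by (simp add: abs_mult)
      also have "\<dots> \<le> M1 * 2 * (norm (P x) * (\<integral>y. I \<theta> (?u x y) + norm (P (?u x y)) \<partial>\<gamma>))"
        using M1 by (intro mult_mono Q_weighted_bound) auto
      finally show ?thesis by (simp add: mult_ac)
    qed
    have t1: "exp_type (\<lambda>z :: (real ^ 'n) \<times> (real ^ 'n). (\<kappa>' (G (fst z)) * (2 * (P (fst z) \<bullet> snd z))) * Q \<theta> (fst (rot (- \<phi>) z)))"
      by (intro growth exp_type_compose[OF k])
    have t2: "exp_type (\<lambda>z :: (real ^ 'n) \<times> (real ^ 'n). norm (P (fst z)) * (I \<theta> (fst (rot (- \<phi>) z)) + norm (P (fst (rot (- \<phi>) z)))))"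
      by (intro growth)
    have t3: "integrable ?M (\<lambda>z. norm (P (fst z)) * I \<theta> (fst (rot (- \<phi>) z)))"
      and t4: "integrable ?M (\<lambda>z. norm (P (fst z)) * norm (P (fst (rot (- \<phi>) z))))"
      by (intro integrable_gauss2_exp_type growth)+
    have "\<bar>\<integral>z. (\<kappa>' (G (fst z)) * (2 * (P (fst z) \<bullet> snd z))) * Q \<theta> (fst (rot (- \<phi>) z)) \<partial>?M\<bar> =
        \<bar>\<integral>x. (\<integral>y. (\<kappa>' (G x) * (2 * (P x \<bullet> y))) * Q \<theta> (?u x y) \<partial>\<gamma>) \<partial>\<gamma>\<bar>"
      by (subst gauss2_integral[OF t1]) simp
    also have "\<dots> \<le> (\<integral>x. \<bar>\<integral>y. (\<kappa>' (G x) * (2 * (P x \<bullet> y))) * Q \<theta> (?u x y) \<partial>\<gamma>\<bar> \<partial>\<gamma>)"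
      by (rule integral_abs_bound)
    also have "\<dots> \<le> (\<integral>x. 2 * M1 * (\<integral>y. norm (P x) * (I \<theta> (?u x y) + norm (P (?u x y))) \<partial>\<gamma>) \<partial>\<gamma>)"
      using exp_type_integral[OF t1] exp_type_integral[OF t2] inner
      by (intro integral_mono integrable_abs integrable_mult_right integrable_gauss_exp_type) auto
    also have "\<dots> = 2 * M1 * (\<integral>z. norm (P (fst z)) * (I \<theta> (fst (rot (- \<phi>) z)) + norm (P (fst (rot (- \<phi>) z)))) \<partial>?M)"
      by (subst gauss2_integral[OF t2]) simp
    also have "\<dots> = 2 * M1 * ((\<integral>z. norm (P (fst z)) * I \<theta> (fst (rot (- \<phi>) z)) \<partial>?M) +
        (\<integral>z. norm (P (fst z)) * norm (P (fst (rot (- \<phi>) z))) \<partial>?M))"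
      using t3 t4 by (simp add: distrib_left)
    also have "\<dots> \<le> 2 * M1 * (\<delta> + \<delta>)"
      using M1 by (intro mult_left_mono add_mono integral_norm_I_le integral_norm_product_le) auto
    finally show ?thesis by simp
  qed
  show ?thesis
    using cov_C11_bound[OF \<kappa> exp_type_Q bound] by (simp add: mult_ac)
qed

lemma mean_Q_bound: "\<bar>\<integral>x. Q \<theta> x \<partial>\<gamma>\<bar> \<le> \<delta>"
proof -
  let ?M = "\<gamma>\<^sub>2 :: ((real ^ 'n) \<times> _) measure"
  have "(\<integral>x. Q \<theta> x \<partial>\<gamma>) = (\<integral>z. P (fst z) \<bullet> P (fst (rot (- \<theta>) z)) \<partial>?M)"
    unfolding Q_def by (subst gauss2_integral) (auto intro!: growth)
  also have "\<bar>\<dots>\<bar> \<le> (\<integral>z. \<bar>P (fst z) \<bullet> P (fst (rot (- \<theta>) z))\<bar> \<partial>?M)"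
    by (rule integral_abs_bound)
  also have "\<dots> \<le> (\<integral>z. norm (P (fst z)) * norm (P (fst (rot (- \<theta>) z))) \<partial>?M)"
    by (intro integral_mono integrable_gauss2_exp_type growth Cauchy_Schwarz_ineq2)
  also have "\<dots> \<le> \<delta>" by (rule integral_norm_product_le)
  finally show ?thesis .
qed

lemma stein_integral:
  assumes k: "exp_type k"
  shows "(\<integral>z. (k (fst z) * (2 * (P (fst z) \<bullet> snd z))) * G (fst (rot (- \<theta>) z)) \<partial>(\<gamma>\<^sub>2 :: ((real ^ 'n) \<times> _) measure)) =
    - 4 * sin \<theta> * (\<integral>x. k x * Q \<theta> x \<partial>\<gamma>)"
proof -
  have "exp_type (\<lambda>z. (k (fst z) * (2 * (P (fst z) \<bullet> snd z))) * G (fst (rot (- \<theta>) z)))"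
    by (intro growth exp_type_compose[OF k])
  then have "(\<integral>z. (k (fst z) * (2 * (P (fst z) \<bullet> snd z))) * G (fst (rot (- \<theta>) z)) \<partial>(\<gamma>\<^sub>2 :: ((real ^ 'n) \<times> _) measure)) =
      (\<integral>x. (\<integral>y. k x * ((2 * (P x \<bullet> y)) * G (fst (rot (- \<theta>) (x, y)))) \<partial>\<gamma>) \<partial>\<gamma>)"
    by (subst gauss2_integral) (simp_all add: mult.assoc)
  also have "\<dots> = (\<integral>x. k x * (- 4 * sin \<theta> * Q \<theta> x) \<partial>\<gamma>)"
    by (subst integral_mult_right_zero) (subst gauss_stein_G, rule refl)
  also have "\<dots> = (\<integral>x. (- 4 * sin \<theta>) * (k x * Q \<theta> x) \<partial>\<gamma>)"
    by (rule Bochner_Integration.integral_cong) auto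
  finally show ?thesis by (simp only: integral_mult_right_zero)
qed

text \<open>
  A Poincare inequality for \<open>G\<close>, whose gradient \<open>2 P\<close> has mean square \<open>4\<delta>\<close>.  The constant \<open>2\<pi>\<close> instead
  of \<open>4\<close> comes from using the mean value theorem in \<open>\<theta>\<close>.
\<close>

lemma variance_G_le: "\<sigma>2 \<le> 2 * pi * \<delta>"
proof -
  have "C11 (\<lambda>u. u) (\<lambda>u. 1) 1 0"
    by (auto simp: C11_def intro!: derivative_eq_intros)
  moreover have "\<bar>\<integral>z. (1 * (2 * (P (fst z) \<bullet> snd z))) * G (fst (rot (- \<theta>) z)) \<partial>\<gamma>\<^sub>2\<bar> \<le> 4 * \<delta>" for \<theta>
  proof -
    have "\<bar>- 4 * sin \<theta> * (\<integral>x. 1 * Q \<theta> x \<partial>\<gamma>)\<bar> = 4 * (\<bar>sin \<theta>\<bar> * \<bar>\<integral>x. Q \<theta> x \<partial>\<gamma>\<bar>)"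
      by (simp add: abs_mult)
    also have "\<dots> \<le> 4 * (1 * \<delta>)"
      by (intro mult_left_mono mult_mono mean_Q_bound) auto
    finally show ?thesis
      by (subst stein_integral[of "\<lambda>_. 1"]) (auto intro: growth)
  qed
  ultimately have "\<bar>(\<integral>x. G x * G x \<partial>\<gamma>) - (\<integral>x. G x \<partial>\<gamma>) * (\<integral>x. G x \<partial>\<gamma>)\<bar> \<le> pi / 2 * (4 * \<delta>)"
    by (intro cov_C11_bound exp_type_G)
  then show ?thesis by (simp add: \<sigma>2_def \<delta>_def power2_eq_square)
qed

text \<open>
  Subtracting from \<open>\<kappa>\<close> the linear function with slope \<open>m = E \<kappa>'(G)\<close> turns the claim into a bound for
  the covariance of \<open>\<kappa>(G) - m G\<close> with \<open>G\<close>.  The rotation estimate expresses it through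
  \<open>E (\<kappa>'(G) - m) Q\<close>, which is itself the covariance of \<open>\<kappa>'(G)\<close> and \<open>Q\<close>, so that \<open>cov_Q_bound\<close>
  applies.
\<close>

lemma stein_bound:
  assumes \<kappa>: "C11 \<kappa> \<kappa>' M1 M2" and \<kappa>': "C11 \<kappa>' \<kappa>'' M2 M3"
  shows "\<bar>(\<integral>x. \<kappa> (G x) * (G x - \<delta>) \<partial>\<gamma>) - \<sigma>2 * (\<integral>x. \<kappa>' (G x) \<partial>\<gamma>)\<bar> \<le> 4 * pi\<^sup>2 * M2 * \<delta>"
proof -
  define m where "m = (\<integral>x. \<kappa>' (G x) \<partial>\<gamma>)"
  have M2: "0 \<le> M2" using \<kappa> by (auto simp: C11_def)
  have \<delta>: "0 \<le> \<delta>" unfolding \<delta>_def by (rule integral_nonneg_AE) (simp add: G_nonneg)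
  note km = C11_diff_linear[OF \<kappa>, of m]
  have k': "exp_type (\<lambda>x. \<kappa>' (G x))" by (rule exp_type_C11_deriv[OF \<kappa>])
  have i: "integrable \<gamma> (\<lambda>x. \<kappa>' (G x) * Q \<theta> x)" "integrable \<gamma> (Q \<theta>)" for \<theta>
    by (intro integrable_gauss_exp_type growth k')+
  have bound: "\<bar>\<integral>z. ((\<kappa>' (G (fst z)) - m) * (2 * (P (fst z) \<bullet> snd z))) * G (fst (rot (- \<theta>) z)) \<partial>\<gamma>\<^sub>2\<bar>
      \<le> 8 * pi * M2 * \<delta>" for \<theta>
  proof -
    have "(\<integral>x. (\<kappa>' (G x) - m) * Q \<theta> x \<partial>\<gamma>) = (\<integral>x. \<kappa>' (G x) * Q \<theta> x \<partial>\<gamma>) - m * (\<integral>x. Q \<theta> x \<partial>\<gamma>)"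
      using i[of \<theta>] by (simp add: left_diff_distrib)
    then have c: "\<bar>\<integral>x. (\<kappa>' (G x) - m) * Q \<theta> x \<partial>\<gamma>\<bar> \<le> 2 * pi * M2 * \<delta>"
      using cov_Q_bound[OF \<kappa>', of \<theta>] by (simp add: m_def)
    have "\<bar>- 4 * sin \<theta> * (\<integral>x. (\<kappa>' (G x) - m) * Q \<theta> x \<partial>\<gamma>)\<bar> =
        4 * (\<bar>sin \<theta>\<bar> * \<bar>\<integral>x. (\<kappa>' (G x) - m) * Q \<theta> x \<partial>\<gamma>\<bar>)"
      by (simp add: abs_mult)
    also have "\<dots> \<le> 4 * (1 * (2 * pi * M2 * \<delta>))"
      by (intro mult_left_mono mult_mono c) auto
    finally show ?thesis
      by (subst stein_integral[of "\<lambda>x. \<kappa>' (G x) - m"]) (auto intro: growth k')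
  qed
  have j: "integrable \<gamma> (\<lambda>x. \<kappa> (G x) * G x)" "integrable \<gamma> (\<lambda>x. \<kappa> (G x))"
    "integrable \<gamma> (\<lambda>x. G x * G x)" "integrable \<gamma> G"
    by (intro integrable_gauss_exp_type growth exp_type_C11[OF \<kappa>])+
  have "\<bar>(\<integral>x. (\<kappa> (G x) - m * G x) * G x \<partial>\<gamma>) - (\<integral>x. \<kappa> (G x) - m * G x \<partial>\<gamma>) * (\<integral>x. G x \<partial>\<gamma>)\<bar>
      \<le> pi / 2 * (8 * pi * M2 * \<delta>)"
    by (rule cov_C11_bound[OF km exp_type_G bound])
  also have "(\<integral>x. (\<kappa> (G x) - m * G x) * G x \<partial>\<gamma>) - (\<integral>x. \<kappa> (G x) - m * G x \<partial>\<gamma>) * (\<integral>x. G x \<partial>\<gamma>) =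
      (\<integral>x. \<kappa> (G x) * (G x - \<delta>) \<partial>\<gamma>) - \<sigma>2 * m"
    using j unfolding \<sigma>2_def \<delta>_def[symmetric]
    by (simp add: left_diff_distrib right_diff_distrib mult.assoc power2_eq_square)
      (simp add: algebra_simps \<delta>_def[symmetric])
  finally show ?thesis by (simp add: m_def power2_eq_square mult_ac)
qed

end

section \<open>The characteristic function of the squared projection\<close>

text \<open>
  Since \<open>|exp(iu) - 1 - iu| \<le> u\<^sup>2/2\<close>, the error of the linear approximation is of order \<open>h\<^sup>2\<close> as soon as
  \<open>Y X\<^sup>2\<close> is integrable.
\<close>

lemma weighted_char_has_vector_derivative:
  fixes X Y :: "'a \<Rightarrow> real"
  assumes [measurable]: "X \<in> borel_measurable M" "Y \<in> borel_measurable M"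
    and i0: "integrable M Y" and i1: "integrable M (\<lambda>x. Y x * X x)" and i2: "integrable M (\<lambda>x. Y x * (X x)\<^sup>2)"
  shows "((\<lambda>t. \<integral>x. of_real (Y x) * iexp (t * X x) \<partial>M) has_vector_derivative
    (\<integral>x. of_real (Y x * X x) * (\<i> * iexp (t * X x)) \<partial>M)) (at t)"
proof -
  let ?F = "\<lambda>t. \<integral>x. of_real (Y x) * iexp (t * X x) \<partial>M"
  let ?D = "\<integral>x. of_real (Y x * X x) * (\<i> * iexp (t * X x)) \<partial>M"
  define c where "c = (\<integral>x. \<bar>Y x * (X x)\<^sup>2\<bar> \<partial>M)"
  have j0: "integrable M (\<lambda>x. of_real (Y x) * iexp (s * X x))" for s
    by (rule Bochner_Integration.integrable_bound[OF i0]) (auto simp: norm_mult)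
  have j1: "integrable M (\<lambda>x. of_real (Y x * X x) * (\<i> * iexp (s * X x)))" for s
    by (rule Bochner_Integration.integrable_bound[OF i1]) (auto simp: norm_mult)
  have le: "norm (?F (t + h) - ?F t - of_real h * ?D) \<le> h\<^sup>2 * c" for h
  proof -
    let ?e = "\<lambda>x. of_real (Y x) * iexp ((t + h) * X x) - of_real (Y x) * iexp (t * X x) -
      of_real h * (of_real (Y x * X x) * (\<i> * iexp (t * X x)))"
    have eq: "?F (t + h) - ?F t - of_real h * ?D = (\<integral>x. ?e x \<partial>M)"
      using j0[of "t + h"] j0[of t] j1[of t] by (simp del: of_real_add of_real_mult)
    have "norm (\<integral>x. ?e x \<partial>M) \<le> (\<integral>x. norm (?e x) \<partial>M)"
      by (rule integral_norm_bound)
    also have "\<dots> \<le> (\<integral>x. h\<^sup>2 * \<bar>Y x * (X x)\<^sup>2\<bar> \<partial>M)"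
    proof (rule integral_mono)
      show "integrable M (\<lambda>x. norm (?e x))"
        by (intro integrable_norm Bochner_Integration.integrable_diff integrable_mult_right j0 j1)
      show "integrable M (\<lambda>x. h\<^sup>2 * \<bar>Y x * (X x)\<^sup>2\<bar>)"
        using i2 by (intro integrable_mult_right integrable_abs)
      fix x
      have "?e x = of_real (Y x) * iexp (t * X x) * (iexp (h * X x) - (1 + \<i> * of_real (h * X x)))"
        by (simp add: algebra_simps exp_add)
      then have "norm (?e x) = \<bar>Y x\<bar> * norm (iexp (h * X x) - (1 + \<i> * of_real (h * X x)))"
        by (simp add: norm_mult)
      also have "\<dots> \<le> \<bar>Y x\<bar> * ((h * X x)\<^sup>2 / 2)"
        using iexp_approx1[of "h * X x" 1] by (intro mult_left_mono) (auto simp: numeral_eq_Suc)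
      also have "\<dots> \<le> \<bar>Y x\<bar> * (h * X x)\<^sup>2"
        by (intro mult_left_mono) auto
      finally show "norm (?e x) \<le> h\<^sup>2 * \<bar>Y x * (X x)\<^sup>2\<bar>"
        by (simp add: abs_mult power_mult_distrib mult_ac)
    qed
    finally show ?thesis unfolding eq by (simp add: c_def)
  qed
  have c: "0 \<le> c" unfolding c_def by (rule integral_nonneg_AE) simp
  show ?thesis
    unfolding has_vector_derivative_def has_derivative_at
  proof (intro conjI bounded_linear_scaleR_left)
    show "(\<lambda>h. norm (?F (t + h) - ?F t - h *\<^sub>R ?D) / norm h) \<midarrow>0\<rightarrow> 0"
    proof (rule Lim_null_comparison)
      show "\<forall>\<^sub>F h in at 0. norm (norm (?F (t + h) - ?F t - h *\<^sub>R ?D) / norm h) \<le> \<bar>h\<bar> * c"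
      proof (rule always_eventually, rule allI)
        fix h :: real
        show "norm (norm (?F (t + h) - ?F t - h *\<^sub>R ?D) / norm h) \<le> \<bar>h\<bar> * c"
          using le[of h] c by (cases "h = 0") (simp_all add: scaleR_conv_of_real divide_le_eq power2_eq_square mult_ac flip: abs_mult)
      qed
      show "((\<lambda>h. \<bar>h\<bar> * c) \<longlongrightarrow> 0) (at 0)"
        by (auto intro!: tendsto_eq_intros)
    qed
  qed
qed

lemma C11I:
  assumes "\<And>u. (\<kappa> has_real_derivative \<kappa>' u) (at u)" "\<And>u. (\<kappa>' has_real_derivative \<kappa>'' u) (at u)"
    and "\<And>u. \<bar>\<kappa>' u\<bar> \<le> M1" "\<And>u. \<bar>\<kappa>'' u\<bar> \<le> M2"
  shows "C11 \<kappa> \<kappa>' M1 M2"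
proof -
  have "\<bar>\<kappa>' u - \<kappa>' v\<bar> \<le> M2 * \<bar>u - v\<bar>" for u v
    using field_differentiable_bound[of UNIV \<kappa>' \<kappa>'' M2 u v] assms(2,4) by simp
  then show ?thesis
    using assms order_trans[OF abs_ge_zero assms(3)] order_trans[OF abs_ge_zero assms(4)]
    unfolding C11_def by blast
qed

lemma iexp_eq: "iexp y = of_real (cos y) + \<i> * of_real (sin y)"
  by (simp add: cis_conv_exp[symmetric] complex_eq_iff)

lemma iexp_integral:
  assumes "prob_space M" and [measurable]: "X \<in> borel_measurable M"
  shows "(\<integral>x. iexp (X x) \<partial>M) = of_real (\<integral>x. cos (X x) \<partial>M) + \<i> * of_real (\<integral>x. sin (X x) \<partial>M)"
proof -
  interpret prob_space M by fact
  have "integrable M (\<lambda>x. cos (X x))" "integrable M (\<lambda>x. sin (X x))"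
    by (intro integrable_const_bound[of _ 1]; simp)+
  then have "(\<integral>x. of_real (cos (X x)) + \<i> * of_real (sin (X x)) \<partial>M) =
      of_real (\<integral>x. cos (X x) \<partial>M) + \<i> * of_real (\<integral>x. sin (X x) \<partial>M)"
    by (subst Bochner_Integration.integral_add) auto
  then show ?thesis by (simp only: iexp_eq)
qed

context cone_projection
begin

lemma \<delta>_nonneg: "0 \<le> \<delta>"
  unfolding \<delta>_def by (rule integral_nonneg_AE) (simp add: G_nonneg)

lemma \<sigma>2_nonneg: "0 \<le> \<sigma>2"
proof -
  have i: "integrable \<gamma> G" "integrable \<gamma> (\<lambda>x. (G x)\<^sup>2)"
    by (intro integrable_gauss_exp_type growth)+
  show ?thesis
    using gauss.variance_positive[of G] gauss.variance_eq[OF i] by (simp add: \<sigma>2_def \<delta>_def)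
qed

definition \<phi> :: "real \<Rightarrow> complex" where
  "\<phi> t = (\<integral>x. iexp (t * (G x - \<delta>)) \<partial>\<gamma>)"

lemma \<phi>_deriv:
  "(\<phi> has_vector_derivative (\<integral>x. of_real (G x - \<delta>) * (\<i> * iexp (t * (G x - \<delta>))) \<partial>\<gamma>)) (at t)"
proof -
  have [measurable]: "G \<in> borel_measurable borel" by (rule exp_type_measurable[OF exp_type_G])
  have "((\<lambda>t. \<integral>x. of_real 1 * iexp (t * (G x - \<delta>)) \<partial>\<gamma>) has_vector_derivative
      (\<integral>x. of_real (1 * (G x - \<delta>)) * (\<i> * iexp (t * (G x - \<delta>))) \<partial>\<gamma>)) (at t)"
    by (rule weighted_char_has_vector_derivative; (intro integrable_gauss_exp_type growth)?) auto
  then show ?thesis by (simp add: \<phi>_def[abs_def])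
qed

text \<open>
  The integral is the derivative of \<open>\<phi>\<close>, so this is the equation \<open>\<phi>' = - \<sigma>2 t \<phi>\<close> of the Gaussian
  characteristic function with an error term.  Real and imaginary part are \<open>stein_bound\<close> for
  \<open>sin(t(u - \<delta>))\<close> and \<open>cos(t(u - \<delta>))\<close>, whose second derivatives are bounded by \<open>t\<^sup>2\<close>.
\<close>

lemma \<phi>_ode:
  "norm ((\<integral>x. of_real (G x - \<delta>) * (\<i> * iexp (t * (G x - \<delta>))) \<partial>\<gamma>) + of_real (t * \<sigma>2) * \<phi> t)
    \<le> 8 * pi\<^sup>2 * t\<^sup>2 * \<delta>"
proof -
  have [measurable]: "G \<in> borel_measurable borel" by (rule exp_type_measurable[OF exp_type_G])
  let ?c = "\<lambda>u. cos (t * (u - \<delta>))" and ?s = "\<lambda>u. sin (t * (u - \<delta>))"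
  have C: "C11 ?c (\<lambda>u. - t * ?s u) \<bar>t\<bar> (t\<^sup>2)"
    and C': "C11 (\<lambda>u. - t * ?s u) (\<lambda>u. - t\<^sup>2 * ?c u) (t\<^sup>2) (\<bar>t\<bar> ^ 3)"
    and S: "C11 ?s (\<lambda>u. t * ?c u) \<bar>t\<bar> (t\<^sup>2)"
    and S': "C11 (\<lambda>u. t * ?c u) (\<lambda>u. - t\<^sup>2 * ?s u) (t\<^sup>2) (\<bar>t\<bar> ^ 3)"
  proof -
    have b: "\<bar>a * cos x\<bar> \<le> K" "\<bar>a * sin x\<bar> \<le> K" if "\<bar>a\<bar> \<le> K" for a x K :: real
      using mult_mono[OF that abs_cos_le_one[of x]] mult_mono[OF that abs_sin_le_one[of x]] that
      by (simp_all add: abs_mult)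
    show "C11 ?c (\<lambda>u. - t * ?s u) \<bar>t\<bar> (t\<^sup>2)"
    proof (rule C11I[where \<kappa>''="\<lambda>u. - t\<^sup>2 * ?c u"])
    qed ((rule b, simp add: power_abs) | (rule derivative_eq_intros refl)+, simp add: power2_eq_square power3_eq_cube)+
    show "C11 (\<lambda>u. - t * ?s u) (\<lambda>u. - t\<^sup>2 * ?c u) (t\<^sup>2) (\<bar>t\<bar> ^ 3)"
    proof (rule C11I[where \<kappa>''="\<lambda>u. t ^ 3 * ?s u"])
    qed ((rule b, simp add: power_abs) | (rule derivative_eq_intros refl)+, simp add: power2_eq_square power3_eq_cube)+
    show "C11 ?s (\<lambda>u. t * ?c u) \<bar>t\<bar> (t\<^sup>2)"
    proof (rule C11I[where \<kappa>''="\<lambda>u. - t\<^sup>2 * ?s u"])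
    qed ((rule b, simp add: power_abs) | (rule derivative_eq_intros refl)+, simp add: power2_eq_square power3_eq_cube)+
    show "C11 (\<lambda>u. t * ?c u) (\<lambda>u. - t\<^sup>2 * ?s u) (t\<^sup>2) (\<bar>t\<bar> ^ 3)"
    proof (rule C11I[where \<kappa>''="\<lambda>u. - (t ^ 3) * ?c u"])
    qed ((rule b, simp add: power_abs) | (rule derivative_eq_intros refl)+, simp add: power2_eq_square power3_eq_cube)+
  qed
  let ?Ec = "\<integral>x. ?c (G x) \<partial>\<gamma>" and ?Es = "\<integral>x. ?s (G x) \<partial>\<gamma>"
  let ?Gc = "\<integral>x. ?c (G x) * (G x - \<delta>) \<partial>\<gamma>" and ?Gs = "\<integral>x. ?s (G x) * (G x - \<delta>) \<partial>\<gamma>"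
  have 1: "\<bar>?Gc + \<sigma>2 * t * ?Es\<bar> \<le> 4 * pi\<^sup>2 * t\<^sup>2 * \<delta>"
    using stein_bound[OF C C'] by simp
  have 2: "\<bar>?Gs - \<sigma>2 * t * ?Ec\<bar> \<le> 4 * pi\<^sup>2 * t\<^sup>2 * \<delta>"
    using stein_bound[OF S S'] by simp
  have \<phi>: "\<phi> t = of_real ?Ec + \<i> * of_real ?Es"
    unfolding \<phi>_def by (subst iexp_integral) (auto intro: prob_space_std_gaussian)
  have i: "integrable \<gamma> (\<lambda>x. ?c (G x) * (G x - \<delta>))" "integrable \<gamma> (\<lambda>x. ?s (G x) * (G x - \<delta>))"
    by (intro integrable_gauss_exp_type growth exp_type_C11[OF C] exp_type_C11[OF S])+
  have "of_real (G x - \<delta>) * (\<i> * iexp (t * (G x - \<delta>))) =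
      \<i> * of_real (?c (G x) * (G x - \<delta>)) - of_real (?s (G x) * (G x - \<delta>))" for x
    by (simp only: iexp_eq) (simp add: complex_eq_iff)
  then have "(\<integral>x. of_real (G x - \<delta>) * (\<i> * iexp (t * (G x - \<delta>))) \<partial>\<gamma>) = \<i> * of_real ?Gc - of_real ?Gs"
    using i by (simp del: of_real_mult of_real_diff)
  then have eq: "(\<integral>x. of_real (G x - \<delta>) * (\<i> * iexp (t * (G x - \<delta>))) \<partial>\<gamma>) + of_real (t * \<sigma>2) * \<phi> t =
      \<i> * of_real (?Gc + \<sigma>2 * t * ?Es) - of_real (?Gs - \<sigma>2 * t * ?Ec)"
    by (simp add: \<phi> algebra_simps)
  have "norm (\<i> * complex_of_real (?Gc + \<sigma>2 * t * ?Es) - of_real (?Gs - \<sigma>2 * t * ?Ec)) \<le> \<bar>?Gc + \<sigma>2 * t * ?Es\<bar> + \<bar>?Gs - \<sigma>2 * t * ?Ec\<bar>"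
    by (rule order_trans[OF norm_triangle_ineq4]) (simp only: norm_mult norm_of_real norm_ii mult_1 order_refl)
  then show ?thesis unfolding eq using 1 2 by linarith
qed

lemma \<phi>_gauss:
  assumes "0 \<le> t"
  shows "norm (\<phi> t - of_real (exp (- \<sigma>2 * t\<^sup>2 / 2))) \<le> 8 * pi\<^sup>2 * t ^ 3 * \<delta>"
proof (cases "t = 0")
  case True
  then show ?thesis by (simp add: \<phi>_def gauss.prob_space[simplified])
next
  case False
  let ?\<phi>' = "\<lambda>t. \<integral>x. of_real (G x - \<delta>) * (\<i> * iexp (t * (G x - \<delta>))) \<partial>\<gamma>"
  \<comment> \<open>Integrating factor of the differential equation.\<close>
  let ?g = "\<lambda>s. of_real (exp (\<sigma>2 * s\<^sup>2 / 2)) * \<phi> s"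
  let ?B = "8 * pi\<^sup>2 * t\<^sup>2 * \<delta> * exp (\<sigma>2 * t\<^sup>2 / 2)"
  have e: "((\<lambda>s. complex_of_real (exp (\<sigma>2 * s\<^sup>2 / 2))) has_vector_derivative of_real (exp (\<sigma>2 * s\<^sup>2 / 2) * (\<sigma>2 * s))) (at s)" for s
    by (intro has_vector_derivative_of_real) (auto intro!: derivative_eq_intros)
  have g: "(?g has_vector_derivative of_real (exp (\<sigma>2 * s\<^sup>2 / 2)) * (?\<phi>' s + of_real (s * \<sigma>2) * \<phi> s)) (at s)" for s
    using has_vector_derivative_mult[OF e \<phi>_deriv, of s] by (simp add: algebra_simps)
  have "norm (?g t - ?g 0) \<le> ?B * t - ?B * 0"
  proof (rule differentiable_bound_general[where f=ttt and \<phi>="\<lambda>s. ?B * s" for ttt])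
    show "0 < t" using assms False by simp
    show "continuous_on {0..t} ?g"
      using g by (intro continuous_at_imp_continuous_on ballI has_vector_derivative_continuous) blast
    show "continuous_on {0..t} (\<lambda>s. ?B * s)" by (intro continuous_intros)
    show "(?g has_vector_derivative of_real (exp (\<sigma>2 * s\<^sup>2 / 2)) * (?\<phi>' s + of_real (s * \<sigma>2) * \<phi> s)) (at s)" for s
      by (rule g)
    show "((\<lambda>s. ?B * s) has_vector_derivative ?B) (at s)" for s
      by (auto intro!: derivative_eq_intros)
    fix s assume s: "0 < s" "s < t"
    have s2: "s\<^sup>2 \<le> t\<^sup>2" using s by (intro power_mono) auto
    have "norm (of_real (exp (\<sigma>2 * s\<^sup>2 / 2)) * (?\<phi>' s + of_real (s * \<sigma>2) * \<phi> s)) =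
        exp (\<sigma>2 * s\<^sup>2 / 2) * norm (?\<phi>' s + of_real (s * \<sigma>2) * \<phi> s)"
      by (simp add: norm_mult)
    also have "\<dots> \<le> exp (\<sigma>2 * t\<^sup>2 / 2) * (8 * pi\<^sup>2 * t\<^sup>2 * \<delta>)"
    proof (intro mult_mono)
      show "exp (\<sigma>2 * s\<^sup>2 / 2) \<le> exp (\<sigma>2 * t\<^sup>2 / 2)"
        using mult_left_mono[OF s2 \<sigma>2_nonneg] by simp
      show "norm (?\<phi>' s + of_real (s * \<sigma>2) * \<phi> s) \<le> 8 * pi\<^sup>2 * t\<^sup>2 * \<delta>"
        by (rule order_trans[OF \<phi>_ode]) (intro mult_right_mono mult_left_mono s2, auto simp: \<delta>_nonneg)
    qed auto
    finally show "norm (of_real (exp (\<sigma>2 * s\<^sup>2 / 2)) * (?\<phi>' s + of_real (s * \<sigma>2) * \<phi> s)) \<le> ?B"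
      by (simp add: mult_ac)
  qed
  then have 1: "norm (?g t - 1) \<le> ?B * t"
    by (simp add: \<phi>_def gauss.prob_space[simplified])
  have "\<phi> t - of_real (exp (- \<sigma>2 * t\<^sup>2 / 2)) = of_real (exp (- \<sigma>2 * t\<^sup>2 / 2)) * (?g t - 1)"
    by (simp add: algebra_simps flip: of_real_mult exp_add mult.assoc)
  then have "norm (\<phi> t - of_real (exp (- \<sigma>2 * t\<^sup>2 / 2))) = exp (- \<sigma>2 * t\<^sup>2 / 2) * norm (?g t - 1)"
    by (simp only: norm_mult norm_of_real abs_exp_cancel)
  also have "\<dots> \<le> exp (- \<sigma>2 * t\<^sup>2 / 2) * (?B * t)"
    by (intro mult_left_mono 1) auto
  also have "\<dots> = 8 * pi\<^sup>2 * t ^ 3 * \<delta> * (exp (- \<sigma>2 * t\<^sup>2 / 2) * exp (\<sigma>2 * t\<^sup>2 / 2))"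
    by (simp add: power2_eq_square power3_eq_cube)
  also have "exp (- \<sigma>2 * t\<^sup>2 / 2) * exp (\<sigma>2 * t\<^sup>2 / 2) = 1"
    by (simp flip: exp_add)
  finally show ?thesis by simp
qed

end

text \<open>
  Testing the variational inequality with \<open>0\<close> and \<open>2 P x\<close> gives \<open>\<langle>x, P x\<rangle> = |P x|\<^sup>2\<close>.  Therefore
  \<open>|P y|\<^sup>2 = |y|\<^sup>2 - |y - P y|\<^sup>2\<close>, and the subgradient inequality says that \<open>P y\<close> is at least as close to
  \<open>y\<close> as the point \<open>P x\<close> of the cone.
\<close>

lemma cone_projection_closest_point:
  fixes C :: "(real ^ 'n) set"
  assumes C: "closed C" "convex_cone C" "C \<noteq> {}"
  shows "cone_projection (closest_point C)"
proof -
  have cv: "convex C" and co: "conic C" using C(2) by (auto simp: convex_cone_def)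
  have z: "0 \<in> C" using C co by (metis conic_contains_0)
  have orth: "x \<bullet> closest_point C x = (norm (closest_point C x))\<^sup>2" for x
  proof -
    let ?p = "closest_point C x"
    have p: "?p \<in> C" by (rule closest_point_in_set[OF C(1,3)])
    have "2 *\<^sub>R ?p \<in> C" using co p by (auto simp: conic_def)
    then have "(x - ?p) \<bullet> (2 *\<^sub>R ?p - ?p) \<le> 0" by (intro closest_point_dot cv C)
    moreover have "(x - ?p) \<bullet> (0 - ?p) \<le> 0" by (intro closest_point_dot cv C z)
    ultimately have "(x - ?p) \<bullet> ?p = 0" by (simp add: scaleR_2)
    then show ?thesis by (simp add: inner_diff_left power2_norm_eq_inner)
  qed
  show ?thesis
  proof
    fix x y :: "real ^ 'n"
    let ?p = "closest_point C x" and ?q = "closest_point C y"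
    show "norm (?p - ?q) \<le> norm (x - y)"
      using closest_point_lipschitz[OF cv C(1,3), of x y] by (simp add: dist_norm)
    have "(dist y ?q)\<^sup>2 \<le> (dist y ?p)\<^sup>2"
      by (intro power_mono closest_point_le C closest_point_in_set) auto
    then have "- 2 * (y \<bullet> ?q) + ?q \<bullet> ?q \<le> - 2 * (y \<bullet> ?p) + ?p \<bullet> ?p"
      unfolding dist_norm power2_norm_eq_inner by (simp add: inner_diff_left inner_diff_right inner_commute)
    then show "2 * (?p \<bullet> (y - x)) \<le> (norm ?q)\<^sup>2 - (norm ?p)\<^sup>2"
      using orth[of x] orth[of y] by (simp add: power2_norm_eq_inner inner_diff_right inner_commute)
  next
    show "closest_point C 0 = 0" by (rule closest_point_self[OF z])
  qed
qed

section \<open>From chi-squared mixtures to the intrinsic volume variable\<close>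

lemma weighted_char_has_vector_derivative':
  fixes X Y :: "'a \<Rightarrow> real"
  assumes "X \<in> borel_measurable M" "Y \<in> borel_measurable M"
    and "integrable M Y" "integrable M (\<lambda>x. Y x * X x)" "integrable M (\<lambda>x. Y x * (X x)\<^sup>2)"
  shows "((\<lambda>t. \<integral>x. of_real (Y x) * iexp (t * X x) \<partial>M) has_vector_derivative
    \<i> * (\<integral>x. of_real (Y x * X x) * iexp (t * X x) \<partial>M)) (at t)"
  using weighted_char_has_vector_derivative[OF assms, of t] by (simp add: mult.left_commute[of _ \<i>])

lemma has_vector_derivative_power_nat:
  fixes f :: "real \<Rightarrow> complex"
  assumes "(f has_vector_derivative f') (at t)"
  shows "((\<lambda>t. f t ^ n) has_vector_derivative of_nat n * f t ^ (n - 1) * f') (at t)"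
proof (induction n)
  case (Suc n)
  have "f t * (of_nat n * f t ^ (n - 1) * f') + f' * f t ^ n = of_nat (Suc n) * f t ^ n * f'"
    by (cases n) (auto simp: algebra_simps)
  with has_vector_derivative_mult[OF assms Suc.IH] show ?case by simp
qed auto

interpretation std_normal: real_distribution std_normal_distribution
  by (rule real_dist_normal_dist)

definition sq_char :: "real \<Rightarrow> complex" where
  "sq_char t = (\<integral>x. iexp (t * x\<^sup>2) \<partial>std_normal_distribution)"

lemma std_normal_square_moments:
  "integrable std_normal_distribution (\<lambda>x. x ^ k)"
  "(\<integral>x. x\<^sup>2 \<partial>std_normal_distribution) = 1" "(\<integral>x. x ^ 4 \<partial>std_normal_distribution) = 3"
  "(\<integral>x. x ^ 6 \<partial>std_normal_distribution) = 15"
  using std_normal_distribution_even_moments(1)[of 1] std_normal_distribution_even_moments(1)[of 2]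
    std_normal_distribution_even_moments(1)[of 3]
  by (simp_all add: integrable_std_normal_distribution_moment fact_numeral)

lemma sq_char_deriv:
  "(sq_char has_vector_derivative \<i> * (\<integral>x. of_real (x\<^sup>2) * iexp (t * x\<^sup>2) \<partial>std_normal_distribution)) (at t)"
proof -
  have "((\<lambda>t. \<integral>x. of_real 1 * iexp (t * x\<^sup>2) \<partial>std_normal_distribution) has_vector_derivative
      \<i> * (\<integral>x. of_real (1 * x\<^sup>2) * iexp (t * x\<^sup>2) \<partial>std_normal_distribution)) (at t)"
    by (rule weighted_char_has_vector_derivative') (simp_all add: std_normal_square_moments flip: power_mult)
  then show ?thesis by (simp add: sq_char_def[abs_def])
qed

lemma sq_char_deriv2:
  "((\<lambda>t. \<integral>x. of_real (x\<^sup>2) * iexp (t * x\<^sup>2) \<partial>std_normal_distribution) has_vector_derivative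
    \<i> * (\<integral>x. of_real (x ^ 4) * iexp (t * x\<^sup>2) \<partial>std_normal_distribution)) (at t)"
proof -
  have "((\<lambda>t. \<integral>x. of_real (x\<^sup>2) * iexp (t * x\<^sup>2) \<partial>std_normal_distribution) has_vector_derivative
      \<i> * (\<integral>x. of_real (x\<^sup>2 * x\<^sup>2) * iexp (t * x\<^sup>2) \<partial>std_normal_distribution)) (at t)"
    by (rule weighted_char_has_vector_derivative') (simp_all add: std_normal_square_moments flip: power_mult power_add)
  then show ?thesis by (simp only: power_add[symmetric]) simp
qed

lemma sq_char_0 [simp]: "sq_char 0 = 1"
  by (simp add: sq_char_def std_normal.prob_space[simplified])

lemma norm_sq_char_le: "norm (sq_char t) \<le> 1"
proof -
  have "norm (sq_char t) \<le> (\<integral>x. norm (iexp (t * x\<^sup>2)) \<partial>std_normal_distribution)"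
    unfolding sq_char_def by (rule integral_norm_bound)
  then show ?thesis by (simp add: std_normal.prob_space[simplified] del: of_real_mult of_real_power)
qed

text \<open>
  The third-order Taylor bound for the exponential, integrated for \<open>Z\<^sup>2 - 1\<close>, which has mean \<open>0\<close>,
  variance \<open>2\<close> and third absolute moment at most \<open>E (Z\<^sup>2 + 1)\<^sup>3 = 28\<close>.
\<close>

lemma sq_char_expansion:
  assumes "0 \<le> t"
  shows "norm (iexp (- t) * sq_char t - of_real (1 - t\<^sup>2)) \<le> 5 * t ^ 3"
proof -
  let ?N = std_normal_distribution
  let ?X = "\<lambda>x :: real. x\<^sup>2 - 1"
  let ?T = "\<lambda>x. \<Sum>k\<le>2. (\<i> * of_real (t * ?X x)) ^ k / fact k"
  have T: "?T x = of_real (1 - t\<^sup>2 * (x ^ 4 - 2 * x\<^sup>2 + 1) / 2) + \<i> * of_real (t * (x\<^sup>2 - 1))" for x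
    by (simp add: numeral_eq_Suc complex_eq_iff field_simps)
  have i: "integrable ?N (\<lambda>x. x ^ 4)" "integrable ?N (\<lambda>x. x\<^sup>2)" "integrable ?N (\<lambda>x. x ^ 6)"
    by (simp_all add: std_normal_square_moments)
  have iT: "integrable ?N ?T"
    unfolding T using i by (intro Bochner_Integration.integrable_add integrable_of_real integrable_mult_right
      Bochner_Integration.integrable_diff) auto
  have ET: "(\<integral>x. ?T x \<partial>?N) = of_real (1 - t\<^sup>2)"
  proof -
    have "(\<integral>x. 1 - t\<^sup>2 * (x ^ 4 - 2 * x\<^sup>2 + 1) / 2 \<partial>?N) = 1 - t\<^sup>2"
      using i by (simp add: std_normal_square_moments std_normal.prob_space[simplified])
    moreover have "(\<integral>x. t * (x\<^sup>2 - 1) \<partial>?N) = 0"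
      using i by (simp add: std_normal_square_moments std_normal.prob_space[simplified])
    moreover have "(\<integral>x. ?T x \<partial>?N) = of_real (\<integral>x. 1 - t\<^sup>2 * (x ^ 4 - 2 * x\<^sup>2 + 1) / 2 \<partial>?N) +
        \<i> * of_real (\<integral>x. t * (x\<^sup>2 - 1) \<partial>?N)"
      unfolding T using i
      by (subst Bochner_Integration.integral_add)
        (auto intro!: integrable_of_real integrable_mult_right Bochner_Integration.integrable_diff simp del: of_real_mult of_real_diff of_real_add)
    ultimately show ?thesis by simp
  qed
  have ie: "integrable ?N (\<lambda>x. iexp (t * ?X x))"
    by (rule std_normal.integrable_const_bound[of _ 1]) (auto simp del: of_real_mult of_real_diff)
  have "iexp (- t) * sq_char t = (\<integral>x. iexp (t * ?X x) \<partial>?N)"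
    unfolding sq_char_def by (subst integral_mult_right_zero[symmetric])
      (auto intro!: Bochner_Integration.integral_cong simp: algebra_simps simp flip: exp_add)
  then have eq: "iexp (- t) * sq_char t - of_real (1 - t\<^sup>2) = (\<integral>x. iexp (t * ?X x) - ?T x \<partial>?N)"
    using ie iT ET by simp
  have "norm (iexp (- t) * sq_char t - of_real (1 - t\<^sup>2)) \<le> (\<integral>x. norm (iexp (t * ?X x) - ?T x) \<partial>?N)"
    unfolding eq by (rule integral_norm_bound)
  also have "\<dots> \<le> (\<integral>x. t ^ 3 / 6 * (x ^ 6 + 3 * x ^ 4 + 3 * x\<^sup>2 + 1) \<partial>?N)"
  proof (rule integral_mono)
    show "integrable ?N (\<lambda>x. norm (iexp (t * ?X x) - ?T x))"
      by (intro integrable_norm Bochner_Integration.integrable_diff ie iT)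
    show "integrable ?N (\<lambda>x. t ^ 3 / 6 * (x ^ 6 + 3 * x ^ 4 + 3 * x\<^sup>2 + 1))"
      using i by (intro integrable_mult_right Bochner_Integration.integrable_add) auto
    fix x :: real
    have "norm (iexp (t * ?X x) - ?T x) \<le> \<bar>t * ?X x\<bar> ^ 3 / 6"
      using iexp_approx1[of "t * ?X x" 2] by (simp add: fact_numeral eval_nat_numeral)
    also have "\<dots> \<le> (t * (x\<^sup>2 + 1)) ^ 3 / 6"
      using assms by (intro divide_right_mono power_mono) (auto simp: abs_mult intro!: mult_left_mono abs_leI)
    also have "\<dots> = t ^ 3 / 6 * (x ^ 6 + 3 * x ^ 4 + 3 * x\<^sup>2 + 1)"
      by (simp add: algebra_simps numeral_eq_Suc)
    finally show "norm (iexp (t * ?X x) - ?T x) \<le> t ^ 3 / 6 * (x ^ 6 + 3 * x ^ 4 + 3 * x\<^sup>2 + 1)" .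
  qed
  also have "\<dots> = t ^ 3 / 6 * 28"
    using i by (simp add: std_normal_square_moments std_normal.prob_space[simplified])
  also have "\<dots> \<le> 5 * t ^ 3" using assms by simp
  finally show ?thesis .
qed

lemma exp_minus_expansion: "0 \<le> t \<Longrightarrow> \<bar>exp (- t\<^sup>2) - (1 - t\<^sup>2)\<bar> \<le> t ^ 3" for t :: real
proof -
  assume t: "0 \<le> t"
  have 1: "1 - t\<^sup>2 \<le> exp (- t\<^sup>2)" using exp_ge_add_one_self[of "- t\<^sup>2"] by simp
  have "exp (- t\<^sup>2) \<le> inverse (1 + t\<^sup>2)"
    unfolding exp_minus by (intro le_imp_inverse_le exp_ge_add_one_self) (simp add: add_pos_nonneg)
  then have "exp (- t\<^sup>2) * (1 + t\<^sup>2) \<le> 1"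
    by (simp add: inverse_eq_divide pos_le_divide_eq add_pos_nonneg)
  then have "(exp (- t\<^sup>2) - (1 - t\<^sup>2)) * (1 + t\<^sup>2) \<le> t ^ 4"
    by (simp add: algebra_simps eval_nat_numeral)
  then have 2: "exp (- t\<^sup>2) - (1 - t\<^sup>2) \<le> t ^ 4 / (1 + t\<^sup>2)"
    by (simp add: pos_le_divide_eq add_pos_nonneg)
  have "t ^ 4 / (1 + t\<^sup>2) \<le> t ^ 3"
  proof (subst pos_divide_le_eq)
    have "0 \<le> t ^ 3 * (1 + t\<^sup>2 - t)"
      using t zero_le_power2[of "t - 1 / 2"] by (intro mult_nonneg_nonneg) (auto simp: power2_eq_square algebra_simps)
    then show "t ^ 4 \<le> t ^ 3 * (1 + t\<^sup>2)" by (simp add: algebra_simps eval_nat_numeral)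
  qed (simp add: add_pos_nonneg)
  with 1 2 show ?thesis by linarith
qed

lemma sq_char_gauss:
  assumes "0 \<le> t"
  shows "norm (iexp (- t) * sq_char t - of_real (exp (- t\<^sup>2))) \<le> 6 * t ^ 3"
proof -
  have "norm (complex_of_real (1 - t\<^sup>2) - of_real (exp (- t\<^sup>2))) \<le> t ^ 3"
    using exp_minus_expansion[OF assms] by (simp only: norm_of_real flip: of_real_diff)
  with sq_char_expansion[OF assms] show ?thesis
    using norm_triangle_ineq[of "iexp (- t) * sq_char t - of_real (1 - t\<^sup>2)" "of_real (1 - t\<^sup>2) - of_real (exp (- t\<^sup>2))"]
    by simp
qed

lemma prob_space_chi_squared: "prob_space (chi_squared k)"
  unfolding chi_squared_def
  by (intro prob_space.prob_space_distr prob_space_PiM std_normal.prob_space_axioms) simp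

lemma sets_chi_squared [simp, measurable_cong]: "sets (chi_squared k) = sets borel"
  by (simp add: chi_squared_def)

lemma char_chi_squared: "(\<integral>y. iexp (t * y) \<partial>chi_squared k) = sq_char t ^ k"
proof -
  interpret product_sigma_finite "\<lambda>_ :: nat. std_normal_distribution" ..
  have "(\<integral>y. iexp (t * y) \<partial>chi_squared k) =
      (\<integral>x. (\<Prod>i<k. iexp (t * (x i)\<^sup>2)) \<partial>Pi\<^sub>M {..<k} (\<lambda>_. std_normal_distribution))"
    unfolding chi_squared_def
    by (subst integral_distr) (simp_all add: sum_distrib_left exp_sum)
  also have "\<dots> = (\<Prod>i<k. \<integral>x. iexp (t * x\<^sup>2) \<partial>std_normal_distribution)"
    by (rule product_integral_prod[of "{..<k}" "\<lambda>_ x. iexp (t * x\<^sup>2)"])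
      (auto intro!: std_normal.integrable_const_bound[of _ 1] simp del: of_real_mult of_real_power)
  finally show ?thesis by (simp add: sq_char_def)
qed

text \<open>
  The defining property of the intrinsic volumes, tested with \<open>cos(ta)\<close> and \<open>sin(ta)\<close> for the first
  coordinate \<open>a\<close>.
\<close>

lemma intrinsic_volumes_char:
  fixes C :: "(real ^ 'n) set"
  assumes C: "cone_projection (closest_point C)" and v: "conic_intrinsic_volumes C v"
  shows "(\<integral>g. iexp (t * (norm (closest_point C g))\<^sup>2) \<partial>\<gamma>) = (\<Sum>j\<le>CARD('n). of_real (v j) * sq_char t ^ j)"
proof -
  interpret cone_projection "closest_point C" by (rule C)
  have [measurable]: "closest_point C \<in> borel_measurable borel"
    by (rule linear_growth_measurable[OF linear_growth_P])
  have fst: "(\<integral>y. h (fst y) \<partial>(chi_squared j \<Otimes>\<^sub>M chi_squared k)) = (\<integral>y. h y \<partial>chi_squared j)"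
    if [measurable]: "h \<in> borel_measurable borel" for h :: "real \<Rightarrow> real" and j k
  proof -
    interpret k: prob_space "chi_squared k" by (rule prob_space_chi_squared)
    have "(\<integral>y. h y \<partial>chi_squared j) = (\<integral>y. h y \<partial>distr (chi_squared j \<Otimes>\<^sub>M chi_squared k) (chi_squared j) fst)"
      by (simp add: k.distr_pair_fst)
    also have "\<dots> = (\<integral>y. h (fst y) \<partial>(chi_squared j \<Otimes>\<^sub>M chi_squared k))"
      by (rule integral_distr) simp_all
    finally show ?thesis by simp
  qed
  have test: "(\<integral>g. h (t * (norm (closest_point C g))\<^sup>2) \<partial>\<gamma>) =
      (\<Sum>j\<le>CARD('n). v j * (\<integral>y. h (t * y) \<partial>chi_squared j))"
    if [measurable]: "h \<in> borel_measurable borel" and b: "\<And>x. \<bar>h x\<bar> \<le> 1" for h :: "real \<Rightarrow> real"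
  proof -
    let ?f = "\<lambda>y :: real \<times> real. h (t * fst y)"
    have "?f \<in> borel_measurable borel \<and> bounded (range ?f)"
      using b by (auto simp: bounded_iff simp flip: borel_prod)
    then have "(\<integral>g. ?f ((norm (closest_point C g))\<^sup>2, (norm (closest_point (polar_cone C) g))\<^sup>2) \<partial>\<gamma>) =
        (\<Sum>j\<le>CARD('n). v j * (\<integral>y. ?f y \<partial>(chi_squared j \<Otimes>\<^sub>M chi_squared (CARD('n) - j))))"
      using v unfolding conic_intrinsic_volumes_def by blast
    then show ?thesis by (simp add: fst[of "\<lambda>x. h (t * x)"])
  qed
  have "(\<integral>g. iexp (t * (norm (closest_point C g))\<^sup>2) \<partial>\<gamma>) =
      of_real (\<Sum>j\<le>CARD('n). v j * (\<integral>y. cos (t * y) \<partial>chi_squared j)) +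
      \<i> * of_real (\<Sum>j\<le>CARD('n). v j * (\<integral>y. sin (t * y) \<partial>chi_squared j))"
    by (subst iexp_integral) (auto intro: prob_space_std_gaussian simp: test[of cos] test[of sin])
  also have "\<dots> = (\<Sum>j\<le>CARD('n). of_real (v j) * (\<integral>y. iexp (t * y) \<partial>chi_squared j))"
    by (subst iexp_integral[OF prob_space_chi_squared])
      (auto simp: sum.distrib sum_distrib_left algebra_simps)
  finally show ?thesis unfolding char_chi_squared .
qed

context cone_projection
begin

text \<open>
  Both sides of the hypothesis are differentiated twice at \<open>0\<close>.  Working with characteristic functions
  reduces everything to bounded test functions of \<open>G\<close>.
\<close>

lemma intrinsic_volumes_moments:
  fixes v :: "nat \<Rightarrow> real" and d :: nat
  assumes char: "\<And>t. (\<integral>x. iexp (t * G x) \<partial>\<gamma>) = (\<Sum>j\<le>d. of_real (v j) * sq_char t ^ j)"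
  shows "\<delta> = (\<Sum>j\<le>d. v j * real j)"
    and "(\<integral>x. (G x)\<^sup>2 \<partial>\<gamma>) = (\<Sum>j\<le>d. v j * ((real j)\<^sup>2 + 2 * real j))"
proof -
  have [measurable]: "G \<in> borel_measurable borel" by (rule exp_type_measurable[OF exp_type_G])
  let ?c1 = "\<lambda>t. \<integral>x. of_real (x\<^sup>2) * iexp (t * x\<^sup>2) \<partial>std_normal_distribution"
  let ?c2 = "\<lambda>t. \<integral>x. of_real (x ^ 4) * iexp (t * x\<^sup>2) \<partial>std_normal_distribution"
  let ?g1 = "\<lambda>t. \<integral>x. of_real (G x) * iexp (t * G x) \<partial>\<gamma>"
  let ?g2 = "\<lambda>t. \<integral>x. of_real ((G x)\<^sup>2) * iexp (t * G x) \<partial>\<gamma>"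
  let ?s1 = "\<lambda>t. \<Sum>j\<le>d. of_real (v j) * (of_nat j * sq_char t ^ (j - 1) * ?c1 t)"
  have c0: "?c1 0 = 1" "?c2 0 = 3"
    by (simp_all add: std_normal_square_moments del: of_real_power)
  have g0: "?g1 0 = of_real \<delta>" "?g2 0 = of_real (\<integral>x. (G x)\<^sup>2 \<partial>\<gamma>)"
    by (simp_all add: \<delta>_def del: of_real_power)
  have g: "?g1 t = ?s1 t" for t
  proof -
    have "((\<lambda>t. \<integral>x. of_real 1 * iexp (t * G x) \<partial>\<gamma>) has_vector_derivative
        \<i> * (\<integral>x. of_real (1 * G x) * iexp (t * G x) \<partial>\<gamma>)) (at t)"
      by (rule weighted_char_has_vector_derivative'; (intro integrable_gauss_exp_type growth)?) auto
    then have "((\<lambda>t. \<Sum>j\<le>d. of_real (v j) * sq_char t ^ j) has_vector_derivative \<i> * ?g1 t) (at t)"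
      by (simp only: char of_real_1 mult_1)
    moreover have "((\<lambda>t. \<Sum>j\<le>d. of_real (v j) * sq_char t ^ j) has_vector_derivative
        (\<Sum>j\<le>d. of_real (v j) * (of_nat j * sq_char t ^ (j - 1) * (\<i> * ?c1 t)))) (at t)"
      by (intro has_vector_derivative_sum has_vector_derivative_mult_right has_vector_derivative_power_nat sq_char_deriv)
    ultimately have "\<i> * ?g1 t = (\<Sum>j\<le>d. of_real (v j) * (of_nat j * sq_char t ^ (j - 1) * (\<i> * ?c1 t)))"
      by (rule vector_derivative_unique_at)
    also have "\<dots> = \<i> * ?s1 t"
      by (simp add: sum_distrib_left mult_ac)
    finally show ?thesis by simp
  qed
  from g[of 0] have "complex_of_real \<delta> = of_real (\<Sum>j\<le>d. v j * real j)"
    unfolding g0 c0 by simp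
  then show "\<delta> = (\<Sum>j\<le>d. v j * real j)" by (simp only: of_real_eq_iff)
  have "(?g1 has_vector_derivative \<i> * (\<integral>x. of_real (G x * G x) * iexp (0 * G x) \<partial>\<gamma>)) (at 0)"
    by (rule weighted_char_has_vector_derivative'; (intro integrable_gauss_exp_type growth)?) auto
  moreover have "(?s1 has_vector_derivative
      (\<Sum>j\<le>d. of_real (v j) * (of_nat j * sq_char 0 ^ (j - 1) * (\<i> * ?c2 0) +
        of_nat j * (of_nat (j - 1) * sq_char 0 ^ (j - 1 - 1) * (\<i> * ?c1 0)) * ?c1 0))) (at 0)"
    by (intro has_vector_derivative_sum has_vector_derivative_mult_right has_vector_derivative_mult
      has_vector_derivative_power_nat sq_char_deriv sq_char_deriv2)
  ultimately have "\<i> * (\<integral>x. of_real (G x * G x) * iexp (0 * G x) \<partial>\<gamma>) =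
      (\<Sum>j\<le>d. of_real (v j) * (of_nat j * sq_char 0 ^ (j - 1) * (\<i> * ?c2 0) +
        of_nat j * (of_nat (j - 1) * sq_char 0 ^ (j - 1 - 1) * (\<i> * ?c1 0)) * ?c1 0))"
    unfolding g by (rule vector_derivative_unique_at)
  also have "\<dots> = \<i> * of_real (\<Sum>j\<le>d. v j * ((real j)\<^sup>2 + 2 * real j))"
    unfolding of_real_sum sum_distrib_left
  proof (rule sum.cong)
    fix j
    have J: "of_nat j * of_nat (j - 1) = (of_nat j)\<^sup>2 - (of_nat j :: complex)"
      by (cases j) (auto simp: power2_eq_square algebra_simps)
    have "complex_of_real (v j) * (of_nat j * sq_char 0 ^ (j - 1) * (\<i> * ?c2 0) +
        of_nat j * (of_nat (j - 1) * sq_char 0 ^ (j - 1 - 1) * (\<i> * ?c1 0)) * ?c1 0) =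
        complex_of_real (v j) * (3 * \<i> * of_nat j + \<i> * (of_nat j * of_nat (j - 1)))"
      unfolding c0 by (simp add: mult_ac)
    then show "complex_of_real (v j) * (of_nat j * sq_char 0 ^ (j - 1) * (\<i> * ?c2 0) +
        of_nat j * (of_nat (j - 1) * sq_char 0 ^ (j - 1 - 1) * (\<i> * ?c1 0)) * ?c1 0) =
        \<i> * complex_of_real (v j * ((real j)\<^sup>2 + 2 * real j))"
      unfolding J by (simp add: algebra_simps)
  qed simp
  finally have "complex_of_real (\<integral>x. (G x)\<^sup>2 \<partial>\<gamma>) = of_real (\<Sum>j\<le>d. v j * ((real j)\<^sup>2 + 2 * real j))"
    by (simp add: power2_eq_square flip: of_real_mult)
  then show "(\<integral>x. (G x)\<^sup>2 \<partial>\<gamma>) = (\<Sum>j\<le>d. v j * ((real j)\<^sup>2 + 2 * real j))"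
    by (simp only: of_real_eq_iff)
qed

text \<open>
  The deconvolution step.  Replacing \<open>r\<^sup>j\<close>, with \<open>r\<close> the characteristic function of \<open>Z\<^sup>2 - 1\<close>, first by
  \<open>exp(- t\<^sup>2 j)\<close> and then by \<open>exp(- t\<^sup>2 \<delta>)\<close> costs \<open>6 t\<^sup>3 j + t\<^sup>2 |j - \<delta>|\<close>; averaging over \<open>j\<close> gives
  \<open>6 t\<^sup>3 \<delta> + t\<^sup>2 \<tau>\<close>, and \<open>\<phi>_gauss\<close> contributes at most \<open>80 t\<^sup>3 \<delta>\<close>.
\<close>

lemma intrinsic_volumes_char_normal:
  fixes v :: "nat \<Rightarrow> real" and d :: nat and \<tau> :: real
  assumes v: "\<And>j. j \<le> d \<Longrightarrow> 0 \<le> v j" "(\<Sum>j\<le>d. v j) = 1"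
    and char: "\<And>t. (\<integral>x. iexp (t * G x) \<partial>\<gamma>) = (\<Sum>j\<le>d. of_real (v j) * sq_char t ^ j)"
    and \<tau>: "0 < \<tau>" "\<tau>\<^sup>2 = (\<Sum>j\<le>d. v j * (real j - \<delta>)\<^sup>2)"
  shows "\<tau>\<^sup>2 \<le> 5 * \<delta>"
    and "0 \<le> t \<Longrightarrow> norm ((\<Sum>j\<le>d. of_real (v j) * iexp (t * (real j - \<delta>))) - of_real (exp (- \<tau>\<^sup>2 * t\<^sup>2 / 2)))
      \<le> exp (t\<^sup>2 * \<delta>) * (86 * t ^ 3 * \<delta> + t\<^sup>2 * \<tau>)"
proof -
  note m = intrinsic_volumes_moments[OF char]
  have "\<tau>\<^sup>2 = (\<Sum>j\<le>d. v j * ((real j)\<^sup>2 + 2 * real j)) - (2 + 2 * \<delta>) * (\<Sum>j\<le>d. v j * real j) + \<delta>\<^sup>2 * (\<Sum>j\<le>d. v j)"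
    unfolding \<tau>(2) sum_distrib_left sum_subtractf[symmetric] sum.distrib[symmetric]
    by (rule sum.cong) (auto simp: power2_eq_square algebra_simps)
  then have \<sigma>: "\<sigma>2 = \<tau>\<^sup>2 + 2 * \<delta>"
    unfolding m(1)[symmetric] m(2)[symmetric] v(2) \<sigma>2_def by (simp add: power2_eq_square algebra_simps)
  have "2 * pi * \<delta> \<le> 7 * \<delta>"
    using pi_less_4 pi_approx by (intro mult_right_mono \<delta>_nonneg) simp
  with variance_G_le \<sigma> show "\<tau>\<^sup>2 \<le> 5 * \<delta>" by linarith
  assume t: "0 \<le> t"
  let ?r = "iexp (- t) * sq_char t"
  let ?V = "\<Sum>j\<le>d. of_real (v j) * iexp (t * (real j - \<delta>))"
  have nr: "norm ?r \<le> 1" using norm_sq_char_le[of t] by (simp add: norm_mult)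
  have \<phi>: "\<phi> t = (\<Sum>j\<le>d. of_real (v j) * iexp (t * (real j - \<delta>)) * ?r ^ j)"
  proof -
    have "\<phi> t = iexp (- t * \<delta>) * (\<integral>x. iexp (t * G x) \<partial>\<gamma>)"
      unfolding \<phi>_def by (subst integral_mult_right_zero[symmetric])
        (auto intro!: Bochner_Integration.integral_cong simp: algebra_simps simp flip: exp_add)
    also have "\<dots> = (\<Sum>j\<le>d. of_real (v j) * (iexp (- t * \<delta>) * sq_char t ^ j))"
      unfolding char sum_distrib_left by (intro sum.cong) auto
    also have "\<dots> = (\<Sum>j\<le>d. of_real (v j) * iexp (t * (real j - \<delta>)) * ?r ^ j)"
    proof (rule sum.cong)
      fix j
      have "iexp (t * (real j - \<delta>)) * iexp (- t) ^ j = iexp (- t * \<delta>)"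
        by (simp add: algebra_simps flip: exp_of_nat_mult exp_add)
      then show "complex_of_real (v j) * (iexp (- t * \<delta>) * sq_char t ^ j) =
          of_real (v j) * iexp (t * (real j - \<delta>)) * ?r ^ j"
        by (simp only: power_mult_distrib mult.assoc[symmetric]) (simp only: mult.assoc)
    qed simp
    finally show ?thesis .
  qed
  have absdev: "(\<Sum>j\<le>d. v j * \<bar>real j - \<delta>\<bar>) \<le> \<tau>"
  proof -
    have "(\<Sum>j\<le>d. v j * \<bar>real j - \<delta>\<bar>) \<le> (\<Sum>j\<le>d. v j * ((real j - \<delta>)\<^sup>2 / (2 * \<tau>) + \<tau> / 2))"
    proof (intro sum_mono mult_left_mono v(1))
      fix j
      have "2 * \<tau> * \<bar>real j - \<delta>\<bar> \<le> (real j - \<delta>)\<^sup>2 + \<tau>\<^sup>2"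
        using sum_squares_bound[of "\<bar>real j - \<delta>\<bar>" \<tau>] by (simp add: mult_ac)
      then show "\<bar>real j - \<delta>\<bar> \<le> (real j - \<delta>)\<^sup>2 / (2 * \<tau>) + \<tau> / 2"
        using \<tau>(1) by (simp add: field_simps power2_eq_square)
    qed simp
    also have "\<dots> = \<tau>\<^sup>2 / (2 * \<tau>) + \<tau> / 2"
    proof -
      have "(\<Sum>j\<le>d. v j * (\<tau> / 2)) = \<tau> / 2"
        using v(2) by (simp only: sum_distrib_right[symmetric])
      moreover have "(\<Sum>j\<le>d. v j * ((real j - \<delta>)\<^sup>2 / (2 * \<tau>))) = \<tau>\<^sup>2 / (2 * \<tau>)"
        unfolding \<tau>(2) sum_divide_distrib by simp
      ultimately show ?thesis by (simp only: distrib_left sum.distrib)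
    qed
    also have "\<dots> = \<tau>" using \<tau>(1) by (simp add: power2_eq_square)
    finally show ?thesis .
  qed
  have each: "norm (?r ^ j - of_real (exp (- t\<^sup>2 * \<delta>))) \<le> 6 * t ^ 3 * real j + t\<^sup>2 * \<bar>real j - \<delta>\<bar>" for j
  proof -
    have "norm (?r ^ j - of_real (exp (- t\<^sup>2)) ^ j) \<le> real j * norm (?r - of_real (exp (- t\<^sup>2)))"
      by (rule norm_power_diff[OF nr]) simp
    also have "\<dots> \<le> real j * (6 * t ^ 3)"
      by (intro mult_left_mono sq_char_gauss t) simp
    finally have 1: "norm (?r ^ j - of_real (exp (- t\<^sup>2)) ^ j) \<le> 6 * t ^ 3 * real j" by (simp only: mult_ac)
    have "norm (of_real (exp (- t\<^sup>2)) ^ j - complex_of_real (exp (- t\<^sup>2 * \<delta>))) = \<bar>exp (- (t\<^sup>2 * real j)) - exp (- (t\<^sup>2 * \<delta>))\<bar>"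
      by (simp add: norm_of_real mult.commute flip: of_real_power of_real_diff exp_of_nat_mult)
    also have "\<dots> \<le> 1 * \<bar>t\<^sup>2 * real j - t\<^sup>2 * \<delta>\<bar>"
    proof -
      have "norm (exp (- (t\<^sup>2 * real j)) - exp (- (t\<^sup>2 * \<delta>))) \<le> 1 * norm (t\<^sup>2 * real j - t\<^sup>2 * \<delta>)"
        by (rule field_differentiable_bound[of "{0..}" "\<lambda>u. exp (- u)" "\<lambda>u. - exp (- u)"])
          (auto intro!: derivative_eq_intros simp: \<delta>_nonneg)
      then show ?thesis by simp
    qed
    also have "\<dots> = t\<^sup>2 * \<bar>real j - \<delta>\<bar>"
      by (simp add: abs_mult flip: right_diff_distrib)
    finally have 2: "norm (of_real (exp (- t\<^sup>2)) ^ j - complex_of_real (exp (- t\<^sup>2 * \<delta>))) \<le> t\<^sup>2 * \<bar>real j - \<delta>\<bar>" .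
    show ?thesis
      using norm_triangle_ineq[of "?r ^ j - of_real (exp (- t\<^sup>2)) ^ j" "of_real (exp (- t\<^sup>2)) ^ j - complex_of_real (exp (- t\<^sup>2 * \<delta>))"] 1 2
      by simp
  qed
  have "\<phi> t - of_real (exp (- t\<^sup>2 * \<delta>)) * ?V =
      (\<Sum>j\<le>d. of_real (v j) * iexp (t * (real j - \<delta>)) * (?r ^ j - of_real (exp (- t\<^sup>2 * \<delta>))))"
    unfolding \<phi> sum_distrib_left sum_subtractf[symmetric] by (rule sum.cong) (auto simp: algebra_simps)
  then have "norm (\<phi> t - of_real (exp (- t\<^sup>2 * \<delta>)) * ?V) \<le>
      (\<Sum>j\<le>d. norm (of_real (v j) * iexp (t * (real j - \<delta>)) * (?r ^ j - of_real (exp (- t\<^sup>2 * \<delta>)))))"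
    by (simp only: norm_sum)
  also have "\<dots> \<le> (\<Sum>j\<le>d. v j * (6 * t ^ 3 * real j + t\<^sup>2 * \<bar>real j - \<delta>\<bar>))"
  proof (rule sum_mono)
    fix j assume "j \<in> {..d}"
    then have "0 \<le> v j" using v(1) by simp
    then show "norm (of_real (v j) * iexp (t * (real j - \<delta>)) * (?r ^ j - of_real (exp (- t\<^sup>2 * \<delta>)))) \<le>
        v j * (6 * t ^ 3 * real j + t\<^sup>2 * \<bar>real j - \<delta>\<bar>)"
      using mult_left_mono[OF each[of j]] by (simp only: norm_mult norm_exp_i_times norm_of_real) simp
  qed
  also have "\<dots> = 6 * t ^ 3 * (\<Sum>j\<le>d. v j * real j) + t\<^sup>2 * (\<Sum>j\<le>d. v j * \<bar>real j - \<delta>\<bar>)"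
    by (simp add: sum_distrib_left sum.distrib algebra_simps)
  also have "\<dots> \<le> 6 * t ^ 3 * \<delta> + t\<^sup>2 * \<tau>"
    unfolding m(1)[symmetric] using t by (intro add_mono mult_left_mono absdev) auto
  finally have 1: "norm (of_real (exp (- t\<^sup>2 * \<delta>)) * ?V - \<phi> t) \<le> 6 * t ^ 3 * \<delta> + t\<^sup>2 * \<tau>"
    by (simp only: norm_minus_commute)
  have "pi\<^sup>2 \<le> 10"
    using pi_approx power_mono[of pi "3.15" 2] by (simp add: power2_eq_square)
  then have "8 * pi\<^sup>2 * (t ^ 3 * \<delta>) \<le> 80 * (t ^ 3 * \<delta>)"
    using t \<delta>_nonneg by (intro mult_right_mono) auto
  then have 2: "norm (\<phi> t - of_real (exp (- \<sigma>2 * t\<^sup>2 / 2))) \<le> 80 * t ^ 3 * \<delta>"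
    using \<phi>_gauss[OF t] by (simp only: mult.assoc)
  have "norm (of_real (exp (- t\<^sup>2 * \<delta>)) * ?V - of_real (exp (- \<sigma>2 * t\<^sup>2 / 2))) \<le> 86 * t ^ 3 * \<delta> + t\<^sup>2 * \<tau>"
    using norm_triangle_ineq[of "of_real (exp (- t\<^sup>2 * \<delta>)) * ?V - \<phi> t" "\<phi> t - of_real (exp (- \<sigma>2 * t\<^sup>2 / 2))"] 1 2
    by simp
  then have 3: "exp (t\<^sup>2 * \<delta>) * norm (of_real (exp (- t\<^sup>2 * \<delta>)) * ?V - of_real (exp (- \<sigma>2 * t\<^sup>2 / 2))) \<le>
      exp (t\<^sup>2 * \<delta>) * (86 * t ^ 3 * \<delta> + t\<^sup>2 * \<tau>)"
    by (intro mult_left_mono) auto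
  have e1: "exp (t\<^sup>2 * \<delta>) * exp (- t\<^sup>2 * \<delta>) = 1" by (simp flip: exp_add)
  have e2: "exp (t\<^sup>2 * \<delta>) * exp (- \<sigma>2 * t\<^sup>2 / 2) = exp (- \<tau>\<^sup>2 * t\<^sup>2 / 2)"
    unfolding exp_add[symmetric] \<sigma> by (simp add: field_simps)
  have "?V - of_real (exp (- \<tau>\<^sup>2 * t\<^sup>2 / 2)) =
      of_real (exp (t\<^sup>2 * \<delta>)) * (of_real (exp (- t\<^sup>2 * \<delta>)) * ?V - of_real (exp (- \<sigma>2 * t\<^sup>2 / 2)))"
    unfolding right_diff_distrib mult.assoc[symmetric] of_real_mult[symmetric] e1 e2 by simp
  then have "norm (?V - of_real (exp (- \<tau>\<^sup>2 * t\<^sup>2 / 2))) =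
      exp (t\<^sup>2 * \<delta>) * norm (of_real (exp (- t\<^sup>2 * \<delta>)) * ?V - of_real (exp (- \<sigma>2 * t\<^sup>2 / 2)))"
    by (simp only: norm_mult norm_of_real abs_exp_cancel)
  with 3 show "norm (?V - of_real (exp (- \<tau>\<^sup>2 * t\<^sup>2 / 2))) \<le> exp (t\<^sup>2 * \<delta>) * (86 * t ^ 3 * \<delta> + t\<^sup>2 * \<tau>)"
    by simp
qed

end

section \<open>A smoothing inequality\<close>

text \<open>
  For \<open>a = 1\<close> this is \<open>\<pi>\<close> times the Fejer density.  The frequency \<open>a\<close> is kept free because
  \<open>cos(tx)(1 - cos x)\<close> is a linear combination of \<open>1 - cos(ax)\<close> for \<open>a = t + 1, t - 1, t\<close>, so that the
  characteristic function follows from the total integral \<open>\<pi> |a|\<close>.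
\<close>

definition fejer :: "real \<Rightarrow> real \<Rightarrow> real" where
  "fejer a x = (1 - cos (a * x)) / x\<^sup>2"

lemma fejer_nonneg: "0 \<le> fejer a x"
  by (simp add: fejer_def)

lemma fejer_minus [simp]: "fejer a (- x) = fejer a x" "fejer (- a) x = fejer a x"
  by (simp_all add: fejer_def)

lemma borel_measurable_fejer [measurable]: "fejer a \<in> borel_measurable borel"
  unfolding fejer_def[abs_def] by measurable

lemma fejer_half_line:
  assumes "0 < a"
  shows "set_integrable lborel {0<..} (fejer a)" "(LINT x:{0<..}|lborel. fejer a x) = pi * a / 2"
proof -
  \<comment> \<open>Antiderivative found by one integration by parts.\<close>
  let ?F = "\<lambda>x. a * Si (a * x) - (1 - cos (a * x)) / x"
  have D: "(?F has_real_derivative fejer a x) (at x)" if "0 < x" for x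
  proof -
    have "(Si has_real_derivative sin (a * x) / (a * x)) (at (a * x))"
      using DERIV_Si[of "a * x"] that assms by simp
    then have "((\<lambda>x. Si (a * x)) has_real_derivative sin (a * x) / (a * x) * a) (at x)"
      by (rule DERIV_chain2) (auto intro!: derivative_eq_intros)
    then have "(?F has_real_derivative a * (sin (a * x) / (a * x) * a) -
        (a * sin (a * x) * x - (1 - cos (a * x))) / x\<^sup>2) (at x)"
      using that by (auto intro!: derivative_eq_intros simp: power2_eq_square mult_ac)
    moreover have "a * (sin (a * x) / (a * x) * a) - (a * sin (a * x) * x - (1 - cos (a * x))) / x\<^sup>2 = fejer a x"
      using that assms by (simp add: fejer_def field_simps power2_eq_square)
    ultimately show ?thesis by simp
  qed
  have c: "isCont (fejer a) x" if "0 < x" for x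
    unfolding fejer_def[abs_def] using that by (intro continuous_intros) auto
  have "((\<lambda>x. a * Si (a * x)) \<longlongrightarrow> a * Si (a * 0)) (at_right 0)"
    by (intro tendsto_intros isCont_tendsto_compose[OF isCont_Si])
  moreover have "Si 0 = 0" by (simp add: Si_def zero_ereal_def)
  moreover have "((\<lambda>x. (1 - cos (a * x)) / x) \<longlongrightarrow> 0) (at_right 0)"
  proof -
    have "((\<lambda>x. 1 - cos (a * x)) has_real_derivative 0) (at 0)"
      by (auto intro!: derivative_eq_intros)
    then have "((\<lambda>x. (1 - cos (a * x)) / x) \<longlongrightarrow> 0) (at 0)"
      by (simp add: has_field_derivative_iff)
    then show ?thesis by (rule filterlim_mono) (auto simp: at_le)
  qed
  ultimately have L: "(?F \<longlongrightarrow> 0) (at_right 0)"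
    using tendsto_diff by fastforce
  have "((\<lambda>x. a * Si (a * x)) \<longlongrightarrow> a * (pi / 2)) at_top"
    using assms by (intro tendsto_intros filterlim_compose[OF Si_at_top] filterlim_tendsto_pos_mult_at_top[OF tendsto_const]
      filterlim_ident) auto
  moreover have "((\<lambda>x. (1 - cos (a * x)) / x) \<longlongrightarrow> 0) at_top"
  proof (rule Lim_null_comparison)
    show "\<forall>\<^sub>F x in at_top. norm ((1 - cos (a * x)) / x) \<le> 2 / x"
      using eventually_gt_at_top[of 0]
    proof eventually_elim
      case (elim x)
      have "1 - cos (a * x) \<le> 2" using cos_ge_minus_one[of "a * x"] by linarith
      with elim show ?case by (simp add: divide_right_mono)
    qed
    show "((\<lambda>x. 2 / x) \<longlongrightarrow> (0 :: real)) at_top"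
      by (intro tendsto_divide_0[OF tendsto_const] filterlim_at_top_imp_at_infinity filterlim_ident)
  qed
  ultimately have U: "(?F \<longlongrightarrow> a * (pi / 2)) at_top"
    using tendsto_diff by fastforce
  have p1: "((?F \<circ> real_of_ereal) \<longlongrightarrow> 0) (at_right 0)"
    using L by (simp add: zero_ereal_def ereal_tendsto_simps)
  have p2: "((?F \<circ> real_of_ereal) \<longlongrightarrow> a * (pi / 2)) (at_left \<infinity>)"
    using U by (simp add: ereal_tendsto_simps)
  have D': "(?F has_real_derivative fejer a x) (at x)" and c': "isCont (fejer a) x" if "0 < ereal x" "ereal x < \<infinity>" for x
    using D c that by auto
  have n: "AE x in lborel. 0 < ereal x \<longrightarrow> ereal x < \<infinity> \<longrightarrow> 0 \<le> fejer a x"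
    by (simp add: fejer_nonneg)
  have z: "(0 :: ereal) < \<infinity>" by simp
  have FTC: "set_integrable lborel (einterval 0 \<infinity>) (fejer a)"
    by (rule interval_integral_FTC_nonneg(1)[OF z _ _ n p1 p2]) (erule (1) D' c')+
  have FTC2: "(LBINT x=0..\<infinity>. fejer a x) = a * (pi / 2) - 0"
    by (rule interval_integral_FTC_nonneg(2)[OF z _ _ n p1 p2]) (erule (1) D' c')+
  have "einterval 0 \<infinity> = {0<..}" by (auto simp: einterval_def zero_ereal_def)
  with FTC FTC2 show "set_integrable lborel {0<..} (fejer a)" "(LINT x:{0<..}|lborel. fejer a x) = pi * a / 2"
    by (auto simp: interval_lebesgue_integral_def)
qed

lemma integral_even_half_line:
  fixes f :: "real \<Rightarrow> real"
  assumes f: "set_integrable lborel {0<..} f" and even: "\<And>x. f (- x) = f x" and "f 0 = 0"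
  shows "integrable lborel f" "(\<integral>x. f x \<partial>lborel) = 2 * (LINT x:{0<..}|lborel. f x)"
proof -
  let ?g = "\<lambda>x. indicator {0<..} x * f x"
  have g: "integrable lborel ?g" using f by (simp add: set_integrable_def)
  have g': "integrable lborel (\<lambda>x. ?g (0 + (- 1) * x))"
    by (rule lborel_integrable_real_affine[OF g]) simp
  have f_eq: "f x = ?g x + ?g (0 + (- 1) * x)" for x
    using even[of x] \<open>f 0 = 0\<close> by (cases x "0 :: real" rule: linorder_cases) auto
  show "integrable lborel f"
    by (subst f_eq[abs_def]) (intro Bochner_Integration.integrable_add g g')
  have "(\<integral>x. f x \<partial>lborel) = (\<integral>x. ?g x \<partial>lborel) + (\<integral>x. ?g (0 + (- 1) * x) \<partial>lborel)"
    by (subst f_eq[abs_def]) (rule Bochner_Integration.integral_add[OF g g'])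
  also have "(\<integral>x. ?g (0 + (- 1) * x) \<partial>lborel) = (\<integral>x. ?g x \<partial>lborel)"
    using lborel_integral_real_affine[of "- 1" ?g 0] by simp
  finally show "(\<integral>x. f x \<partial>lborel) = 2 * (LINT x:{0<..}|lborel. f x)"
    by (simp add: set_lebesgue_integral_def)
qed

lemma integral_fejer: "integrable lborel (fejer a)" "(\<integral>x. fejer a x \<partial>lborel) = pi * \<bar>a\<bar>"
proof -
  have pos: "integrable lborel (fejer b) \<and> (\<integral>x. fejer b x \<partial>lborel) = pi * b" if "0 < b" for b
    using integral_even_half_line[OF fejer_half_line(1)[OF that]] fejer_half_line(2)[OF that]
    by (simp add: fejer_def)
  have "fejer (- a) = fejer a" by (simp add: fun_eq_iff)
  moreover have "fejer 0 = (\<lambda>x. 0)" by (simp add: fun_eq_iff fejer_def)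
  ultimately have "integrable lborel (fejer a) \<and> (\<integral>x. fejer a x \<partial>lborel) = pi * \<bar>a\<bar>"
    using pos[of a] pos[of "- a"] by (cases a "0 :: real" rule: linorder_cases) auto
  then show "integrable lborel (fejer a)" "(\<integral>x. fejer a x \<partial>lborel) = pi * \<bar>a\<bar>" by auto
qed

definition fejer_law :: "real measure" where
  "fejer_law = density lborel (\<lambda>x. ennreal (fejer 1 x / pi))"

lemma sets_fejer_law [simp, measurable_cong]: "sets fejer_law = sets borel"
  by (simp add: fejer_law_def)

lemma space_fejer_law [simp]: "space fejer_law = UNIV"
  by (simp add: fejer_law_def)

lemma prob_space_fejer_law: "prob_space fejer_law"
proof
  have "emeasure fejer_law UNIV = (\<integral>\<^sup>+x. ennreal (fejer 1 x / pi) \<partial>lborel)"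
    by (simp add: fejer_law_def emeasure_density)
  also have "\<dots> = ennreal (\<integral>x. fejer 1 x / pi \<partial>lborel)"
    by (rule nn_integral_eq_integral) (auto simp: integral_fejer fejer_nonneg)
  finally show "emeasure fejer_law (space fejer_law) = 1" by (simp add: integral_fejer)
qed

interpretation fejer_law: real_distribution fejer_law
  by (intro real_distribution.intro real_distribution_axioms.intro prob_space_fejer_law) auto

lemma integral_fejer_law:
  fixes h :: "real \<Rightarrow> real"
  assumes [measurable]: "h \<in> borel_measurable borel"
  shows "(\<integral>x. h x \<partial>fejer_law) = (\<integral>x. fejer 1 x / pi * h x \<partial>lborel)"
  unfolding fejer_law_def by (subst integral_density) (auto simp: fejer_nonneg)

lemma char_fejer_law: "char fejer_law t = of_real (max 0 (1 - \<bar>t\<bar>))"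
proof -
  have "(\<integral>x. cos (t * x) \<partial>fejer_law) = (\<integral>x. (fejer (t + 1) x + fejer (t - 1) x - 2 * fejer t x) / (2 * pi) \<partial>lborel)"
    by (subst integral_fejer_law)
      (auto intro!: Bochner_Integration.integral_cong simp: fejer_def cos_add cos_diff algebra_simps add_divide_distrib diff_divide_distrib)
  also have "\<dots> = (\<bar>t + 1\<bar> + \<bar>t - 1\<bar> - 2 * \<bar>t\<bar>) / 2"
    by (simp add: integral_fejer field_simps)
  also have "\<dots> = max 0 (1 - \<bar>t\<bar>)" by (auto simp: max_def abs_if field_simps)
  finally have c: "(\<integral>x. cos (t * x) \<partial>fejer_law) = max 0 (1 - \<bar>t\<bar>)" .
  have "(\<integral>x. sin (t * x) \<partial>fejer_law) = (\<integral>x. fejer 1 x / pi * sin (t * x) \<partial>lborel)"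
    by (rule integral_fejer_law) simp
  also have "\<dots> = (\<integral>x. fejer 1 (0 + (- 1) * x) / pi * sin (t * (0 + (- 1) * x)) \<partial>lborel)"
    using lborel_integral_real_affine[of "- 1" "\<lambda>x. fejer 1 x / pi * sin (t * x)" 0] by simp
  also have "\<dots> = - (\<integral>x. fejer 1 x / pi * sin (t * x) \<partial>lborel)"
    by simp
  finally have s: "(\<integral>x. sin (t * x) \<partial>fejer_law) = 0"
    using integral_fejer_law[of "\<lambda>x. sin (t * x)"] by simp
  show ?thesis
    unfolding char_def by (subst iexp_integral) (auto intro: prob_space_fejer_law simp: c s)
qed

lemma fejer_law_tail:
  assumes "0 < a"
  shows "measure fejer_law {x. a < \<bar>x\<bar>} \<le> 4 / (pi * a)"
proof -
  let ?f = "\<lambda>x :: real. indicator {x. a < \<bar>x\<bar>} x / x\<^sup>2"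
  have p1: "(((\<lambda>x. - 1 / x) \<circ> real_of_ereal) \<longlongrightarrow> - 1 / a) (at_right (ereal a))"
    using assms by (auto simp: ereal_tendsto_simps intro!: tendsto_eq_intros)
  have "((\<lambda>x. - 1 / x) \<longlongrightarrow> (0 :: real)) at_top"
    by (intro tendsto_divide_0[OF tendsto_const] filterlim_at_top_imp_at_infinity filterlim_ident)
  then have p2: "(((\<lambda>x. - 1 / x) \<circ> real_of_ereal) \<longlongrightarrow> 0) (at_left \<infinity>)"
    by (simp add: ereal_tendsto_simps)
  have D: "((\<lambda>x. - 1 / x) has_real_derivative 1 / x\<^sup>2) (at x)" if "ereal a < ereal x" "ereal x < \<infinity>" for x
    using that assms by (auto intro!: derivative_eq_intros simp: power2_eq_square)
  have c: "isCont (\<lambda>x. 1 / x\<^sup>2) x" if "ereal a < ereal x" "ereal x < \<infinity>" for x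
    using that assms by (intro continuous_intros) auto
  have n: "AE x in lborel. ereal a < ereal x \<longrightarrow> ereal x < \<infinity> \<longrightarrow> 0 \<le> 1 / x\<^sup>2"
    by simp
  have z: "ereal a < \<infinity>" by simp
  have FTC: "set_integrable lborel (einterval a \<infinity>) (\<lambda>x. 1 / x\<^sup>2)"
    by (rule interval_integral_FTC_nonneg(1)[OF z _ _ n p1 p2]) (erule (1) D c)+
  have FTC2: "(LBINT x=a..\<infinity>. 1 / x\<^sup>2) = 0 - (- 1 / a)"
    by (rule interval_integral_FTC_nonneg(2)[OF z _ _ n p1 p2]) (erule (1) D c)+
  have ei: "einterval a \<infinity> = {a<..}" by (auto simp: einterval_def)
  have half: "indicator {0<..} x * ?f x = indicator {a<..} x * (1 / x\<^sup>2)" for x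
    using assms by (auto simp: indicator_def)
  have "(LINT x:{a<..}|lborel. 1 / x\<^sup>2) = 1 / a"
    using FTC2 by (simp add: interval_lebesgue_integral_def ei)
  with FTC have f: "set_integrable lborel {0<..} ?f" "(LINT x:{0<..}|lborel. ?f x) = 1 / a"
    unfolding set_integrable_def set_lebesgue_integral_def ei real_scaleR_def half .
  have F: "integrable lborel ?f" "(\<integral>x. ?f x \<partial>lborel) = 2 / a"
    using integral_even_half_line[OF f(1)] f(2) by (auto simp: indicator_def)
  have "measure fejer_law {x. a < \<bar>x\<bar>} = (\<integral>x. indicator {x. a < \<bar>x\<bar>} x \<partial>fejer_law)"
    by simp
  also have "\<dots> = (\<integral>x. fejer 1 x / pi * indicator {x. a < \<bar>x\<bar>} x \<partial>lborel)"
    by (rule integral_fejer_law) simp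
  also have "\<dots> \<le> (\<integral>x. 2 / pi * ?f x \<partial>lborel)"
  proof (rule integral_mono)
    show "integrable lborel (\<lambda>x. fejer 1 x / pi * indicator {x. a < \<bar>x\<bar>} x)"
      by (rule Bochner_Integration.integrable_bound[OF integral_fejer(1)[of 1, THEN integrable_divide[of _ _ pi]]])
        (auto simp: indicator_def fejer_nonneg)
    show "integrable lborel (\<lambda>x. 2 / pi * ?f x)" using F(1) by (rule integrable_mult_right)
    fix x :: real
    have "1 - cos x \<le> 2" using cos_ge_minus_one[of x] by linarith
    then have "fejer 1 x \<le> 2 / x\<^sup>2" unfolding fejer_def by (simp add: divide_right_mono)
    then show "fejer 1 x / pi * indicator {x. a < \<bar>x\<bar>} x \<le> 2 / pi * ?f x"
      by (auto simp: indicator_def divide_right_mono field_simps)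
  qed
  also have "\<dots> = 2 / pi * (2 / a)" by (simp only: integral_mult_right_zero F(2))
  finally have "measure fejer_law {x. a < \<bar>x\<bar>} \<le> 2 / pi * (2 / a)" .
  then show ?thesis by simp
qed

definition smoothed :: "real measure \<Rightarrow> real \<Rightarrow> real measure" where
  "smoothed \<mu> T = distr (\<mu> \<Otimes>\<^sub>M fejer_law) borel (\<lambda>z. fst z + snd z / T)"

context
  fixes \<mu> :: "real measure" and T :: real
  assumes \<mu>: "real_distribution \<mu>" and T: "0 < T"
begin

interpretation \<mu>: real_distribution \<mu> by (rule \<mu>)

interpretation P: pair_prob_space \<mu> fejer_law ..

lemma measurable_smoothing_sum [measurable]: "(\<lambda>z. fst z + snd z / T) \<in> borel_measurable (\<mu> \<Otimes>\<^sub>M fejer_law)"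
  by measurable

lemma space_product_fejer: "space (\<mu> \<Otimes>\<^sub>M fejer_law) = UNIV"
  by (simp only: space_pair_measure \<mu>.space_eq_univ space_fejer_law UNIV_Times_UNIV)

lemma real_distribution_smoothed: "real_distribution (smoothed \<mu> T)"
  unfolding smoothed_def
  by (intro real_distribution.intro real_distribution_axioms.intro P.prob_space_distr) auto

lemma char_smoothed: "char (smoothed \<mu> T) t = char \<mu> t * of_real (max 0 (1 - \<bar>t / T\<bar>))"
proof -
  let ?f = "\<lambda>z. iexp (t * fst z) * iexp (t / T * snd z)"
  have i: "integrable (\<mu> \<Otimes>\<^sub>M fejer_law) ?f"
    by (rule P.integrable_const_bound[of _ 1]) (auto simp: norm_mult simp del: of_real_mult)
  have "char (smoothed \<mu> T) t = (\<integral>z. ?f z \<partial>(\<mu> \<Otimes>\<^sub>M fejer_law))"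
    unfolding char_def smoothed_def
    by (subst integral_distr) (auto simp: distrib_left exp_add)
  also have "\<dots> = (\<integral>x. \<integral>y. ?f (x, y) \<partial>fejer_law \<partial>\<mu>)"
    by (rule P.integral_fst'[OF i, symmetric])
  also have "\<dots> = char \<mu> t * char fejer_law (t / T)"
    by (simp add: char_def)
  finally show ?thesis by (simp add: char_fejer_law)
qed

lemma cdf_smoothed: "cdf (smoothed \<mu> T) u = (\<integral>y. cdf \<mu> (u - y / T) \<partial>fejer_law)"
proof -
  let ?A = "{z. fst z + snd z / T \<le> u}"
  have [measurable]: "?A \<in> sets (\<mu> \<Otimes>\<^sub>M fejer_law)"
    using measurable_sets[OF measurable_smoothing_sum, of "{..u}"] by (simp add: vimage_def space_pair_measure)
  have i: "integrable (\<mu> \<Otimes>\<^sub>M fejer_law) (\<lambda>(x, y). indicator ?A (x, y) :: real)"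
    by (rule P.integrable_const_bound[of _ 1]) (auto simp: case_prod_beta)
  have "cdf (smoothed \<mu> T) u = measure (\<mu> \<Otimes>\<^sub>M fejer_law) ?A"
  proof -
    have "(\<lambda>z. fst z + snd z / T) -` {..u} \<inter> space (\<mu> \<Otimes>\<^sub>M fejer_law) = ?A"
      unfolding space_product_fejer by auto
    then show ?thesis
      unfolding cdf_def smoothed_def by (subst measure_distr) (simp_all only: measurable_smoothing_sum, simp)
  qed
  also have "\<dots> = (\<integral>z. (case z of (x, y) \<Rightarrow> indicator ?A (x, y)) \<partial>(\<mu> \<Otimes>\<^sub>M fejer_law))"
    by (simp add: case_prod_beta space_product_fejer)
  also have "\<dots> = (\<integral>y. \<integral>x. indicator ?A (x, y) \<partial>\<mu> \<partial>fejer_law)"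
    by (rule P.integral_snd[OF i, symmetric])
  also have "\<dots> = (\<integral>y. cdf \<mu> (u - y / T) \<partial>fejer_law)"
  proof (rule Bochner_Integration.integral_cong[OF refl])
    fix y
    have "indicator ?A (x, y) = (indicator {..u - y / T} x :: real)" for x
      by (auto simp: indicator_def)
    then show "(\<integral>x. indicator ?A (x, y) \<partial>\<mu>) = cdf \<mu> (u - y / T)"
      by (simp add: cdf_def)
  qed
  finally show ?thesis .
qed

lemma fejer_law_singleton: "measure fejer_law {c} = 0"
proof -
  have "emeasure fejer_law {c} = (\<integral>\<^sup>+x. ennreal (fejer 1 x / pi) * indicator {c} x \<partial>lborel)"
    by (simp add: fejer_law_def emeasure_density)
  also have "\<dots> = (\<integral>\<^sup>+x. 0 \<partial>(lborel :: real measure))"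
    using AE_lborel_singleton[of c] by (intro nn_integral_cong_AE) (auto elim!: eventually_mono)
  finally show ?thesis by (simp add: measure_def)
qed

lemma smoothed_singleton: "measure (smoothed \<mu> T) {a} = 0"
proof -
  let ?A = "{z. fst z + snd z / T = a}"
  have [measurable]: "?A \<in> sets (\<mu> \<Otimes>\<^sub>M fejer_law)"
    using measurable_sets[OF measurable_smoothing_sum, of "{a}"] by (simp add: vimage_def space_pair_measure)
  have i: "integrable (\<mu> \<Otimes>\<^sub>M fejer_law) (indicator ?A :: real \<times> real \<Rightarrow> real)"
    by (rule P.integrable_const_bound[of _ 1]) auto
  have "measure (smoothed \<mu> T) {a} = measure (\<mu> \<Otimes>\<^sub>M fejer_law) ?A"
  proof -
    have "(\<lambda>z. fst z + snd z / T) -` {a} \<inter> space (\<mu> \<Otimes>\<^sub>M fejer_law) = ?A"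
      unfolding space_product_fejer by auto
    then show ?thesis
      unfolding smoothed_def by (subst measure_distr) (simp_all only: measurable_smoothing_sum, simp)
  qed
  also have "\<dots> = (\<integral>z. indicator ?A z \<partial>(\<mu> \<Otimes>\<^sub>M fejer_law))"
    by (simp add: space_product_fejer)
  also have "\<dots> = (\<integral>x. \<integral>y. indicator ?A (x, y) \<partial>fejer_law \<partial>\<mu>)"
    by (rule P.integral_fst'[OF i, symmetric])
  also have "\<dots> = (\<integral>x. 0 \<partial>\<mu>)"
  proof (rule Bochner_Integration.integral_cong[OF refl])
    fix x
    have "indicator ?A (x, y) = (indicator {T * (a - x)} y :: real)" for y
      using T by (auto simp: indicator_def field_simps)
    then show "(\<integral>y. indicator ?A (x, y) \<partial>fejer_law) = (0 :: real)"
      by (simp add: fejer_law_singleton)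
  qed
  finally show ?thesis by simp
qed

end

text \<open>
  Adding an independent Fejer variable divided by \<open>T\<close> multiplies the characteristic function by
  \<open>max 0 (1 - |t|/T)\<close> and removes atoms.  In the difference of the two inversion integrals only
  \<open>|t| \<le> T\<close> contributes, and there the integrand is at most \<open>(2/|t|) \<epsilon> |t|\<close>.
\<close>

lemma smoothed_interval_bound:
  fixes \<mu> \<nu> :: "real measure"
  assumes \<mu>: "real_distribution \<mu>" and \<nu>: "real_distribution \<nu>" and T: "0 < T" and \<epsilon>: "0 \<le> \<epsilon>"
    and close: "\<And>t. \<bar>t\<bar> \<le> T \<Longrightarrow> norm (char \<mu> t - char \<nu> t) \<le> \<epsilon> * \<bar>t\<bar>"
    and ab: "a \<le> b"
  shows "\<bar>measure (smoothed \<mu> T) {a<..b} - measure (smoothed \<nu> T) {a<..b}\<bar> \<le> 2 * \<epsilon> * T / pi"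
proof -
  let ?h = "\<lambda>t. (iexp (- (t * a)) - iexp (- (t * b))) / (\<i> * of_real t)"
  interpret m: real_distribution "smoothed \<mu> T" by (rule real_distribution_smoothed[OF \<mu> T])
  interpret n: real_distribution "smoothed \<nu> T" by (rule real_distribution_smoothed[OF \<nu> T])
  define J where "J \<rho> r = 1 / (2 * pi) * (CLBINT t=-r..r. ?h t * char \<rho> t)" for \<rho> :: "real measure" and r :: real
  have lim: "(\<lambda>k. J (smoothed \<mu> T) (real k)) \<longlonglongrightarrow> of_real (measure (smoothed \<mu> T) {a<..b})"
    "(\<lambda>k. J (smoothed \<nu> T) (real k)) \<longlonglongrightarrow> of_real (measure (smoothed \<nu> T) {a<..b})"
    unfolding J_def
    using m.Levy_Inversion[OF ab smoothed_singleton[OF \<mu> T] smoothed_singleton[OF \<mu> T]]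
      n.Levy_Inversion[OF ab smoothed_singleton[OF \<nu> T] smoothed_singleton[OF \<nu> T]] by auto
  have J_eq: "J \<rho> r = 1 / (2 * pi) * (\<integral>t. indicator {- r<..<r} t *\<^sub>R (?h t * char \<rho> t) \<partial>lborel)" if "0 \<le> r" for \<rho> r
    using that by (simp add: J_def interval_lebesgue_integral_def set_lebesgue_integral_def einterval_eq)
  have h1: "norm (?h t) \<le> b - a" for t
    using Levy_Inversion_aux2[of "- b" "- a" t] ab by (cases "t = 0") auto
  have h2: "norm (?h t) * \<bar>t\<bar> \<le> 2" for t
  proof (cases "t = 0")
    case False
    have "norm (iexp (- (t * a)) - iexp (- (t * b))) \<le> norm (iexp (- (t * a))) + norm (iexp (- (t * b)))"
      by (rule norm_triangle_ineq4)
    also have "\<dots> = 2" by (simp only: norm_exp_i_times)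
    finally show ?thesis using False by (simp add: norm_divide norm_mult)
  qed simp
  have int: "integrable lborel (\<lambda>t. indicator {- r<..<r} t *\<^sub>R (?h t * char \<rho> t))"
    if \<rho>: "real_distribution \<rho>" for \<rho> and r :: real
  proof -
    interpret \<rho>: real_distribution \<rho> by (rule \<rho>)
    show ?thesis
    proof (rule integrableI_bounded_set_indicator[where B="b - a"])
      show "emeasure lborel {- r<..<r} < \<infinity>" by (cases "- r \<le> r") auto
      show "AE t in lborel. t \<in> {- r<..<r} \<longrightarrow> norm (?h t * char \<rho> t) \<le> b - a"
      proof (intro AE_I2 impI)
        fix t
        have "norm (?h t) * norm (char \<rho> t) \<le> (b - a) * 1"
          using h1[of t] \<rho>.cmod_char_le_1[of t] ab by (intro mult_mono) auto
        then show "norm (?h t * char \<rho> t) \<le> b - a" by (simp only: norm_mult mult_1_right)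
      qed
    qed simp_all
  qed
  have bnd: "norm (J (smoothed \<mu> T) r - J (smoothed \<nu> T) r) \<le> 2 * \<epsilon> * T / pi" if r: "0 \<le> r" for r
  proof -
    let ?D = "\<lambda>t. indicator {- r<..<r} t *\<^sub>R (?h t * char (smoothed \<mu> T) t) - indicator {- r<..<r} t *\<^sub>R (?h t * char (smoothed \<nu> T) t)"
    note im = int[OF real_distribution_smoothed[OF \<mu> T], of r] and jn = int[OF real_distribution_smoothed[OF \<nu> T], of r]
    have "J (smoothed \<mu> T) r - J (smoothed \<nu> T) r = 1 / (2 * pi) * (\<integral>t. ?D t \<partial>lborel)"
      unfolding J_eq[OF r] Bochner_Integration.integral_diff[OF im jn] by (simp only: right_diff_distrib)
    then have Jn: "norm (J (smoothed \<mu> T) r - J (smoothed \<nu> T) r) = 1 / (2 * pi) * norm (\<integral>t. ?D t \<partial>lborel)"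
      by (simp add: norm_mult norm_divide)
    have "norm (\<integral>t. ?D t \<partial>lborel) \<le> (\<integral>t. norm (?D t) \<partial>lborel)"
      by (rule integral_norm_bound)
    also have "\<dots> \<le> (\<integral>t. 2 * \<epsilon> * indicator {- T..T} t \<partial>lborel)"
    proof (rule integral_mono)
      show "integrable lborel (\<lambda>t. norm (?D t))"
        by (intro integrable_norm Bochner_Integration.integrable_diff im jn)
      show "integrable lborel (\<lambda>t. 2 * \<epsilon> * indicator {- T..T} t)"
        using T by (intro integrable_mult_right) (auto simp: integrable_indicator_iff)
      fix t
      let ?w = "max 0 (1 - \<bar>t / T\<bar>)"
      have D: "?D t = indicator {- r<..<r} t *\<^sub>R (?h t * (char \<mu> t - char \<nu> t) * of_real ?w)"
        by (simp only: char_smoothed[OF \<mu> T] char_smoothed[OF \<nu> T] scaleR_diff_right[symmetric]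
          right_diff_distrib[symmetric] left_diff_distrib[symmetric] mult.assoc)
      have "norm (?D t) = indicator {- r<..<r} t * (norm (?h t) * norm (char \<mu> t - char \<nu> t) * ?w)"
        unfolding D by (simp only: norm_scaleR norm_mult norm_of_real) simp
      also have "\<dots> \<le> 1 * (norm (?h t) * norm (char \<mu> t - char \<nu> t) * ?w)"
        by (intro mult_right_mono) (auto simp: indicator_def)
      also have "\<dots> \<le> 2 * \<epsilon> * indicator {- T..T} t"
      proof (cases "\<bar>t\<bar> \<le> T")
        case True
        have "norm (?h t) * norm (char \<mu> t - char \<nu> t) * ?w \<le> (norm (?h t) * (\<epsilon> * \<bar>t\<bar>)) * 1"
          by (intro mult_mono mult_left_mono close True) (auto simp: \<epsilon> T)
        also have "\<dots> = \<epsilon> * (norm (?h t) * \<bar>t\<bar>)" by simp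
        also have "\<dots> \<le> \<epsilon> * 2" by (intro mult_left_mono h2 \<epsilon>)
        finally show ?thesis using True by (simp add: indicator_def abs_le_iff)
      next
        case False
        then have "?w = 0" using T by (simp add: max_def field_simps)
        then show ?thesis using \<epsilon> by simp
      qed
      finally show "norm (?D t) \<le> 2 * \<epsilon> * indicator {- T..T} t" .
    qed
    also have "\<dots> = 2 * \<epsilon> * (2 * T)"
      using T by simp
    finally have "1 / (2 * pi) * norm (\<integral>t. ?D t \<partial>lborel) \<le> 1 / (2 * pi) * (2 * \<epsilon> * (2 * T))"
      by (rule mult_left_mono) simp
    also have "1 / (2 * pi) * (2 * \<epsilon> * (2 * T)) = 2 * \<epsilon> * T / pi" by simp
    finally show ?thesis unfolding Jn .
  qed
  have "(\<lambda>k. norm (J (smoothed \<mu> T) (real k) - J (smoothed \<nu> T) (real k))) \<longlonglongrightarrow>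
      norm (complex_of_real (measure (smoothed \<mu> T) {a<..b}) - of_real (measure (smoothed \<nu> T) {a<..b}))"
    by (intro tendsto_intros lim)
  then have "norm (complex_of_real (measure (smoothed \<mu> T) {a<..b}) - of_real (measure (smoothed \<nu> T) {a<..b})) \<le> 2 * \<epsilon> * T / pi"
    by (rule LIMSEQ_le_const2) (intro exI[of _ 0] allI impI bnd, simp)
  then show ?thesis by (simp only: norm_of_real flip: of_real_diff)
qed

lemma smoothed_cdf_bound:
  fixes \<mu> \<nu> :: "real measure"
  assumes \<mu>: "real_distribution \<mu>" and \<nu>: "real_distribution \<nu>" and T: "0 < T" and \<epsilon>: "0 \<le> \<epsilon>"
    and close: "\<And>t. \<bar>t\<bar> \<le> T \<Longrightarrow> norm (char \<mu> t - char \<nu> t) \<le> \<epsilon> * \<bar>t\<bar>"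
  shows "\<bar>cdf (smoothed \<mu> T) u - cdf (smoothed \<nu> T) u\<bar> \<le> 2 * \<epsilon> * T / pi"
proof -
  interpret m: real_distribution "smoothed \<mu> T" by (rule real_distribution_smoothed[OF \<mu> T])
  interpret n: real_distribution "smoothed \<nu> T" by (rule real_distribution_smoothed[OF \<nu> T])
  let ?c = "\<lambda>k. (cdf (smoothed \<mu> T) u - cdf (smoothed \<mu> T) (- real k)) - (cdf (smoothed \<nu> T) u - cdf (smoothed \<nu> T) (- real k))"
  have at: "filterlim (\<lambda>k. - real k) at_bot sequentially"
    by (rule filterlim_compose[OF filterlim_uminus_at_bot_at_top filterlim_real_sequentially])
  have "(\<lambda>k. \<bar>?c k\<bar>) \<longlonglongrightarrow> \<bar>(cdf (smoothed \<mu> T) u - 0) - (cdf (smoothed \<nu> T) u - 0)\<bar>"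
    by (intro tendsto_intros filterlim_compose[OF m.cdf_lim_at_bot at] filterlim_compose[OF n.cdf_lim_at_bot at])
  moreover have "\<exists>N. \<forall>k\<ge>N. \<bar>?c k\<bar> \<le> 2 * \<epsilon> * T / pi"
  proof (intro exI allI impI)
    fix k assume "nat \<lceil>- u\<rceil> + 1 \<le> k"
    then have k: "- real k < u" by linarith
    show "\<bar>?c k\<bar> \<le> 2 * \<epsilon> * T / pi"
      unfolding m.cdf_diff_eq[OF k] n.cdf_diff_eq[OF k]
      by (rule smoothed_interval_bound[OF \<mu> \<nu> T \<epsilon> close]) (use k in auto)
  qed
  ultimately show ?thesis
    using LIMSEQ_le_const2 by fastforce
qed

lemma cdf_std_normal_lipschitz:
  assumes "x \<le> y"
  shows "cdf std_normal_distribution y - cdf std_normal_distribution x \<le> (y - x) / 2"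
proof (cases "x < y")
  case True
  have d: "std_normal_density z \<le> 1 / 2" for z
  proof -
    have "2 \<le> sqrt (2 * pi)" using pi_ge_two by (intro real_le_rsqrt) (simp add: power2_eq_square)
    then have "1 / sqrt (2 * pi) * exp (- z\<^sup>2 / 2) \<le> 1 / 2 * 1"
      by (intro mult_mono) (auto simp: field_simps)
    then show ?thesis by (simp add: std_normal_density_def)
  qed
  have "emeasure std_normal_distribution {x<..y} = (\<integral>\<^sup>+z. ennreal (std_normal_density z) * indicator {x<..y} z \<partial>lborel)"
    by (rule emeasure_density) auto
  also have "\<dots> \<le> (\<integral>\<^sup>+z. ennreal (1 / 2) * indicator {x<..y} z \<partial>lborel)"
    using d by (intro nn_integral_mono mult_right_mono ennreal_leI) auto
  also have "\<dots> = ennreal (1 / 2) * emeasure lborel {x<..y}"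
    by (rule nn_integral_cmult_indicator) simp
  also have "\<dots> = ennreal (1 / 2) * ennreal (y - x)"
    using True by simp
  also have "\<dots> = ennreal (1 / 2 * (y - x))"
    using True by (intro ennreal_mult[symmetric]) auto
  finally have "measure std_normal_distribution {x<..y} \<le> (y - x) / 2"
    using True by (simp add: std_normal.emeasure_eq_measure)
  then show ?thesis by (simp add: std_normal.cdf_diff_eq[OF True])
qed (use assms in auto)

text \<open>
  Suppose the difference \<open>\<Delta>\<close> of the distribution functions is almost \<open>\<eta> = sup |\<Delta>|\<close> at \<open>u0\<close>.  It decreases
  to the right of \<open>u0\<close> at rate at most \<open>1/2\<close>, so it stays above \<open>\<eta>/2\<close> on an interval of length
  \<open>\<eta>\<close>.  Averaging \<open>\<Delta>\<close> around the centre of this interval with the Fejer law at scale \<open>1/T\<close> loses only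
  \<open>3\<eta>/2\<close> times the mass outside, which is at most \<open>8 / (\<pi> T \<eta>)\<close>.  If \<open>\<Delta>\<close> is almost \<open>-\<eta>\<close>, the same
  holds to the left of \<open>u0\<close>.
\<close>

theorem esseen_smoothing:
  fixes \<mu> :: "real measure"
  assumes \<mu>: "real_distribution \<mu>" and T: "0 < T" and \<epsilon>: "0 \<le> \<epsilon>"
    and close: "\<And>t. \<bar>t\<bar> \<le> T \<Longrightarrow> norm (char \<mu> t - char std_normal_distribution t) \<le> \<epsilon> * \<bar>t\<bar>"
  shows "(SUP u. \<bar>cdf \<mu> u - cdf std_normal_distribution u\<bar>) \<le> 2 * \<epsilon> * T + 8 / T"
proof -
  let ?N = std_normal_distribution
  interpret \<mu>: real_distribution \<mu> by (rule \<mu>)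
  define \<Delta> where "\<Delta> u = cdf \<mu> u - cdf ?N u" for u
  define \<eta> where "\<eta> = (SUP u. \<bar>\<Delta> u\<bar>)"
  define \<beta> where "\<beta> = 2 * \<epsilon> * T / pi"
  have \<Delta>1: "\<bar>\<Delta> u\<bar> \<le> 1" for u
    using \<mu>.cdf_nonneg[of u] \<mu>.cdf_bounded_prob[of u] std_normal.cdf_nonneg[of u] std_normal.cdf_bounded_prob[of u]
    unfolding \<Delta>_def by linarith
  have bdd: "bdd_above (range (\<lambda>u. \<bar>\<Delta> u\<bar>))"
    by (rule bdd_aboveI2[of _ _ 1]) (rule \<Delta>1)
  have \<Delta>\<eta>: "\<bar>\<Delta> u\<bar> \<le> \<eta>" for u
    unfolding \<eta>_def by (rule cSUP_upper[OF _ bdd]) simp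
  have \<eta>0: "0 \<le> \<eta>" using \<Delta>\<eta>[of 0] by linarith
  have [measurable]: "cdf \<mu> \<in> borel_measurable borel" "cdf ?N \<in> borel_measurable borel"
    by (simp_all add: borel_measurable_mono mono_def \<mu>.cdf_nondecreasing std_normal.cdf_nondecreasing)
  have i: "integrable fejer_law (\<lambda>y. cdf \<mu> (u - y / T))" "integrable fejer_law (\<lambda>y. cdf ?N (u - y / T))" for u
    by (rule fejer_law.integrable_const_bound[of _ 1];
      auto simp: \<mu>.cdf_nonneg \<mu>.cdf_bounded_prob std_normal.cdf_nonneg std_normal.cdf_bounded_prob)+
  have iD: "integrable fejer_law (\<lambda>y. \<Delta> (u - y / T))" for u
    unfolding \<Delta>_def using i[of u] by (rule Bochner_Integration.integrable_diff)
  have S: "\<bar>\<integral>y. \<Delta> (u - y / T) \<partial>fejer_law\<bar> \<le> \<beta>" for u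
    using smoothed_cdf_bound[OF \<mu> real_dist_normal_dist T \<epsilon> close, of u]
    unfolding \<beta>_def \<Delta>_def cdf_smoothed[OF \<mu> T] cdf_smoothed[OF real_dist_normal_dist T] using i[of u] by simp
  have main: "\<eta> \<le> 2 * \<beta> + 24 / (pi * T) + 2 * e" if e: "0 < e" for e
  proof (cases "\<eta> = 0")
    case True
    then show ?thesis using \<epsilon> T e by (simp add: \<beta>_def)
  next
    case False
    then have \<eta>: "0 < \<eta>" using \<eta>0 by simp
    let ?B = "{y. T * \<eta> / 2 < \<bar>y\<bar>}"
    let ?p = "measure fejer_law ?B"
    have p: "\<eta> * ?p \<le> 8 / (pi * T)"
      using mult_left_mono[OF fejer_law_tail[of "T * \<eta> / 2"], of \<eta>] T \<eta> by (simp add: field_simps)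
    have iL: "integrable fejer_law (\<lambda>y. (\<eta> / 2 - e) - 3 / 2 * \<eta> * indicator ?B y)"
      by (intro Bochner_Integration.integrable_diff integrable_mult_right) (auto simp: fejer_law.emeasure_finite less_top[symmetric])
    have vL: "(\<integral>y. (\<eta> / 2 - e) - 3 / 2 * \<eta> * indicator ?B y \<partial>fejer_law) = \<eta> / 2 - e - 3 / 2 * (\<eta> * ?p)"
      by (subst Bochner_Integration.integral_diff)
        (auto simp: fejer_law.prob_space[simplified] fejer_law.emeasure_finite less_top[symmetric])
    obtain u0 where u0: "\<eta> - e < \<bar>\<Delta> u0\<bar>"
      using less_cSUP_iff[OF _ bdd, of "\<eta> - e"] e unfolding \<eta>_def[symmetric] by auto
    have mono: "\<Delta> x - (y - x) / 2 \<le> \<Delta> y" if "x \<le> y" for x y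
      using \<mu>.cdf_nondecreasing[OF that] cdf_std_normal_lipschitz[OF that] unfolding \<Delta>_def by linarith
    have "\<eta> / 2 - e - 3 / 2 * (\<eta> * ?p) \<le> \<beta>"
    proof (cases "0 \<le> \<Delta> u0")
      case True
      have "\<eta> / 2 - e - 3 / 2 * (\<eta> * ?p) \<le> (\<integral>y. \<Delta> ((u0 + \<eta> / 2) - y / T) \<partial>fejer_law)"
        unfolding vL[symmetric]
      proof (rule integral_mono[OF iL iD])
        fix y
        show "(\<eta> / 2 - e) - 3 / 2 * \<eta> * indicator ?B y \<le> \<Delta> ((u0 + \<eta> / 2) - y / T)"
        proof (cases "y \<in> ?B")
          case True
          then show ?thesis using \<Delta>\<eta>[of "(u0 + \<eta> / 2) - y / T"] e by (simp add: abs_le_iff)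
        next
          case False
          then have "\<bar>y / T\<bar> \<le> \<eta> / 2" using T by (simp add: abs_divide pos_divide_le_eq mult.commute)
          then have y: "y / T \<le> \<eta> / 2" "- (\<eta> / 2) \<le> y / T" by linarith+
          have "\<Delta> u0 - ((u0 + \<eta> / 2 - y / T) - u0) / 2 \<le> \<Delta> (u0 + \<eta> / 2 - y / T)"
            using y by (intro mono) linarith
          moreover have "\<eta> - e < \<Delta> u0" using u0 \<open>0 \<le> \<Delta> u0\<close> by simp
          ultimately have "\<eta> / 2 - e \<le> \<Delta> (u0 + \<eta> / 2 - y / T)" using y by argo
          then show ?thesis using False by simp
        qed
      qed
      also have "\<dots> \<le> \<beta>" using S[of "u0 + \<eta> / 2"] by (simp add: abs_le_iff)
      finally show ?thesis .
    next
      case neg: False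
      have "\<eta> / 2 - e - 3 / 2 * (\<eta> * ?p) \<le> (\<integral>y. - \<Delta> ((u0 - \<eta> / 2) - y / T) \<partial>fejer_law)"
        unfolding vL[symmetric]
      proof (rule integral_mono[OF iL integrable_minus[OF iD]])
        fix y
        show "(\<eta> / 2 - e) - 3 / 2 * \<eta> * indicator ?B y \<le> - \<Delta> ((u0 - \<eta> / 2) - y / T)"
        proof (cases "y \<in> ?B")
          case True
          then show ?thesis using \<Delta>\<eta>[of "(u0 - \<eta> / 2) - y / T"] e by (simp add: abs_le_iff)
        next
          case False
          then have "\<bar>y / T\<bar> \<le> \<eta> / 2" using T by (simp add: abs_divide pos_divide_le_eq mult.commute)
          then have y: "y / T \<le> \<eta> / 2" "- (\<eta> / 2) \<le> y / T" by linarith+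
          have "\<Delta> (u0 - \<eta> / 2 - y / T) - (u0 - (u0 - \<eta> / 2 - y / T)) / 2 \<le> \<Delta> u0"
            using y by (intro mono) linarith
          moreover have "\<eta> - e < - \<Delta> u0" using u0 neg by simp
          ultimately have "\<eta> / 2 - e \<le> - \<Delta> (u0 - \<eta> / 2 - y / T)" using y by argo
          then show ?thesis using False by simp
        qed
      qed
      also have "\<dots> \<le> \<beta>" using S[of "u0 - \<eta> / 2"] by (simp add: abs_le_iff)
      finally show ?thesis .
    qed
    then show ?thesis using p by (simp add: field_simps)
  qed
  have "\<eta> \<le> 2 * \<beta> + 24 / (pi * T)"
  proof (rule field_le_epsilon)
    fix e :: real assume "0 < e"
    then show "\<eta> \<le> 2 * \<beta> + 24 / (pi * T) + e" using main[of "e / 2"] by simp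
  qed
  also have "\<dots> \<le> 2 * \<epsilon> * T + 8 / T"
  proof (intro add_mono)
    have "2 * \<epsilon> * T * 2 \<le> 2 * \<epsilon> * T * pi"
      using \<epsilon> T pi_ge_two by (intro mult_left_mono) auto
    then show "2 * \<beta> \<le> 2 * \<epsilon> * T" by (simp add: \<beta>_def field_simps)
    have "24 * T \<le> (8 * T) * pi" using T pi_gt3 by simp
    then show "24 / (pi * T) \<le> 8 / T" using T by (simp add: field_simps)
  qed
  finally show ?thesis by (simp add: \<eta>_def \<Delta>_def)
qed

section \<open>The Berry--Esseen bound\<close>

lemma square_le_exp:
  fixes x :: real
  assumes "300 \<le> x"
  shows "300 * x\<^sup>2 \<le> 8 * exp x"
proof -
  have "x / 4 \<le> exp (x / 4)" using exp_ge_add_one_self[of "x / 4"] by linarith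
  then have "(x / 4) ^ 4 \<le> exp (x / 4) ^ 4" using assms by (intro power_mono) auto
  also have "\<dots> = exp x" by (simp flip: exp_of_nat_mult)
  finally have "x ^ 4 \<le> 256 * exp x" by (simp add: power_divide)
  moreover have "90000 * x\<^sup>2 \<le> x\<^sup>2 * x\<^sup>2"
    using power_mono[of 300 x 2] assms by (intro mult_right_mono) auto
  then have "90000 * x\<^sup>2 \<le> x ^ 4" by (simp flip: power_add)
  ultimately show ?thesis using exp_ge_zero[of x] by linarith
qed

text \<open>
  The value of \<open>T\<close> makes \<open>T\<^sup>2\<delta>/\<tau>\<^sup>2 = L/4\<close>.  Then the factor \<open>exp(t\<^sup>2\<delta>)\<close> costs at most \<open>exp(L/4)\<close>, while the error
  terms carry \<open>\<delta>/\<tau>\<^sup>3 = exp(- L)\<close> and \<open>1/\<tau> \<le> 5 exp(- L)\<close>.  What remains is \<open>exp(- 3L/4)\<close> times a polynomial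
  in \<open>T\<close>, and \<open>T\<^sup>2 \<le> 5L/4\<close>.
\<close>

lemma nontrivial_regime:
  fixes \<delta> \<tau> L T :: real
  assumes \<delta>: "0 < \<delta>" and \<tau>: "0 < \<tau>" and le: "\<tau>\<^sup>2 \<le> 5 * \<delta>"
    and L: "0 < L" "exp L = \<tau> ^ 3 / \<delta>" and big: "2304 * \<delta> < \<tau>\<^sup>2 * L"
    and T: "T = sqrt (\<tau>\<^sup>2 * L / (4 * \<delta>))"
  defines "\<epsilon> \<equiv> exp (- 3 * L / 4) * (86 * T\<^sup>2 + 5 * T)"
  shows "0 < T" and "0 \<le> \<epsilon>"
    and "\<And>s. 0 \<le> s \<Longrightarrow> s \<le> T \<Longrightarrow>
      exp ((s / \<tau>)\<^sup>2 * \<delta>) * (86 * (s / \<tau>) ^ 3 * \<delta> + (s / \<tau>)\<^sup>2 * \<tau>) \<le> \<epsilon> * s"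
    and "2 * \<epsilon> * T + 8 / T \<le> 48 * sqrt (\<delta> / (\<tau>\<^sup>2 * L))"
proof -
  have T2: "T\<^sup>2 = \<tau>\<^sup>2 * L / (4 * \<delta>)" unfolding T using \<delta> L by simp
  show T0: "0 < T" unfolding T using \<delta> \<tau> L by simp
  then show \<epsilon>0: "0 \<le> \<epsilon>" by (simp add: \<epsilon>_def)
  have "2304 * \<delta> < (5 * \<delta>) * L"
    using big mult_right_mono[OF le, of L] L by linarith
  then have L460: "460 < L" using \<delta> by simp
  have "576 < T\<^sup>2" unfolding T2 using big \<delta> by (simp add: field_simps)
  then have T1: "1 \<le> T" using T0 by (intro power2_le_imp_le[of 1 T]) auto
  have T2L: "T\<^sup>2 \<le> 5 / 4 * L"
    unfolding T2 using mult_right_mono[OF le, of L] L \<delta> by (simp add: field_simps)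
  have mL: "exp (- L) = \<delta> / \<tau> ^ 3" using L(2) by (simp add: exp_minus)
  have inv: "1 / \<tau> \<le> 5 * exp (- L)"
  proof -
    have "\<tau>\<^sup>2 * \<tau>\<^sup>2 \<le> (5 * \<delta>) * \<tau>\<^sup>2" by (intro mult_right_mono le) simp
    then show ?thesis unfolding mL using \<tau> by (simp add: field_simps eval_nat_numeral)
  qed
  show "exp ((s / \<tau>)\<^sup>2 * \<delta>) * (86 * (s / \<tau>) ^ 3 * \<delta> + (s / \<tau>)\<^sup>2 * \<tau>) \<le> \<epsilon> * s"
    if s: "0 \<le> s" "s \<le> T" for s
  proof -
    have s2: "s\<^sup>2 \<le> T\<^sup>2" using s by (intro power_mono) auto
    then have "s\<^sup>2 * (\<delta> / \<tau>\<^sup>2) \<le> T\<^sup>2 * (\<delta> / \<tau>\<^sup>2)" using \<delta> by (intro mult_right_mono) auto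
    also have "\<dots> = L / 4" unfolding T2 using \<delta> \<tau> by simp
    finally have 1: "exp ((s / \<tau>)\<^sup>2 * \<delta>) \<le> exp (L / 4)" by (simp add: power_divide)
    have "86 * (s / \<tau>) ^ 3 * \<delta> = 86 * (s\<^sup>2 * s) * exp (- L)"
      unfolding mL by (simp add: power_divide power2_eq_square power3_eq_cube)
    also have "\<dots> \<le> 86 * (T\<^sup>2 * s) * exp (- L)"
      using s s2 by (intro mult_left_mono mult_right_mono) auto
    finally have 2: "86 * (s / \<tau>) ^ 3 * \<delta> \<le> 86 * (T\<^sup>2 * s) * exp (- L)" .
    have "(s / \<tau>)\<^sup>2 * \<tau> = (s * s) * (1 / \<tau>)" using \<tau> by (simp add: power2_eq_square)
    also have "\<dots> \<le> (T * s) * (5 * exp (- L))"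
      using s T0 \<tau> by (intro mult_mono inv mult_right_mono) auto
    finally have 3: "(s / \<tau>)\<^sup>2 * \<tau> \<le> (T * s) * (5 * exp (- L))" .
    have e: "exp (L / 4) * exp (- L) = exp (- 3 * L / 4)" by (simp flip: exp_add)
    have "exp ((s / \<tau>)\<^sup>2 * \<delta>) * (86 * (s / \<tau>) ^ 3 * \<delta> + (s / \<tau>)\<^sup>2 * \<tau>) \<le>
        exp (L / 4) * (86 * (T\<^sup>2 * s) * exp (- L) + (T * s) * (5 * exp (- L)))"
      using s \<delta> \<tau> by (intro mult_mono add_mono 1 2 3) auto
    also have "\<dots> = (exp (L / 4) * exp (- L)) * (86 * T\<^sup>2 + 5 * T) * s"
      by (simp add: algebra_simps)
    finally show ?thesis unfolding e \<epsilon>_def .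
  qed
  have "\<epsilon> * T\<^sup>2 \<le> 8"
  proof -
    have "T \<le> T\<^sup>2" using T1 by (simp add: power2_eq_square)
    then have "\<epsilon> * T\<^sup>2 \<le> exp (- 3 * L / 4) * (91 * T\<^sup>2) * T\<^sup>2"
      unfolding \<epsilon>_def by (intro mult_right_mono mult_left_mono) auto
    also have "\<dots> = 91 * exp (- 3 * L / 4) * (T\<^sup>2)\<^sup>2"
      by (simp add: power2_eq_square)
    also have "\<dots> \<le> 91 * exp (- 3 * L / 4) * (5 / 4 * L)\<^sup>2"
      by (intro mult_left_mono power_mono T2L) auto
    also have "\<dots> \<le> exp (- 3 * L / 4) * (300 * (3 * L / 4)\<^sup>2)"
      using L(1) by (simp add: power2_eq_square)
    also have "\<dots> \<le> exp (- 3 * L / 4) * (8 * exp (3 * L / 4))"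
      using L460 by (intro mult_left_mono square_le_exp) auto
    also have "\<dots> = 8" by (simp flip: exp_add)
    finally show ?thesis .
  qed
  then have "2 * \<epsilon> * T + 8 / T \<le> 24 / T"
  proof -
    have "2 * \<epsilon> * T = 2 * (\<epsilon> * T\<^sup>2) / T" using T0 by (simp add: power2_eq_square)
    also have "\<dots> \<le> 16 / T" using \<open>\<epsilon> * T\<^sup>2 \<le> 8\<close> T0 by (intro divide_right_mono) auto
    finally show ?thesis by simp
  qed
  also have "24 / T = 48 * sqrt (\<delta> / (\<tau>\<^sup>2 * L))"
  proof -
    have nn: "0 \<le> \<delta> / (\<tau>\<^sup>2 * L)" using \<delta> L(1) by simp
    have "2 * sqrt (\<delta> / (\<tau>\<^sup>2 * L)) = 1 / T"
    proof (rule power2_eq_imp_eq)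
      have "(2 * sqrt (\<delta> / (\<tau>\<^sup>2 * L)))\<^sup>2 = 4 * (\<delta> / (\<tau>\<^sup>2 * L))"
        by (simp only: power_mult_distrib real_sqrt_pow2[OF nn]) simp
      also have "\<dots> = (1 / T)\<^sup>2"
        by (simp only: power_divide T2) simp
      finally show "(2 * sqrt (\<delta> / (\<tau>\<^sup>2 * L)))\<^sup>2 = (1 / T)\<^sup>2" .
      show "0 \<le> 2 * sqrt (\<delta> / (\<tau>\<^sup>2 * L))"
        using real_sqrt_ge_zero[OF nn] by (rule mult_nonneg_nonneg[rotated]) simp
      show "0 \<le> 1 / T" using T0 by simp
    qed
    then have "48 * sqrt (\<delta> / (\<tau>\<^sup>2 * L)) = 24 * (1 / T)" by linarith
    then show ?thesis by simp
  qed
  finally show "2 * \<epsilon> * T + 8 / T \<le> 48 * sqrt (\<delta> / (\<tau>\<^sup>2 * L))" .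
qed

text \<open>
  The probabilities of the values \<open>0, ..., d\<close> add up to one, so \<open>V\<close> takes no other value almost surely.
\<close>

lemma (in prob_space) expectation_finite_support:
  fixes h :: "real \<Rightarrow> 'b::{banach, second_countable_topology}"
  assumes V [measurable]: "V \<in> borel_measurable M" and h [measurable]: "h \<in> borel_measurable borel"
    and p: "\<And>j. j \<le> d \<Longrightarrow> measure M {\<omega> \<in> space M. V \<omega> = real j} = v j" and v: "(\<Sum>j\<le>d. v j) = 1"
  shows "(\<integral>\<omega>. h (V \<omega>) \<partial>M) = (\<Sum>j\<le>d. v j *\<^sub>R h (real j))"
proof -
  define A where "A j = {\<omega> \<in> space M. V \<omega> = real j}" for j
  have A [measurable]: "A j \<in> sets M" for j unfolding A_def by measurable
  have "prob (\<Union>j\<le>d. A j) = (\<Sum>j\<le>d. prob (A j))"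
    by (rule finite_measure_finite_Union) (auto simp: disjoint_family_on_def A_def)
  also have "\<dots> = 1" unfolding v[symmetric] by (rule sum.cong) (auto simp: A_def p)
  finally have "AE \<omega> in M. \<omega> \<in> (\<Union>j\<le>d. A j)"
    by (subst (asm) prob_eq_1) auto
  then have ae: "AE \<omega> in M. h (V \<omega>) = (\<Sum>j\<le>d. indicator (A j) \<omega> *\<^sub>R h (real j))"
  proof eventually_elim
    case (elim \<omega>)
    then obtain k where k: "k \<le> d" "\<omega> \<in> A k" by auto
    then have "indicator (A j) \<omega> *\<^sub>R h (real j) = (if j = k then h (V \<omega>) else 0)" for j
      by (auto simp: A_def indicator_def)
    then show ?case using k by simp
  qed
  have "(\<integral>\<omega>. h (V \<omega>) \<partial>M) = (\<integral>\<omega>. (\<Sum>j\<le>d. indicator (A j) \<omega> *\<^sub>R h (real j)) \<partial>M)"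
    by (rule integral_cong_AE[OF _ _ ae]) measurable
  also have "\<dots> = (\<Sum>j\<le>d. prob (A j) *\<^sub>R h (real j))"
    by (subst Bochner_Integration.integral_sum) (auto simp: emeasure_eq_measure)
  also have "\<dots> = (\<Sum>j\<le>d. v j *\<^sub>R h (real j))"
    by (rule sum.cong) (auto simp: A_def p)
  finally show ?thesis .
qed

theorem theorem5p1:
  fixes C :: "(real ^ 'n) set" and v :: "nat \<Rightarrow> real"
    and M :: "'w measure" and V :: "'w \<Rightarrow> real"
    and \<delta> \<tau> \<eta> :: real and F \<Phi> :: "real \<Rightarrow> real"
  assumes "closed C" and "convex_cone C" and "C \<noteq> {}" and "C \<noteq> UNIV"
    and "conic_intrinsic_volumes C v"
    and "prob_space M" and "V \<in> borel_measurable M"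
    and "\<And>j. j \<le> CARD('n) \<Longrightarrow> measure M {\<omega> \<in> space M. V \<omega> = real j} = v j"
    and "\<delta> = prob_space.expectation M V"
    and "\<tau>\<^sup>2 = prob_space.variance M V" and "\<tau> > 0"
    and "F = cdf (distr M borel (\<lambda>\<omega>. (V \<omega> - \<delta>) / \<tau>))"
    and "\<Phi> = cdf std_normal_distribution"
    and "\<eta> = (SUP u. \<bar>F u - \<Phi> u\<bar>)"
  shows "ereal \<eta> \<le>
    ereal (1 / 108 * max (\<tau> / \<delta> ^ 3) (1 / \<delta> powr (8 / 3)) powr (3 / 16)
        * log_plus (\<tau> ^ 3 / \<delta>) powr (3 / 2)
        * log_plus (\<tau>\<^sup>2 / (144 * \<delta>) * log_plus (\<tau> ^ 3 / \<delta>)))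
    + 48 * ereal_sqrt (ereal \<delta> / ereal (\<tau>\<^sup>2 * log_plus (\<tau> ^ 3 / \<delta>)))"
proof -
  interpret M: prob_space M by fact
  have [measurable]: "V \<in> borel_measurable M" by fact
  have v: "\<And>j. j \<le> CARD('n) \<Longrightarrow> 0 \<le> v j" "(\<Sum>j\<le>CARD('n). v j) = 1"
    using assms(5) unfolding conic_intrinsic_volumes_def by auto
  note ex = M.expectation_finite_support[OF assms(7) _ assms(8) v(2)]
  have cone: "cone_projection (closest_point C)"
    by (rule cone_projection_closest_point) fact+
  interpret cone: cone_projection "closest_point C" by (rule cone)
  have char: "(\<integral>x. iexp (t * cone.G x) \<partial>\<gamma>) = (\<Sum>j\<le>CARD('n). of_real (v j) * sq_char t ^ j)" for t
    unfolding cone.G_def by (rule intrinsic_volumes_char[OF cone assms(5)])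
  have \<delta>: "\<delta> = cone.\<delta>"
    unfolding assms(9) cone.intrinsic_volumes_moments(1)[OF char] using ex[of "\<lambda>x. x"] by simp
  have \<tau>2: "\<tau>\<^sup>2 = (\<Sum>j\<le>CARD('n). v j * (real j - cone.\<delta>)\<^sup>2)"
    unfolding assms(10) \<delta>[symmetric] using ex[of "\<lambda>x. (x - \<delta>)\<^sup>2"] by (simp add: assms(9))
  have \<tau>0: "0 < \<tau>" by fact
  have le: "\<tau>\<^sup>2 \<le> 5 * \<delta>"
    unfolding \<delta> by (rule cone.intrinsic_volumes_char_normal(1)[OF v char \<tau>0 \<tau>2])
  have \<delta>0: "0 < \<delta>" using le zero_less_power[OF \<tau>0, of 2] by linarith
  define L where "L = log_plus (\<tau> ^ 3 / \<delta>)"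
  define R where "R = 1 / 108 * max (\<tau> / \<delta> ^ 3) (1 / \<delta> powr (8 / 3)) powr (3 / 16)
        * L powr (3 / 2) * log_plus (\<tau>\<^sup>2 / (144 * \<delta>) * L)"
  have R: "0 \<le> R" unfolding R_def by (intro mult_nonneg_nonneg) (auto simp: log_plus_def)
  have "ereal \<eta> \<le> ereal R + 48 * ereal_sqrt (ereal \<delta> / ereal (\<tau>\<^sup>2 * L))"
  \<comment> \<open>For \<open>L = 0\<close> the quotient under the root has denominator zero and the bound is infinite.\<close>
  proof (cases "L = 0")
    case True
    then have "ereal \<delta> / ereal (\<tau>\<^sup>2 * L) = \<infinity>"
      using \<delta>0 by (simp add: divide_ereal_def zero_ereal_def[symmetric])
    then show ?thesis by (simp add: ereal_sqrt_def)
  next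
    case False
    have A: "0 < \<tau> ^ 3 / \<delta>" using \<tau>0 \<delta>0 by simp
    with False have L: "0 < L" "L = ln (\<tau> ^ 3 / \<delta>)"
      by (auto simp: L_def log_plus_def max_def split: if_splits)
    then have expL: "exp L = \<tau> ^ 3 / \<delta>" using A by simp
    have rhs: "48 * ereal_sqrt (ereal \<delta> / ereal (\<tau>\<^sup>2 * L)) = ereal (48 * sqrt (\<delta> / (\<tau>\<^sup>2 * L)))"
      using \<tau>0 L by (simp add: ereal_sqrt_def)
    let ?\<mu> = "distr M borel (\<lambda>\<omega>. (V \<omega> - \<delta>) / \<tau>)"
    have \<mu>: "real_distribution ?\<mu>"
      by (intro real_distribution.intro real_distribution_axioms.intro M.prob_space_distr) auto
    interpret \<mu>: real_distribution ?\<mu> by (rule \<mu>)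
    \<comment> \<open>The first summand of the bound is nonnegative, and the second one alone dominates \<open>\<eta>\<close>.\<close>
    have "\<eta> \<le> 48 * sqrt (\<delta> / (\<tau>\<^sup>2 * L))"
    proof (cases "2304 * \<delta> < \<tau>\<^sup>2 * L")
      case False
      have "\<eta> \<le> 1"
        unfolding assms(12-14)
      proof (rule cSUP_least)
        fix u
        show "\<bar>cdf ?\<mu> u - cdf std_normal_distribution u\<bar> \<le> 1"
          using \<mu>.cdf_nonneg[of u] \<mu>.cdf_bounded_prob[of u] std_normal.cdf_nonneg[of u] std_normal.cdf_bounded_prob[of u]
          by linarith
      qed simp
      also have "1 \<le> 48 * sqrt (\<delta> / (\<tau>\<^sup>2 * L))"
      proof -
        have "(1 / 48)\<^sup>2 \<le> \<delta> / (\<tau>\<^sup>2 * L)"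
          using False \<tau>0 L by (simp add: field_simps power2_eq_square)
        then have "1 / 48 \<le> sqrt (\<delta> / (\<tau>\<^sup>2 * L))" by (rule real_le_rsqrt)
        then show ?thesis by simp
      qed
      finally show ?thesis .
    next
      case True
      define T where "T = sqrt (\<tau>\<^sup>2 * L / (4 * \<delta>))"
      define \<epsilon> where "\<epsilon> = exp (- 3 * L / 4) * (86 * T\<^sup>2 + 5 * T)"
      note reg = nontrivial_regime[OF \<delta>0 \<tau>0 le L(1) expL True T_def, folded \<epsilon>_def]
      have pos: "norm (char ?\<mu> s - char std_normal_distribution s) \<le> \<epsilon> * s" if s: "0 \<le> s" "s \<le> T" for s
      proof -
        have "char ?\<mu> s = (\<integral>\<omega>. iexp (s * ((V \<omega> - \<delta>) / \<tau>)) \<partial>M)"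
          unfolding char_def by (rule integral_distr) simp_all
        also have "\<dots> = (\<Sum>j\<le>CARD('n). of_real (v j) * iexp (s / \<tau> * (real j - \<delta>)))"
          using ex[of "\<lambda>x. iexp (s * ((x - \<delta>) / \<tau>))"] by (simp add: scaleR_conv_of_real)
        finally have c: "char ?\<mu> s = (\<Sum>j\<le>CARD('n). of_real (v j) * iexp (s / \<tau> * (real j - \<delta>)))" .
        have n: "char std_normal_distribution s = of_real (exp (- \<tau>\<^sup>2 * (s / \<tau>)\<^sup>2 / 2))"
          using \<tau>0 by (simp add: char_std_normal_distribution power_divide)
        have "0 \<le> s / \<tau>" using s \<tau>0 by simp
        then have "norm (char ?\<mu> s - char std_normal_distribution s) \<le>
            exp ((s / \<tau>)\<^sup>2 * \<delta>) * (86 * (s / \<tau>) ^ 3 * \<delta> + (s / \<tau>)\<^sup>2 * \<tau>)"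
          unfolding c n unfolding \<delta> by (intro cone.intrinsic_volumes_char_normal(2)[OF v char \<tau>0 \<tau>2])
        also have "\<dots> \<le> \<epsilon> * s" by (rule reg(3)[OF s])
        finally show ?thesis .
      qed
      have close: "norm (char ?\<mu> t - char std_normal_distribution t) \<le> \<epsilon> * \<bar>t\<bar>" if "\<bar>t\<bar> \<le> T" for t
      proof (cases "0 \<le> t")
        case True
        then show ?thesis using pos[of t] that by simp
      next
        case False
        have cnj: "char \<rho> (- t) = cnj (char \<rho> t)" for \<rho> :: "real measure"
        proof -
          have "cnj (char \<rho> t) = (\<integral>x. cnj (iexp (t * x)) \<partial>\<rho>)"
            unfolding char_def by (rule Bochner_Integration.integral_cnj[symmetric])
          then show ?thesis by (simp add: char_def exp_cnj)
        qed
        have "norm (char ?\<mu> (- t) - char std_normal_distribution (- t)) \<le> \<epsilon> * (- t)"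
          using False that by (intro pos) auto
        then show ?thesis using False
          unfolding cnj complex_cnj_diff[symmetric] complex_mod_cnj by simp
      qed
      have "\<eta> \<le> 2 * \<epsilon> * T + 8 / T"
        unfolding assms(12-14) by (rule esseen_smoothing[OF \<mu> reg(1,2) close])
      also have "\<dots> \<le> 48 * sqrt (\<delta> / (\<tau>\<^sup>2 * L))" by (rule reg(4))
      finally show ?thesis .
    qed
    with R show ?thesis unfolding rhs by simp
  qed
  then show ?thesis unfolding R_def L_def .
qed

end
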